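(* Let $\mu$ be fixed with $2\mu\notin\mathbb Z$. For any pair of values $(a_\infty,\sigma_\infty)$, $\sigma_\infty\in[0,1)$ (with $a_\infty\ne0$ complex), there exists a unique branch of the solution of $\mathrm{PVI}_\mu$ with the asymptotic behaviour $$y(x)\sim a_\infty x^{\sigma_\infty}\big(1+O(x^{-\varepsilon})\big)\qquad\text{as }x\to\infty,$$ for some $\varepsilon>0$.
   Context: $\mathrm{PVI}_\mu$ is the equation $$y''=\tfrac12\Big(\tfrac1y+\tfrac1{y-1}+\tfrac1{y-x}\Big)y'^2-\Big(\tfrac1x+\tfrac1{x-1}+\tfrac1{y-x}\Big)y'+\tfrac12\,\frac{y(y-1)(y-x)}{x^2(x-1)^2}\Big[(2\mu-1)^2+\frac{x(x-1)}{(y-x)^2}\Big].$$ A neighbourhood of $x=\infty$ is cut along a ray so that powers of $x$ are well defined; a branch is a solution on such a punctured cut neighbourhood.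
   Formalization: The equation is imposed with denominators cleared; this is equivalent whenever y is not 0, 1 or x, and for the pair (a,σ)=(1,0), where the fractional equation has no such solution, the constant y=1 (0/0 in the fractional form) is admitted as the unique branch. *)

theory Defs
  imports "HOL-Complex_Analysis.Complex_Analysis" "HOL-Library.Landau_Symbols"
begin

definition PVI_rhs :: "complex \<Rightarrow> complex \<Rightarrow> complex \<Rightarrow> complex \<Rightarrow> complex" where
  "PVI_rhs \<mu> x y p =
     1/2 * (1/y + 1/(y - 1) + 1/(y - x)) * p^2
     - (1/x + 1/(x - 1) + 1/(y - x)) * p
     + 1/2 * (y * (y - 1) * (y - x)) / (x^2 * (x - 1)^2)
         * ((2 * \<mu> - 1)^2 + x * (x - 1) / (y - x)^2)"

text \<open>
  The equation \<open>q = PVI_rhs \<mu> x y p\<close>, with \<open>p = y'\<close> and \<open>q = y''\<close>, after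
  multiplication by \<open>2 x^2 (x-1)^2 y (y-1) (y-x)\<close>.  Clearing denominators avoids any
  dependence on the convention \<open>z / 0 = 0\<close> at points where \<open>y\<close> takes one of the values
  \<open>0\<close>, \<open>1\<close>, \<open>x\<close>; elsewhere it changes nothing (lemma \<open>PVI_eq_iff\<close>).  The constant
  \<open>y = 1\<close> (of type \<open>0/0\<close> in the fractional form) satisfies the cleared equation; it is the
  branch with exponent \<open>0\<close> and leading coefficient \<open>1\<close>.
\<close>

definition PVI_eq :: "complex \<Rightarrow> complex \<Rightarrow> complex \<Rightarrow> complex \<Rightarrow> complex \<Rightarrow> bool" where
  "PVI_eq \<mu> x y p q \<longleftrightarrow>
     2 * x^2 * (x - 1)^2 * y * (y - 1) * (y - x) * q =
       x^2 * (x - 1)^2 * ((y - 1) * (y - x) + y * (y - x) + y * (y - 1)) * p^2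
       - 2 * x * (x - 1) * y * (y - 1)
           * ((x - 1) * (y - x) + x * (y - x) + x * (x - 1)) * p
       + y^2 * (y - 1)^2 * ((2 * \<mu> - 1)^2 * (y - x)^2 + x * (x - 1))"

lemma PVI_eq_iff:
  assumes "x \<noteq> 0" "x \<noteq> 1" "y \<noteq> 0" "y \<noteq> 1" "y \<noteq> x"
  shows "PVI_eq \<mu> x y p q \<longleftrightarrow> q = PVI_rhs \<mu> x y p"
proof -
  define u v w where "u = x - 1" and "v = y - 1" and "w = y - x"
  have nz: "x \<noteq> 0" "u \<noteq> 0" "y \<noteq> 0" "v \<noteq> 0" "w \<noteq> 0"
    using assms by (auto simp: u_def v_def w_def)
  define M where "M = 2 * x^2 * u^2 * y * v * w"
  have M: "M \<noteq> 0" using nz by (simp add: M_def)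
  have "M * PVI_rhs \<mu> x y p =
       x^2 * u^2 * (v * w + y * w + y * v) * p^2
       - 2 * x * u * y * v * (u * w + x * w + x * u) * p
       + y^2 * v^2 * ((2 * \<mu> - 1)^2 * w^2 + x * u)"
    unfolding PVI_rhs_def u_def[symmetric] v_def[symmetric] w_def[symmetric] M_def
    using nz by (simp add: field_simps power2_eq_square)
  hence "PVI_eq \<mu> x y p q \<longleftrightarrow> M * q = M * PVI_rhs \<mu> x y p"
    unfolding PVI_eq_def u_def[symmetric] v_def[symmetric] w_def[symmetric]
    by (simp add: M_def)
  thus ?thesis using M by simp
qed

definition cut_nhd_infinity :: "real \<Rightarrow> real \<Rightarrow> complex set" where
  "cut_nhd_infinity \<phi> R = {x. norm x > R \<and> \<not> (\<exists>r\<ge>0. x = of_real r * cis \<phi>)}"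

text \<open>
  The logarithm that is continuous off the ray of argument \<open>\<phi>\<close>, with imaginary part in
  \<open>(\<phi>, \<phi> + 2 \<pi>)\<close> there.  As \<open>\<phi>\<close> runs over the reals this gives all rays and, for each
  ray, all determinations of the logarithm.
\<close>

definition cut_Ln :: "real \<Rightarrow> complex \<Rightarrow> complex" where
  "cut_Ln \<phi> x = Ln (- (x * cis (- \<phi>))) + \<i> * of_real (\<phi> + pi)"

definition cut_powr :: "real \<Rightarrow> complex \<Rightarrow> real \<Rightarrow> complex" where
  "cut_powr \<phi> x s = exp (of_real s * cut_Ln \<phi> x)"

lemma exp_cut_Ln:
  assumes "x \<noteq> 0"
  shows "exp (cut_Ln \<phi> x) = x"
proof -
  have "exp (\<i> * of_real (\<phi> + pi)) = cis (\<phi> + pi)"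
    by (simp add: cis_conv_exp)
  also have "\<dots> = - cis \<phi>" by (simp add: cis_mult [symmetric])
  finally have e: "exp (\<i> * of_real (\<phi> + pi)) = - cis \<phi>" .
  have "exp (cut_Ln \<phi> x) = - (x * cis (- \<phi>)) * (- cis \<phi>)"
    unfolding cut_Ln_def exp_add e using assms by simp
  also have "\<dots> = x * (cis (- \<phi>) * cis \<phi>)" by simp
  also have "\<dots> = x" by (subst cis_mult) simp
  finally show ?thesis .
qed

text \<open>
  The condition \<open>R \<ge> 1\<close> keeps the fixed singularities \<open>0\<close> and \<open>1\<close> out of the domain.
\<close>

definition PVI_branch ::
    "complex \<Rightarrow> real \<Rightarrow> real \<Rightarrow> (complex \<Rightarrow> complex) \<Rightarrow> bool" where
  "PVI_branch \<mu> \<phi> R y \<longleftrightarrow>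
     R \<ge> 1 \<and> y holomorphic_on cut_nhd_infinity \<phi> R \<and>
     (\<forall>x\<in>cut_nhd_infinity \<phi> R. PVI_eq \<mu> x (y x) (deriv y x) (deriv (deriv y) x))"

text \<open>
  \<open>y(x) = a x^s (1 + O(x^(-\<epsilon>)))\<close> for some \<open>\<epsilon> > 0\<close>, as \<open>x\<close> tends to infinity
  in the cut neighbourhood.
\<close>

definition PVI_asymptotics ::
    "real \<Rightarrow> real \<Rightarrow> complex \<Rightarrow> real \<Rightarrow> (complex \<Rightarrow> complex) \<Rightarrow> bool" where
  "PVI_asymptotics \<phi> R a s y \<longleftrightarrow>
     (\<exists>\<epsilon>>0. (\<lambda>x. y x / (a * cut_powr \<phi> x s) - 1)
        \<in> O[inf at_infinity (principal (cut_nhd_infinity \<phi> R))](\<lambda>x. cut_powr \<phi> x (- \<epsilon>)))"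

end

theory Submission
  imports Defs
begin

text \<open>
  Put \<open>x = exp t\<close> and \<open>y = (1 + cosh v) / 2\<close>. Since the parameters belonging to the singular values
  \<open>0\<close> and \<open>1\<close> of \<open>y\<close> vanish, the terms with \<open>1/y\<close> and \<open>1/(y-1)\<close> cancel, and what remains is
  \<open>v'' = A v'^2 + B v' + C\<close>, where \<open>A\<close>, \<open>B\<close>, \<open>C\<close> are of order \<open>cosh v / exp t\<close>. Writing
  \<open>v = \<sigma> t + c + w\<close> with \<open>exp c = 4 a\<close> (or \<open>(1 + cosh c) / 2 = a\<close> if \<open>\<sigma> = 0\<close>), the required
  asymptotics say that \<open>w\<close> tends to \<open>0\<close>, and \<open>w\<close> satisfies a second-order equation whose right-hand
  side and Lipschitz constants decay like \<open>exp (-(1-\<sigma>) Re t)\<close>. Picard iteration from \<open>t = \<infinity>\<close> in a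
  half plane gives existence. A contraction estimate along the middle ray of the strip, where Cauchy's
  inequality controls the derivatives, gives uniqueness. The lift \<open>v\<close> may fail to exist only for
  \<open>\<sigma> = 0\<close>, \<open>a = 1\<close>; there the system for \<open>y - 1\<close>, its derivative and \<open>(y')^2 / (y - 1)\<close> forces
  \<open>y = 1\<close>.
\<close>

section \<open>Decaying primitives\<close>

text \<open>The coordinate \<open>v\<close> comes from integrating dy / sqrt (y (y - 1)), which
  straightens the terms 1/y and 1/(y - 1) in the coefficient of y'^2. When x is much larger than y
  the equation degenerates to v'' = 0, and its solutions \<sigma> t + c carry exactly the two
  asymptotic parameters. The rate 1 - \<sigma> is the size of cosh v / exp t; since \<sigma> is
  real, every bound depends on Re t alone, which makes a half plane a natural domain for the
  iteration. The obstacle to uniqueness is that the asymptotic condition bounds y but not y', and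
  that the discs available for Cauchy's inequality shrink towards the edges of the strip. On the
  middle ray their radius can stay 1, and the identity theorem then carries equality to the whole
  strip. At \<sigma> = 0, a = 1 the map from v to y has a critical point over the limit value, so
  the asymptotics alone do not select a single-valued v. The replacement system has a leading part
  that is not small but nilpotent, and this still permits a contraction.\<close>

lemma exp_decay_tendsto_0:
  assumes "(\<kappa>::real) > 0" shows "((\<lambda>r. M * exp (- \<kappa> * r)) \<longlongrightarrow> 0) at_top"
proof -
  have "filterlim (\<lambda>r. - \<kappa> * r) at_bot at_top"
    using assms filterlim_tendsto_neg_mult_at_bot[OF tendsto_const, of "- \<kappa>" "\<lambda>r. r" at_top]
    by (simp add: filterlim_ident)
  from filterlim_compose[OF exp_at_bot this] show ?thesis
    using tendsto_mult_right_zero by blast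
qed

text \<open>Mean value inequality against the majorant -M/\<kappa> exp (-\<kappa> x), whose
  derivative is the given bound. The majorant is nonpositive at \<open>s\<close>, so the estimate is
  uniform in \<open>s\<close>.\<close>

lemma ray_increment:
  fixes f f' :: "real \<Rightarrow> complex"
  assumes "\<kappa> > 0"
    and der: "\<And>r. r > T \<Longrightarrow> (f has_vector_derivative f' r) (at r)"
    and bnd: "\<And>r. r > T \<Longrightarrow> norm (f' r) \<le> M * exp (- \<kappa> * r)"
    and "T < r" "r \<le> s"
  shows "norm (f s - f r) \<le> M / \<kappa> * exp (- \<kappa> * r)"
proof -
  let ?h = "\<lambda>x. - M / \<kappa> * exp (- \<kappa> * x)"
  have "0 \<le> M * exp (- \<kappa> * r)" using bnd[OF \<open>T < r\<close>] norm_ge_zero order_trans by blast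
  hence M: "M \<ge> 0" by (simp add: zero_le_mult_iff)
  show ?thesis
  proof (cases "r = s")
    case False
    with \<open>r \<le> s\<close> have "r < s" by simp
    have "norm (f s - f r) \<le> ?h s - ?h r"
    proof (rule differentiable_bound_general[OF \<open>r < s\<close>, where f = f and f' = f' and \<phi> = "?h" and \<phi>' = "\<lambda>x. M * exp (- \<kappa> * x)"])
      show "continuous_on {r..s} f"
        by (rule continuous_on_vector_derivative[where f' = f'], rule has_vector_derivative_at_within, rule der)
          (use \<open>T < r\<close> in simp)
      show "continuous_on {r..s} ?h" by (intro continuous_intros)
      fix x assume x: "r < x" "x < s"
      show "(f has_vector_derivative f' x) (at x)" using der x \<open>T < r\<close> by simp
      show "(?h has_vector_derivative M * exp (- \<kappa> * x)) (at x)"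
        unfolding has_real_derivative_iff_has_vector_derivative[symmetric]
        using \<open>\<kappa> > 0\<close> by (auto intro!: derivative_eq_intros)
      show "norm (f' x) \<le> M * exp (- \<kappa> * x)" using bnd x \<open>T < r\<close> by simp
    qed
    moreover have "?h s \<le> 0" using M \<open>\<kappa> > 0\<close> by simp
    ultimately show ?thesis by simp
  qed (use M \<open>\<kappa> > 0\<close> in simp)
qed

lemma ray_decay:
  fixes f f' :: "real \<Rightarrow> complex"
  assumes "\<kappa> > 0"
    and "\<And>r. r > T \<Longrightarrow> (f has_vector_derivative f' r) (at r)"
    and "\<And>r. r > T \<Longrightarrow> norm (f' r) \<le> M * exp (- \<kappa> * r)"
    and lim: "(f \<longlongrightarrow> l) at_top" and "r > T"
  shows "norm (f r - l) \<le> M / \<kappa> * exp (- \<kappa> * r)"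
proof -
  have ev: "eventually (\<lambda>s. norm (f s - f r) \<le> M / \<kappa> * exp (- \<kappa> * r)) at_top"
    using eventually_ge_at_top[of r] by eventually_elim (rule ray_increment[OF assms(1-3) \<open>r > T\<close>])
  have "((\<lambda>s. norm (f s - f r)) \<longlongrightarrow> norm (l - f r)) at_top"
    by (intro tendsto_intros lim)
  from tendsto_upperbound[OF this ev] show ?thesis by (simp add: norm_minus_commute)
qed

lemma ray_limit_exists:
  fixes f f' :: "real \<Rightarrow> complex"
  assumes "\<kappa> > 0"
    and "\<And>r. r > T \<Longrightarrow> (f has_vector_derivative f' r) (at r)"
    and "\<And>r. r > T \<Longrightarrow> norm (f' r) \<le> M * exp (- \<kappa> * r)"
  obtains l where "(f \<longlongrightarrow> l) at_top"
proof -
  \<comment> \<open>Completeness is applied to a sequence of samples; the increment estimate, being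
    uniform in its far endpoint, then carries the limit over to real r.\<close>
  define X where "X = (\<lambda>n::nat. f (T + 1 + real n))"
  have inc: "norm (f s - f r) \<le> M / \<kappa> * exp (- \<kappa> * r)" if "T < r" "r \<le> s" for r s
    using ray_increment[OF assms that] by blast
  have small: "\<exists>N. \<forall>r\<ge>N. T < r \<and> M / \<kappa> * exp (- \<kappa> * r) < e" if "e > 0" for e
  proof -
    have "\<forall>\<^sub>F r in at_top. M / \<kappa> * exp (- \<kappa> * r) < e \<and> T < r"
      using order_tendstoD(2)[OF exp_decay_tendsto_0[OF \<open>\<kappa> > 0\<close>, of "M / \<kappa>"] that] eventually_gt_at_top[of T]
      by eventually_elim simp
    thus ?thesis by (auto simp: eventually_at_top_linorder)
  qed
  have "Cauchy X"
  proof (rule CauchyI')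
    fix e :: real assume "e > 0"
    then obtain N where N: "\<And>r. r \<ge> N \<Longrightarrow> T < r \<and> M / \<kappa> * exp (- \<kappa> * r) < e" using small by blast
    obtain k :: nat where k: "real k \<ge> N - T - 1" using real_arch_simple by blast
    show "\<exists>k. \<forall>m\<ge>k. \<forall>n>m. dist (X m) (X n) < e"
    proof (intro exI[of _ k] allI impI)
      fix m n assume "k \<le> m" "m < n"
      hence "norm (X n - X m) \<le> M / \<kappa> * exp (- \<kappa> * (T + 1 + real m))"
        unfolding X_def by (intro inc) auto
      also have "\<dots> < e" using N[of "T + 1 + real m"] k \<open>k \<le> m\<close> by simp
      finally show "dist (X m) (X n) < e" by (simp add: dist_norm norm_minus_commute)
    qed
  qed
  then obtain l where l: "X \<longlonglongrightarrow> l" using Cauchy_convergent convergent_def by blast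
  have "norm (f r - l) \<le> M / \<kappa> * exp (- \<kappa> * r)" if "r > T" for r
  proof -
    have "\<forall>\<^sub>F n in sequentially. norm (X n - f r) \<le> M / \<kappa> * exp (- \<kappa> * r)"
      using eventually_ge_at_top[of "nat \<lceil>r - T\<rceil>"]
    proof eventually_elim
      case (elim n)
      hence "r \<le> T + 1 + real n" by linarith
      thus ?case unfolding X_def by (rule inc[OF that])
    qed
    moreover have "(\<lambda>n. norm (X n - f r)) \<longlonglongrightarrow> norm (l - f r)" by (intro tendsto_intros l)
    ultimately have "norm (l - f r) \<le> M / \<kappa> * exp (- \<kappa> * r)"
      using tendsto_upperbound[OF _ _ sequentially_bot] by blast
    thus ?thesis by (simp add: norm_minus_commute)
  qed
  hence "\<forall>\<^sub>F r in at_top. norm (f r - l) \<le> M / \<kappa> * exp (- \<kappa> * r)"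
    using eventually_gt_at_top[of T] by (rule eventually_mono[rotated])
  hence "((\<lambda>r. f r - l) \<longlongrightarrow> 0) at_top"
    by (rule Lim_null_comparison[OF _ exp_decay_tendsto_0[OF \<open>\<kappa> > 0\<close>, of "M / \<kappa>"]])
  thus ?thesis using that LIM_zero_cancel by blast
qed

lemma has_vector_derivative_horizontal:
  assumes "(g has_field_derivative g') (at (Complex r \<eta>))"
  shows "((\<lambda>r. g (Complex r \<eta>)) has_vector_derivative g') (at r)"
proof -
  have "((\<lambda>r. Complex r \<eta>) has_vector_derivative 1) (at r)"
    unfolding Complex_eq by (auto intro!: derivative_eq_intros)
  from field_vector_diff_chain_at[OF this assms] show ?thesis by (simp add: o_def)
qed

lemma half_plane_decay:
  assumes "\<kappa> > 0"
    and der: "\<And>t. Re t > \<rho> \<Longrightarrow> (g has_field_derivative g' t) (at t)"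
    and bnd: "\<And>t. Re t > \<rho> \<Longrightarrow> norm (g' t) \<le> M * exp (- \<kappa> * Re t)"
    and lim: "((\<lambda>r. g (Complex r (Im t))) \<longlongrightarrow> l) at_top" and "Re t > \<rho>"
  shows "norm (g t - l) \<le> M / \<kappa> * exp (- \<kappa> * Re t)"
proof -
  have "norm (g (Complex (Re t) (Im t)) - l) \<le> M / \<kappa> * exp (- \<kappa> * Re t)"
  proof (rule ray_decay[where f = "\<lambda>r. g (Complex r (Im t))" and T = \<rho>, OF \<open>\<kappa> > 0\<close> _ _ lim \<open>Re t > \<rho>\<close>])
    fix r assume "r > \<rho>"
    thus "((\<lambda>r. g (Complex r (Im t))) has_vector_derivative g' (Complex r (Im t))) (at r)"
      by (intro has_vector_derivative_horizontal der) simp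
    show "norm (g' (Complex r (Im t))) \<le> M * exp (- \<kappa> * r)"
      using bnd[of "Complex r (Im t)"] \<open>r > \<rho>\<close> by simp
  qed
  thus ?thesis by simp
qed

text \<open>Every primitive on the half plane has a limit along each horizontal ray. These limits
  coincide, so subtracting one constant makes the primitive vanish at infinity in all directions at
  once.\<close>

lemma decaying_primitive:
  assumes "\<kappa> > 0" and hol: "g holomorphic_on {t. Re t > \<rho>}"
    and bnd: "\<And>t. Re t > \<rho> \<Longrightarrow> norm (g t) \<le> M * exp (- \<kappa> * Re t)"
  obtains G where "\<And>t. Re t > \<rho> \<Longrightarrow> (G has_field_derivative g t) (at t)"
    and "\<And>t. Re t > \<rho> \<Longrightarrow> norm (G t) \<le> M / \<kappa> * exp (- \<kappa> * Re t)"
proof -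
  have op: "open {t. Re t > \<rho>}" by (rule open_halfspace_Re_gt)
  obtain G0 where "\<And>t. t \<in> {t. Re t > \<rho>} \<Longrightarrow> (G0 has_field_derivative g t) (at t within {t. Re t > \<rho>})"
    using holomorphic_convex_primitive'[OF convex_halfspace_Re_gt op hol] by auto
  hence G0: "(G0 has_field_derivative g t) (at t)" if "Re t > \<rho>" for t
    using that at_within_open[OF _ op] by auto
  define f where "f = (\<lambda>\<eta> r. G0 (Complex r \<eta>))"
  have M: "M \<ge> 0"
  proof -
    have "0 \<le> norm (g (of_real (\<rho> + 1)))" by simp
    also have "\<dots> \<le> M * exp (- \<kappa> * (\<rho> + 1))" using bnd[of "of_real (\<rho> + 1)"] by simp
    finally show ?thesis by (simp add: zero_le_mult_iff)
  qed
  have "\<exists>l. (f \<eta> \<longlongrightarrow> l) at_top" for \<eta>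
  proof -
    have 1: "(f \<eta> has_vector_derivative g (Complex x \<eta>)) (at x)" if "x > \<rho>" for x
      unfolding f_def by (intro has_vector_derivative_horizontal G0) (use that in simp)
    have 2: "norm (g (Complex x \<eta>)) \<le> M * exp (- \<kappa> * x)" if "x > \<rho>" for x
      using bnd[of "Complex x \<eta>"] that by simp
    show ?thesis using ray_limit_exists[OF \<open>\<kappa> > 0\<close> 1 2] by blast
  qed
  then obtain L where L: "\<And>\<eta>. (f \<eta> \<longlongrightarrow> L \<eta>) at_top" by metis
  \<comment> \<open>Two points of equal real part r at heights \<eta> and 0 are at fixed distance,
    while the derivative between them is O(exp (-\<kappa> r)).\<close>
  have const: "L \<eta> = L 0" for \<eta>
  proof -
    have "((\<lambda>r. f \<eta> r - f 0 r) \<longlongrightarrow> 0) at_top"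
    proof (rule Lim_null_comparison)
      show "((\<lambda>r. (M * \<bar>\<eta>\<bar>) * exp (- \<kappa> * r)) \<longlongrightarrow> 0) at_top"
        by (rule exp_decay_tendsto_0[OF \<open>\<kappa> > 0\<close>])
      show "\<forall>\<^sub>F r in at_top. norm (f \<eta> r - f 0 r) \<le> (M * \<bar>\<eta>\<bar>) * exp (- \<kappa> * r)"
        using eventually_gt_at_top[of \<rho>]
      proof eventually_elim
        case (elim r)
        have "norm (G0 (Complex r \<eta>) - G0 (Complex r 0)) \<le> (M * exp (- \<kappa> * r)) * norm (Complex r \<eta> - Complex r 0)"
        proof (rule field_differentiable_bound[OF convex_halfspace_Re_ge])
          fix z assume "z \<in> {x. r \<le> Re x}"
          hence z: "r \<le> Re z" by simp
          show "(G0 has_field_derivative g z) (at z within {x. r \<le> Re x})"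
            by (rule has_field_derivative_at_within, rule G0) (use z elim in simp)
          have "norm (g z) \<le> M * exp (- \<kappa> * Re z)" using bnd z elim by simp
          also have "\<dots> \<le> M * exp (- \<kappa> * r)" using M z \<open>\<kappa> > 0\<close> by (intro mult_left_mono) auto
          finally show "norm (g z) \<le> M * exp (- \<kappa> * r)" .
        qed auto
        also have "norm (Complex r \<eta> - Complex r 0) = \<bar>\<eta>\<bar>" by (simp add: cmod_def)
        finally show ?case by (simp add: f_def mult_ac)
      qed
    qed
    moreover have "((\<lambda>r. f \<eta> r - f 0 r) \<longlongrightarrow> L \<eta> - L 0) at_top" by (intro tendsto_intros L)
    ultimately have "0 = L \<eta> - L 0" by (rule tendsto_unique[OF trivial_limit_at_top_linorder])
    thus ?thesis by simp
  qed
  show ?thesis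
  proof
    fix t assume t: "Re t > \<rho>"
    show "((\<lambda>t. G0 t - L 0) has_field_derivative g t) (at t)"
      using G0[OF t] by (auto intro!: derivative_eq_intros)
    show "norm (G0 t - L 0) \<le> M / \<kappa> * exp (- \<kappa> * Re t)"
      by (rule half_plane_decay[OF \<open>\<kappa> > 0\<close> G0 bnd _ t])
        (use L[of "Im t"] const[of "Im t"] in \<open>auto simp: f_def\<close>)
  qed
qed

section \<open>Second-order equations with exponentially decaying right-hand side\<close>

text \<open>Picard iteration for the pair (w, w'), integrating from infinity. Each integration costs
  a factor 1/\<kappa> and keeps the weight exp (-\<kappa> Re t), so a contraction results as soon as
  the half plane lies far enough to the right.\<close>

lemma decaying_second_order_solution:
  fixes F :: "complex \<Rightarrow> complex \<Rightarrow> complex \<Rightarrow> complex"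
  assumes "\<kappa> > 0"
    and bnd: "\<And>t w p. Re t > \<rho>\<^sub>0 \<Longrightarrow> norm w \<le> 1 \<Longrightarrow> norm p \<le> 1 \<Longrightarrow>
      norm (F t w p) \<le> K * exp (- \<kappa> * Re t)"
    and lip: "\<And>t w p w' p'. Re t > \<rho>\<^sub>0 \<Longrightarrow> norm w \<le> 1 \<Longrightarrow> norm p \<le> 1 \<Longrightarrow>
      norm w' \<le> 1 \<Longrightarrow> norm p' \<le> 1 \<Longrightarrow>
      norm (F t w p - F t w' p') \<le> K * exp (- \<kappa> * Re t) * (norm (w - w') + norm (p - p'))"
    and hol: "\<And>\<rho> w p. \<rho> \<ge> \<rho>\<^sub>0 \<Longrightarrow> w holomorphic_on {t. Re t > \<rho>} \<Longrightarrow> p holomorphic_on {t. Re t > \<rho>} \<Longrightarrow>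
      \<forall>t. Re t > \<rho> \<longrightarrow> norm (w t) \<le> 1 \<Longrightarrow> (\<lambda>t. F t (w t) (p t)) holomorphic_on {t. Re t > \<rho>}"
  obtains w p C \<rho>\<^sub>1 where "\<rho>\<^sub>0 \<le> \<rho>\<^sub>1"
    "\<And>t. Re t > \<rho>\<^sub>1 \<Longrightarrow> (w has_field_derivative p t) (at t)"
    "\<And>t. Re t > \<rho>\<^sub>1 \<Longrightarrow> (p has_field_derivative F t (w t) (p t)) (at t)"
    "\<And>t. Re t > \<rho>\<^sub>1 \<Longrightarrow> norm (w t) \<le> 1 \<and> norm (w t) \<le> C * exp (- \<kappa> * Re t)"
proof -
  \<comment> \<open>The Lipschitz bound adds two differences, giving 2 c; one integration (for p)
    and two integrations (for w) then give factors 2 c / \<kappa> and 2 c / \<kappa>^2, both at most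
    1/2.\<close>
  define c where "c = min (\<kappa> / 4) (\<kappa>^2 / 4)"
  have "c > 0" using \<open>\<kappa> > 0\<close> by (simp add: c_def)
  have "\<forall>\<^sub>F r in at_top. K * exp (- \<kappa> * r) < c \<and> \<rho>\<^sub>0 \<le> r"
    using order_tendstoD(2)[OF exp_decay_tendsto_0[OF \<open>\<kappa> > 0\<close>, of K] \<open>c > 0\<close>] eventually_ge_at_top[of \<rho>\<^sub>0]
    by eventually_elim simp
  then obtain \<rho>\<^sub>1 where \<rho>\<^sub>1: "K * exp (- \<kappa> * \<rho>\<^sub>1) < c" and "\<rho>\<^sub>0 \<le> \<rho>\<^sub>1"
    using eventually_happens'[OF trivial_limit_at_top_linorder] by blast
  have small: "K * exp (- \<kappa> * \<rho>\<^sub>1) \<le> c" "c / \<kappa> \<le> 1/4" "c / \<kappa>^2 \<le> 1/4"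
    using \<rho>\<^sub>1 \<open>\<kappa> > 0\<close> by (auto simp: c_def field_simps min_le_iff_disj)
  define H where "H = {t. Re t > \<rho>\<^sub>1}"
  have op: "open H" unfolding H_def by (rule open_halfspace_Re_gt)
  \<comment> \<open>Integration from infinity. Vanishing along all horizontal rays fixes the
    primitive on \<open>H\<close>; outside \<open>H\<close> the chosen function is arbitrary, so
    everything about \<open>J\<close> is stated on \<open>H\<close> only.\<close>
  define J where "J = (\<lambda>g. SOME G. (\<forall>t\<in>H. (G has_field_derivative g t) (at t)) \<and>
    (\<forall>\<eta>. ((\<lambda>r. G (Complex r \<eta>)) \<longlongrightarrow> 0) at_top))"
  have J: "\<forall>t\<in>H. (J g has_field_derivative g t) (at t)"
    "((\<lambda>r. J g (Complex r \<eta>)) \<longlongrightarrow> 0) at_top"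
    if "g holomorphic_on H" "\<And>t. t \<in> H \<Longrightarrow> norm (g t) \<le> M * exp (- \<kappa> * Re t)" for g M \<eta>
  proof -
    have b: "\<And>t. Re t > \<rho>\<^sub>1 \<Longrightarrow> norm (g t) \<le> M * exp (- \<kappa> * Re t)" using that(2) by (simp add: H_def)
    from decaying_primitive[OF \<open>\<kappa> > 0\<close> that(1)[unfolded H_def] b] obtain G
      where G: "\<And>t. Re t > \<rho>\<^sub>1 \<Longrightarrow> (G has_field_derivative g t) (at t)"
      "\<And>t. Re t > \<rho>\<^sub>1 \<Longrightarrow> norm (G t) \<le> M / \<kappa> * exp (- \<kappa> * Re t)" by blast
    have "((\<lambda>r. G (Complex r \<eta>)) \<longlongrightarrow> 0) at_top" for \<eta>
    proof (rule Lim_null_comparison[OF _ exp_decay_tendsto_0[OF \<open>\<kappa> > 0\<close>]])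
      show "\<forall>\<^sub>F r in at_top. norm (G (Complex r \<eta>)) \<le> M / \<kappa> * exp (- \<kappa> * r)"
        using eventually_gt_at_top[of \<rho>\<^sub>1] by eventually_elim (use G(2)[of "Complex _ \<eta>"] in simp)
    qed
    with G(1) have "\<exists>G. (\<forall>t\<in>H. (G has_field_derivative g t) (at t)) \<and>
      (\<forall>\<eta>. ((\<lambda>r. G (Complex r \<eta>)) \<longlongrightarrow> 0) at_top)" unfolding H_def by blast
    from someI_ex[OF this] show "\<forall>t\<in>H. (J g has_field_derivative g t) (at t)"
      "((\<lambda>r. J g (Complex r \<eta>)) \<longlongrightarrow> 0) at_top" unfolding J_def by blast+
  qed
  have Jb: "norm (J g t - J g' t) \<le> M'' / \<kappa> * exp (- \<kappa> * Re t)"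
    if "g holomorphic_on H" "\<And>t. t \<in> H \<Longrightarrow> norm (g t) \<le> M * exp (- \<kappa> * Re t)"
      "g' holomorphic_on H" "\<And>t. t \<in> H \<Longrightarrow> norm (g' t) \<le> M' * exp (- \<kappa> * Re t)"
      "\<And>t. t \<in> H \<Longrightarrow> norm (g t - g' t) \<le> M'' * exp (- \<kappa> * Re t)" "t \<in> H" for g g' M M' M'' t
  proof -
    have "norm (J g t - J g' t - 0) \<le> M'' / \<kappa> * exp (- \<kappa> * Re t)"
    proof (rule half_plane_decay[OF \<open>\<kappa> > 0\<close>, where g = "\<lambda>t. J g t - J g' t" and g' = "\<lambda>t. g t - g' t"
          and \<rho> = \<rho>\<^sub>1 and l = 0])
      fix s assume "\<rho>\<^sub>1 < Re s"
      thus "((\<lambda>t. J g t - J g' t) has_field_derivative g s - g' s) (at s)"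
        using J(1)[OF that(1,2)] J(1)[OF that(3,4)] by (intro DERIV_diff) (auto simp: H_def)
      show "cmod (g s - g' s) \<le> M'' * exp (- \<kappa> * Re s)" using that(5) \<open>\<rho>\<^sub>1 < Re s\<close> by (simp add: H_def)
    next
      show "((\<lambda>r. J g (Complex r (Im t)) - J g' (Complex r (Im t))) \<longlongrightarrow> 0) at_top"
        using tendsto_diff[OF J(2)[OF that(1,2)] J(2)[OF that(3,4)]] by simp
      show "\<rho>\<^sub>1 < Re t" using that(6) by (simp add: H_def)
    qed
    thus ?thesis by simp
  qed
  have J0: "J (\<lambda>_. 0) t = 0" if "t \<in> H" for t
  proof -
    have "norm (J (\<lambda>_. 0) t - 0) \<le> 0 / \<kappa> * exp (- \<kappa> * Re t)"
    proof (rule half_plane_decay[OF \<open>\<kappa> > 0\<close>, where g' = "\<lambda>_. 0" and \<rho> = \<rho>\<^sub>1])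
      show "((\<lambda>r. J (\<lambda>_. 0) (Complex r (Im t))) \<longlongrightarrow> 0) at_top" by (rule J(2)[where M = 0]) auto
    qed (use that J(1)[of "\<lambda>_. 0" 0] in \<open>auto simp: H_def\<close>)
    thus ?thesis by simp
  qed
  have Jb0: "norm (J g t) \<le> M / \<kappa> * exp (- \<kappa> * Re t)"
    if "g holomorphic_on H" "\<And>t. t \<in> H \<Longrightarrow> norm (g t) \<le> M * exp (- \<kappa> * Re t)" "t \<in> H" for g M t
    using Jb[OF that(1,2), of "\<lambda>_. 0" 0 M t] that J0[OF that(3)] by auto
  have Jh: "J g holomorphic_on H"
    if "g holomorphic_on H" "\<And>t. t \<in> H \<Longrightarrow> norm (g t) \<le> M * exp (- \<kappa> * Re t)" for g M
    unfolding holomorphic_on_open[OF op] using J(1)[OF that] by blast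
  \<comment> \<open>The new w integrates the new p, not the old one, so that w' = p holds exactly
    for every iterate and only the equation for p' has to be recovered in the limit.\<close>
  define S where "S = (\<lambda>(w, p). let q = J (\<lambda>t. F t (w t) (p t)) in (J q, q))"
  define u where "u = (\<lambda>n. (S ^^ n) (\<lambda>_. 0, \<lambda>_. 0))"
  define w where "w = (\<lambda>n. fst (u n))"
  define p where "p = (\<lambda>n. snd (u n))"
  define f where "f = (\<lambda>n t. F t (w n t) (p n t))"
  have p_Suc: "p (Suc n) = J (f n)" for n
    by (simp add: p_def u_def S_def w_def f_def split_beta Let_def)
  have w_Suc: "w (Suc n) = J (p (Suc n))" for n
    by (simp add: p_def u_def S_def w_def f_def split_beta Let_def)
  have wp0: "w 0 = (\<lambda>_. 0)" "p 0 = (\<lambda>_. 0)" by (simp_all add: w_def p_def u_def)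
  have "0 \<le> K * exp (- \<kappa> * (\<rho>\<^sub>1 + 1))"
    using order_trans[OF norm_ge_zero bnd[of "of_real (\<rho>\<^sub>1 + 1)" 0 0]] \<open>\<rho>\<^sub>0 \<le> \<rho>\<^sub>1\<close> by simp
  hence K: "K \<ge> 0" by (simp add: zero_le_mult_iff)
  have e: "K * exp (- \<kappa> * Re t) \<le> c" if "t \<in> H" for t
  proof -
    have "K * exp (- \<kappa> * Re t) \<le> K * exp (- \<kappa> * \<rho>\<^sub>1)"
      using that \<open>\<kappa> > 0\<close> K by (intro mult_left_mono) (auto simp: H_def)
    thus ?thesis using small(1) by simp
  qed
  have scale: "K / \<kappa> * exp (- \<kappa> * Re t) \<le> 1" "K / \<kappa> / \<kappa> * exp (- \<kappa> * Re t) \<le> 1" if "t \<in> H" for t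
  proof -
    have "K * exp (- \<kappa> * Re t) / \<kappa> \<le> c / \<kappa>" "K * exp (- \<kappa> * Re t) / \<kappa>^2 \<le> c / \<kappa>^2"
      using e[OF that] \<open>\<kappa> > 0\<close> by (auto intro!: divide_right_mono)
    hence "K * exp (- \<kappa> * Re t) / \<kappa> \<le> 1" "K * exp (- \<kappa> * Re t) / \<kappa>^2 \<le> 1"
      using small by linarith+
    thus "K / \<kappa> * exp (- \<kappa> * Re t) \<le> 1" "K / \<kappa> / \<kappa> * exp (- \<kappa> * Re t) \<le> 1"
      by (simp_all add: power2_eq_square)
  qed
  have inv: "w n holomorphic_on H \<and> p n holomorphic_on H \<and>
      (\<forall>t\<in>H. norm (w n t) \<le> 1 \<and> norm (p n t) \<le> 1 \<and>
        norm (p n t) \<le> K / \<kappa> * exp (- \<kappa> * Re t) \<and> norm (w n t) \<le> K / \<kappa> / \<kappa> * exp (- \<kappa> * Re t))" for n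
  proof (induction n)
    case 0
    show ?case using K \<open>\<kappa> > 0\<close> by (simp add: wp0)
  next
    case (Suc n)
    have fh: "f n holomorphic_on H"
      unfolding f_def H_def by (rule hol[OF \<open>\<rho>\<^sub>0 \<le> \<rho>\<^sub>1\<close>]) (use Suc in \<open>auto simp: H_def\<close>)
    have fb: "norm (f n t) \<le> K * exp (- \<kappa> * Re t)" if "t \<in> H" for t
      unfolding f_def by (rule bnd) (use Suc that \<open>\<rho>\<^sub>0 \<le> \<rho>\<^sub>1\<close> in \<open>auto simp: H_def\<close>)
    have ph: "p (Suc n) holomorphic_on H" unfolding p_Suc by (rule Jh[OF fh fb])
    have pb: "norm (p (Suc n) t) \<le> K / \<kappa> * exp (- \<kappa> * Re t)" if "t \<in> H" for t
      unfolding p_Suc by (rule Jb0[OF fh fb that])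
    have wh: "w (Suc n) holomorphic_on H" unfolding w_Suc by (rule Jh[OF ph pb])
    have wb: "norm (w (Suc n) t) \<le> K / \<kappa> / \<kappa> * exp (- \<kappa> * Re t)" if "t \<in> H" for t
      unfolding w_Suc by (rule Jb0[OF ph pb that])
    show ?case using ph wh pb wb scale by (meson order_refl order_trans)
  qed
  have fh: "f n holomorphic_on H" for n
    unfolding f_def H_def by (rule hol[OF \<open>\<rho>\<^sub>0 \<le> \<rho>\<^sub>1\<close>]) (use inv in \<open>auto simp: H_def\<close>)
  have fb: "norm (f n t) \<le> K * exp (- \<kappa> * Re t)" if "t \<in> H" for t n
    unfolding f_def by (rule bnd) (use inv that \<open>\<rho>\<^sub>0 \<le> \<rho>\<^sub>1\<close> in \<open>auto simp: H_def\<close>)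
  have pb: "norm (p n t) \<le> K / \<kappa> * exp (- \<kappa> * Re t)" if "t \<in> H" for t n
    using inv that by blast
  \<comment> \<open>The iteration starts at zero, so the first differences are the first iterates
    themselves; \<open>D\<close> is the larger of their two bounds.\<close>
  define D where "D = max (K / \<kappa>) (K / \<kappa> / \<kappa>)"
  have diff: "\<forall>t\<in>H. norm (w (Suc n) t - w n t) \<le> D / 2^n * exp (- \<kappa> * Re t) \<and>
    norm (p (Suc n) t - p n t) \<le> D / 2^n * exp (- \<kappa> * Re t)" for n
  proof (induction n)
    case 0
    show ?case
    proof
      fix t assume t: "t \<in> H"
      have "K / \<kappa> * exp (- \<kappa> * Re t) \<le> D * exp (- \<kappa> * Re t)" "K / \<kappa> / \<kappa> * exp (- \<kappa> * Re t) \<le> D * exp (- \<kappa> * Re t)"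
        unfolding D_def by (intro mult_right_mono; simp)+
      thus "norm (w (Suc 0) t - w 0 t) \<le> D / 2^0 * exp (- \<kappa> * Re t) \<and>
        norm (p (Suc 0) t - p 0 t) \<le> D / 2^0 * exp (- \<kappa> * Re t)"
        using inv[of "Suc 0"] t by (simp add: wp0) (meson order_trans)
    qed
  next
    case (Suc n)
    define A where "A = D / 2^n"
    have A: "A \<ge> 0" using K \<open>\<kappa> > 0\<close> by (simp add: A_def D_def le_max_iff_disj)
    have df: "norm (f (Suc n) t - f n t) \<le> (2 * c * A) * exp (- \<kappa> * Re t)" if "t \<in> H" for t
    proof -
      have "norm (f (Suc n) t - f n t) \<le> K * exp (- \<kappa> * Re t) *
        (norm (w (Suc n) t - w n t) + norm (p (Suc n) t - p n t))"
        unfolding f_def by (rule lip) (use inv that \<open>\<rho>\<^sub>0 \<le> \<rho>\<^sub>1\<close> in \<open>auto simp: H_def\<close>)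
      also have "\<dots> \<le> c * (A * exp (- \<kappa> * Re t) + A * exp (- \<kappa> * Re t))"
        using e[OF that] Suc that K unfolding A_def[symmetric]
        by (intro mult_mono add_mono) (auto intro: order_trans[OF _ e[OF that]])
      finally show ?thesis by (simp add: algebra_simps)
    qed
    have dp: "norm (p (Suc (Suc n)) t - p (Suc n) t) \<le> (2 * c * A) / \<kappa> * exp (- \<kappa> * Re t)" if "t \<in> H" for t
      unfolding p_Suc[of "Suc n"] p_Suc[of n] by (rule Jb[OF fh fb fh fb df that])
    have dw: "norm (w (Suc (Suc n)) t - w (Suc n) t) \<le> (2 * c * A) / \<kappa> / \<kappa> * exp (- \<kappa> * Re t)" if "t \<in> H" for t
      unfolding w_Suc[of "Suc n"] w_Suc[of n] by (rule Jb[OF _ pb _ pb dp that]) (use inv in auto)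
    have "(2 * c * A) / \<kappa> \<le> A / 2" "(2 * c * A) / \<kappa> / \<kappa> \<le> A / 2"
    proof -
      have "2 * (A * (c / \<kappa>)) \<le> A / 2" "2 * (A * (c / \<kappa>^2)) \<le> A / 2"
        using mult_left_mono[OF small(2) A] mult_left_mono[OF small(3) A] by linarith+
      thus "(2 * c * A) / \<kappa> \<le> A / 2" "(2 * c * A) / \<kappa> / \<kappa> \<le> A / 2"
        by (simp_all add: power2_eq_square mult_ac)
    qed
    hence "(2 * c * A) / \<kappa> * exp (- \<kappa> * Re t) \<le> A / 2 * exp (- \<kappa> * Re t)"
      "(2 * c * A) / \<kappa> / \<kappa> * exp (- \<kappa> * Re t) \<le> A / 2 * exp (- \<kappa> * Re t)" for t
      by (intro mult_right_mono; simp)+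
    note half = this
    have D2: "D / 2 ^ Suc n = A / 2" by (simp add: A_def)
    show ?case unfolding D2 by (intro ballI conjI order_trans[OF dp half(1)] order_trans[OF dw half(2)])
  qed
  \<comment> \<open>Telescoping turns the iterates into partial sums, to which the M-test applies
    with a geometric majorant; the exponential weight is at most its value at
    \<open>\<rho>\<^sub>1\<close>.\<close>
  have conv: "\<exists>l. uniform_limit H g l sequentially"
    if d: "\<And>n t. t \<in> H \<Longrightarrow> norm (g (Suc n) t - g n t) \<le> D / 2^n * exp (- \<kappa> * Re t)"
      and g0: "\<And>t. g 0 t = 0" for g :: "nat \<Rightarrow> complex \<Rightarrow> complex"
  proof -
    have "uniform_limit H (\<lambda>n t. \<Sum>i<n. g (Suc i) t - g i t) (\<lambda>t. suminf (\<lambda>i. g (Suc i) t - g i t)) sequentially"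
    proof (rule Weierstrass_m_test)
      fix n t assume "t \<in> H"
      have "D \<ge> 0" using K \<open>\<kappa> > 0\<close> by (simp add: D_def le_max_iff_disj)
      have "norm (g (Suc n) t - g n t) \<le> D / 2^n * exp (- \<kappa> * Re t)" by (rule d[OF \<open>t \<in> H\<close>])
      also have "\<dots> \<le> D / 2^n * exp (- \<kappa> * \<rho>\<^sub>1)"
        using \<open>t \<in> H\<close> \<open>\<kappa> > 0\<close> \<open>D \<ge> 0\<close> by (intro mult_left_mono) (auto simp: H_def)
      finally show "norm (g (Suc n) t - g n t) \<le> D * exp (- \<kappa> * \<rho>\<^sub>1) * (1/2)^n" by (simp add: power_one_over field_simps)
    qed (intro summable_mult summable_geometric, simp)
    moreover have "(\<Sum>i<n. g (Suc i) t - g i t) = g n t" for n t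
      by (induction n) (auto simp: g0)
    ultimately show ?thesis by auto
  qed
  obtain W where W: "uniform_limit H w W sequentially"
    using conv[of w] diff by (auto simp: wp0)
  obtain P where P: "uniform_limit H p P sequentially"
    using conv[of p] diff by (auto simp: wp0)
  have ball: "\<exists>d>0. cball t d \<subseteq> H" if "t \<in> H" for t using op that open_contains_cball by blast
  have limw: "(\<lambda>n. w n t) \<longlonglongrightarrow> W t" and limp: "(\<lambda>n. p n t) \<longlonglongrightarrow> P t" if "t \<in> H" for t
    using tendsto_uniform_limitI[OF W that] tendsto_uniform_limitI[OF P that] .
  have nW: "norm (W t) \<le> K / \<kappa> / \<kappa> * exp (- \<kappa> * Re t)" "norm (W t) \<le> 1" "norm (P t) \<le> 1" if "t \<in> H" for t
    by (rule Lim_norm_ubound[OF sequentially_bot limw[OF that]] Lim_norm_ubound[OF sequentially_bot limp[OF that]],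
        use inv that in simp)+
  \<comment> \<open>Uniform limits of holomorphic functions may be differentiated termwise. The
    index is shifted because \<open>w_Suc\<close> presents the iterates as primitives from index 1
    on.\<close>
  have "\<exists>w'. \<forall>t\<in>H. (W has_field_derivative w' t) (at t) \<and> (\<lambda>n. p (Suc n) t) \<longlonglongrightarrow> w' t"
  proof (rule has_complex_derivative_uniform_sequence[OF op, where f = "\<lambda>n. w (Suc n)"])
    fix n t assume "t \<in> H"
    show "(w (Suc n) has_field_derivative p (Suc n) t) (at t)"
      unfolding w_Suc using J(1)[of "p (Suc n)", OF _ pb] inv[of "Suc n"] \<open>t \<in> H\<close> by blast
  next
    fix t assume "t \<in> H"
    then obtain d where "d > 0" "cball t d \<subseteq> H" using ball by blast
    moreover have "uniform_limit H (\<lambda>n. w (Suc n)) W sequentially"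
      by (rule filterlim_compose[OF W filterlim_Suc])
    ultimately show "\<exists>d>0. cball t d \<subseteq> H \<and> uniform_limit (cball t d) (\<lambda>n. w (Suc n)) W sequentially"
      using uniform_limit_on_subset by blast
  qed
  then obtain w' where w': "\<And>t. t \<in> H \<Longrightarrow> (W has_field_derivative w' t) (at t)" "\<And>t. t \<in> H \<Longrightarrow> (\<lambda>n. p (Suc n) t) \<longlonglongrightarrow> w' t"
    by blast
  have w'P: "w' t = P t" if "t \<in> H" for t
    using LIMSEQ_unique w'(2)[OF that] LIMSEQ_Suc[OF limp[OF that]] by blast
  have "\<exists>p'. \<forall>t\<in>H. (P has_field_derivative p' t) (at t) \<and> (\<lambda>n. f n t) \<longlonglongrightarrow> p' t"
  proof (rule has_complex_derivative_uniform_sequence[OF op, where f = "\<lambda>n. p (Suc n)"])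
    fix n t assume "t \<in> H"
    show "(p (Suc n) has_field_derivative f n t) (at t)"
      unfolding p_Suc using J(1)[of "f n", OF fh fb] \<open>t \<in> H\<close> by blast
  next
    fix t assume "t \<in> H"
    then obtain d where "d > 0" "cball t d \<subseteq> H" using ball by blast
    moreover have "uniform_limit H (\<lambda>n. p (Suc n)) P sequentially"
      by (rule filterlim_compose[OF P filterlim_Suc])
    ultimately show "\<exists>d>0. cball t d \<subseteq> H \<and> uniform_limit (cball t d) (\<lambda>n. p (Suc n)) P sequentially"
      using uniform_limit_on_subset by blast
  qed
  then obtain p' where p': "\<And>t. t \<in> H \<Longrightarrow> (P has_field_derivative p' t) (at t)" "\<And>t. t \<in> H \<Longrightarrow> (\<lambda>n. f n t) \<longlonglongrightarrow> p' t"
    by blast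
  \<comment> \<open>The Lipschitz estimate also supplies the continuity needed to pass to the limit
    inside \<open>F\<close>.\<close>
  have p'F: "p' t = F t (W t) (P t)" if "t \<in> H" for t
  proof -
    have "(\<lambda>n. f n t - F t (W t) (P t)) \<longlonglongrightarrow> 0"
    proof (rule Lim_null_comparison)
      show "\<forall>\<^sub>F n in sequentially. norm (f n t - F t (W t) (P t)) \<le>
        K * exp (- \<kappa> * Re t) * (norm (w n t - W t) + norm (p n t - P t))"
        unfolding f_def by (intro always_eventually allI lip)
          (use inv that nW \<open>\<rho>\<^sub>0 \<le> \<rho>\<^sub>1\<close> in \<open>auto simp: H_def\<close>)
      have "(\<lambda>n. K * exp (- \<kappa> * Re t) * (norm (w n t - W t) + norm (p n t - P t)))
        \<longlonglongrightarrow> K * exp (- \<kappa> * Re t) * (norm (W t - W t) + norm (P t - P t))"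
        by (intro tendsto_intros limw limp that)
      thus "(\<lambda>n. K * exp (- \<kappa> * Re t) * (norm (w n t - W t) + norm (p n t - P t))) \<longlonglongrightarrow> 0" by simp
    qed
    hence "(\<lambda>n. f n t) \<longlonglongrightarrow> F t (W t) (P t)" by (rule LIM_zero_cancel)
    thus ?thesis by (rule LIMSEQ_unique[OF p'(2)[OF that]])
  qed
  show ?thesis
  proof
    show "\<rho>\<^sub>0 \<le> \<rho>\<^sub>1" by fact
    fix t assume "Re t > \<rho>\<^sub>1"
    hence t: "t \<in> H" by (simp add: H_def)
    show "(W has_field_derivative P t) (at t)" using w'(1)[OF t] w'P[OF t] by simp
    show "(P has_field_derivative F t (W t) (P t)) (at t)" using p'(1)[OF t] p'F[OF t] by simp
    show "norm (W t) \<le> 1 \<and> norm (W t) \<le> K / \<kappa> / \<kappa> * exp (- \<kappa> * Re t)" using nW[OF t] by blast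
  qed
qed

text \<open>If both differences are bounded by M far out, integrating the equation from infinity
  once and twice bounds them by M/2, and iteration forces them to vanish. The setting is a single
  ray because decay of the derivatives will be known only on the middle one.\<close>

lemma decaying_second_order_unique:
  fixes F :: "complex \<Rightarrow> complex \<Rightarrow> complex \<Rightarrow> complex" and w\<^sub>1 w\<^sub>2 p\<^sub>1 p\<^sub>2 :: "real \<Rightarrow> complex"
  assumes "\<kappa> > 0"
    and lip: "\<And>t w p w' p'. Re t > \<rho>\<^sub>0 \<Longrightarrow> norm w \<le> 1 \<Longrightarrow> norm p \<le> 1 \<Longrightarrow>
      norm w' \<le> 1 \<Longrightarrow> norm p' \<le> 1 \<Longrightarrow>
      norm (F t w p - F t w' p') \<le> K * exp (- \<kappa> * Re t) * (norm (w - w') + norm (p - p'))"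
    and w: "\<And>r. r > T \<Longrightarrow> (w\<^sub>1 has_vector_derivative p\<^sub>1 r) (at r)"
      "\<And>r. r > T \<Longrightarrow> (w\<^sub>2 has_vector_derivative p\<^sub>2 r) (at r)"
    and p: "\<And>r. r > T \<Longrightarrow> (p\<^sub>1 has_vector_derivative F (Complex r \<eta>) (w\<^sub>1 r) (p\<^sub>1 r)) (at r)"
      "\<And>r. r > T \<Longrightarrow> (p\<^sub>2 has_vector_derivative F (Complex r \<eta>) (w\<^sub>2 r) (p\<^sub>2 r)) (at r)"
    and lim: "(w\<^sub>1 \<longlongrightarrow> 0) at_top" "(w\<^sub>2 \<longlongrightarrow> 0) at_top" "(p\<^sub>1 \<longlongrightarrow> 0) at_top" "(p\<^sub>2 \<longlongrightarrow> 0) at_top"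
  shows "eventually (\<lambda>r. w\<^sub>1 r = w\<^sub>2 r) at_top"
proof -
  define c where "c = min (\<kappa> / 4) (\<kappa>^2 / 4)"
  have "c > 0" using \<open>\<kappa> > 0\<close> by (simp add: c_def)
  have le1: "\<forall>\<^sub>F r in at_top. norm (f r) \<le> 1" if "(f \<longlongrightarrow> 0) at_top" for f :: "real \<Rightarrow> complex"
    using order_tendstoD(2)[OF tendsto_norm_zero[OF that], of 1] by (auto elim: eventually_mono)
  have "\<forall>\<^sub>F r in at_top. K * exp (- \<kappa> * r) < c \<and> \<rho>\<^sub>0 < r \<and> T < r \<and>
    norm (w\<^sub>1 r) \<le> 1 \<and> norm (w\<^sub>2 r) \<le> 1 \<and> norm (p\<^sub>1 r) \<le> 1 \<and> norm (p\<^sub>2 r) \<le> 1"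
    using order_tendstoD(2)[OF exp_decay_tendsto_0[OF \<open>\<kappa> > 0\<close>, of K] \<open>c > 0\<close>] eventually_gt_at_top[of \<rho>\<^sub>0]
      eventually_gt_at_top[of T] lim[THEN le1]
    by eventually_elim simp
  then obtain R where R: "\<And>r. r \<ge> R \<Longrightarrow> K * exp (- \<kappa> * r) < c" "\<And>r. r \<ge> R \<Longrightarrow> \<rho>\<^sub>0 < r"
      "\<And>r. r \<ge> R \<Longrightarrow> T < r" and le: "\<And>r. r \<ge> R \<Longrightarrow> norm (w\<^sub>1 r) \<le> 1" "\<And>r. r \<ge> R \<Longrightarrow> norm (w\<^sub>2 r) \<le> 1"
      "\<And>r. r \<ge> R \<Longrightarrow> norm (p\<^sub>1 r) \<le> 1" "\<And>r. r \<ge> R \<Longrightarrow> norm (p\<^sub>2 r) \<le> 1"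
    unfolding eventually_at_top_linorder by blast
  let ?d = "\<lambda>r. w\<^sub>1 r - w\<^sub>2 r" and ?e = "\<lambda>r. p\<^sub>1 r - p\<^sub>2 r"
  have "0 \<le> K * exp (- \<kappa> * (R + 1)) * (norm (0 - 1 :: complex) + norm (0 - 0 :: complex))"
    using order_trans[OF norm_ge_zero lip[of "of_real (R + 1)" 0 0 1 0]] R(2)[of "R + 1"] by simp
  hence K: "K \<ge> 0" by (simp add: zero_le_mult_iff)
  have dlim: "(?d \<longlongrightarrow> 0) at_top" "(?e \<longlongrightarrow> 0) at_top"
    using tendsto_diff[OF lim(1,2)] tendsto_diff[OF lim(3,4)] by simp_all
  have small: "\<forall>r>R. norm (?d r) \<le> M / 2 \<and> norm (?e r) \<le> M / 2"
    if M: "\<forall>r>R. norm (?d r) \<le> M \<and> norm (?e r) \<le> M" for M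
  proof -
    have M0: "M \<ge> 0" using M order_trans[OF norm_ge_zero] gt_ex by blast
    have e: "norm (?e r - 0) \<le> (K * (2 * M)) / \<kappa> * exp (- \<kappa> * r)" if "r > R" for r
    proof (rule ray_decay[OF \<open>\<kappa> > 0\<close> _ _ dlim(2) that])
      fix r assume r: "r > R"
      show "(?e has_vector_derivative F (Complex r \<eta>) (w\<^sub>1 r) (p\<^sub>1 r) - F (Complex r \<eta>) (w\<^sub>2 r) (p\<^sub>2 r)) (at r)"
        by (intro has_vector_derivative_diff p R(3)) (use r in auto)
      have "norm (F (Complex r \<eta>) (w\<^sub>1 r) (p\<^sub>1 r) - F (Complex r \<eta>) (w\<^sub>2 r) (p\<^sub>2 r))
        \<le> K * exp (- \<kappa> * Re (Complex r \<eta>)) * (norm (?d r) + norm (?e r))"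
        by (rule lip) (use r le R(2) in auto)
      also have "\<dots> \<le> K * exp (- \<kappa> * Re (Complex r \<eta>)) * (M + M)"
        using M r K by (intro mult_left_mono add_mono) auto
      finally show "norm (F (Complex r \<eta>) (w\<^sub>1 r) (p\<^sub>1 r) - F (Complex r \<eta>) (w\<^sub>2 r) (p\<^sub>2 r))
        \<le> (K * (2 * M)) * exp (- \<kappa> * r)" by (simp add: mult_ac)
    qed
    have d: "norm (?d r - 0) \<le> (K * (2 * M)) / \<kappa> / \<kappa> * exp (- \<kappa> * r)" if "r > R" for r
    proof (rule ray_decay[OF \<open>\<kappa> > 0\<close> _ _ dlim(1) that])
      fix r assume r: "r > R"
      show "(?d has_vector_derivative ?e r) (at r)"
        by (intro has_vector_derivative_diff w R(3)) (use r in auto)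
      show "norm (?e r) \<le> (K * (2 * M)) / \<kappa> * exp (- \<kappa> * r)" using e[OF r] by simp
    qed
    have half: "(K * (2 * M)) / \<kappa> * exp (- \<kappa> * r) \<le> M / 2" "(K * (2 * M)) / \<kappa> / \<kappa> * exp (- \<kappa> * r) \<le> M / 2"
      if "r > R" for r
    proof -
      have "K * exp (- \<kappa> * r) \<le> \<kappa> / 4" "K * exp (- \<kappa> * r) \<le> \<kappa>^2 / 4"
        using R(1)[of r] that by (auto simp: c_def)
      hence "K * exp (- \<kappa> * r) / \<kappa> \<le> 1 / 4" "K * exp (- \<kappa> * r) / \<kappa>^2 \<le> 1 / 4"
        using \<open>\<kappa> > 0\<close> by (auto simp: field_simps)
      hence "(K * exp (- \<kappa> * r) / \<kappa>) * (2 * M) \<le> 1 / 4 * (2 * M)"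
        "(K * exp (- \<kappa> * r) / \<kappa>^2) * (2 * M) \<le> 1 / 4 * (2 * M)"
        using M0 by (intro mult_right_mono; simp)+
      thus "(K * (2 * M)) / \<kappa> * exp (- \<kappa> * r) \<le> M / 2" "(K * (2 * M)) / \<kappa> / \<kappa> * exp (- \<kappa> * r) \<le> M / 2"
        by (simp_all add: power2_eq_square mult_ac)
    qed
    show ?thesis
      using order_trans[OF d half(2)] order_trans[OF e half(1)] by simp
  qed
  \<comment> \<open>The initial bound 2 is the diameter of the unit disc, in which all four
    functions lie beyond \<open>R\<close>.\<close>
  have "\<forall>r>R. norm (?d r) \<le> 2 / 2^n \<and> norm (?e r) \<le> 2 / 2^n" for n
  proof (induction n)
    case 0
    show ?case
    proof (intro allI impI)
      fix r assume "R < r"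
      thus "norm (?d r) \<le> 2 / 2^0 \<and> norm (?e r) \<le> 2 / 2^0"
        using norm_triangle_ineq4[of "w\<^sub>1 r" "w\<^sub>2 r"] norm_triangle_ineq4[of "p\<^sub>1 r" "p\<^sub>2 r"]
          le[of r] by simp
    qed
  next
    case (Suc n)
    from small[OF this] show ?case by (simp add: mult.commute)
  qed
  hence lim0: "norm (?d r) \<le> 2 / 2^n" if "r > R" for r n using that by blast
  have "?d r = 0" if "r > R" for r
  proof -
    have "(\<lambda>n. 2 * (1/2)^n :: real) \<longlonglongrightarrow> 2 * 0" by (intro tendsto_intros LIMSEQ_power_zero) simp
    hence "(\<lambda>n. 2 / 2^n :: real) \<longlonglongrightarrow> 0" by (simp add: power_one_over field_simps)
    from LIMSEQ_le_const[OF this] lim0[OF that] have "norm (?d r) \<le> 0" by blast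
    thus ?thesis by simp
  qed
  thus ?thesis unfolding eventually_at_top_dense by auto
qed

section \<open>The equation in the coordinates t and v\<close>

text \<open>With \<open>x = exp t\<close> and \<open>y = (1 + cosh v) / 2\<close> the equation becomes \<open>v'' = PVI_cosh \<mu> x v v'\<close>,
  where the derivatives are taken with respect to \<open>t\<close>.\<close>

definition PVI_quad :: "complex \<Rightarrow> complex \<Rightarrow> complex" where
  "PVI_quad x v = sinh v / (4 * ((1 + cosh v) / 2 - x))"

definition PVI_lin :: "complex \<Rightarrow> complex \<Rightarrow> complex" where
  "PVI_lin x v = - x * ((1 + cosh v) / 2 - 1) / ((x - 1) * ((1 + cosh v) / 2 - x))"

definition PVI_const :: "complex \<Rightarrow> complex \<Rightarrow> complex \<Rightarrow> complex" where
  "PVI_const \<mu> x v = sinh v / 4 *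
     ((2 * \<mu> - 1)^2 * ((1 + cosh v) / 2 - x) / (x - 1)^2 + x / ((x - 1) * ((1 + cosh v) / 2 - x)))"

definition PVI_cosh :: "complex \<Rightarrow> complex \<Rightarrow> complex \<Rightarrow> complex \<Rightarrow> complex" where
  "PVI_cosh \<mu> x v p = PVI_quad x v * p^2 + PVI_lin x v * p + PVI_const \<mu> x v"

text \<open>For x = exp t, with P and Q the first and second derivatives of y in t, the chain rule
  gives y' = P/x and y'' = (Q - P)/x^2. All powers of x from the double pole at 0 then
  cancel.\<close>

lemma PVI_eq_log:
  assumes "x \<noteq> 0"
  shows "PVI_eq \<mu> x y (P / x) ((Q - P) / x^2) \<longleftrightarrow>
     2 * (x - 1)^2 * y * (y - 1) * (y - x) * (Q - P) =
       (x - 1)^2 * ((y - 1) * (y - x) + y * (y - x) + y * (y - 1)) * P^2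
       - 2 * (x - 1) * y * (y - 1)
           * ((x - 1) * (y - x) + x * (y - x) + x * (x - 1)) * P
       + y^2 * (y - 1)^2 * ((2 * \<mu> - 1)^2 * (y - x)^2 + x * (x - 1))"
proof -
  define u v w p q where "u = x - 1" and "v = y - 1" and "w = y - x" and "p = P / x" and "q = (Q - P) / x^2"
  have P: "P = x * p" and Q: "Q - P = x^2 * q" using assms by (simp_all add: p_def q_def)
  show ?thesis
    unfolding PVI_eq_def u_def[symmetric] v_def[symmetric] w_def[symmetric] p_def[symmetric] q_def[symmetric] P Q[unfolded P]
    by (simp add: power_mult_distrib mult_ac)
qed

lemma PVI_cosh_cleared:
  assumes "x \<noteq> 1" "(1 + cosh v) / 2 \<noteq> x"
  shows "(x - 1)^2 * ((1 + cosh v) / 2 - x) * PVI_cosh \<mu> x v p =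
    (x - 1)^2 * sinh v * p^2 / 4 - x * (x - 1) * ((1 + cosh v) / 2 - 1) * p
    + sinh v / 4 * ((2 * \<mu> - 1)^2 * ((1 + cosh v) / 2 - x)^2 + x * (x - 1))"
proof -
  define u w where "u = x - 1" and "w = (1 + cosh v) / 2 - x"
  have "u \<noteq> 0" "w \<noteq> 0" using assms by (auto simp: u_def w_def)
  thus ?thesis
    unfolding PVI_cosh_def PVI_quad_def PVI_lin_def PVI_const_def u_def[symmetric] w_def[symmetric]
    by (simp add: field_simps power2_eq_square)
qed

text \<open>The two sides of the cleared equation differ by a multiple of \<open>sinh v ^ 3\<close>, where
  \<open>sinh v ^ 2 = 4 y (y - 1)\<close>; hence the alternative \<open>sinh v = 0\<close>.\<close>

lemma PVI_eq_cosh_iff: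
  assumes "x \<noteq> 0" "x \<noteq> 1" "(1 + cosh v) / 2 \<noteq> x"
  shows "PVI_eq \<mu> x ((1 + cosh v) / 2) (sinh v * p / 2 / x)
      (((cosh v * p^2 + sinh v * q) / 2 - sinh v * p / 2) / x^2) \<longleftrightarrow>
    sinh v = 0 \<or> q = PVI_cosh \<mu> x v p"
proof -
  define s k y where "s = sinh v" and "k = cosh v" and "y = (1 + k) / 2"
  define m where "m = (2 * \<mu> - 1)^2"
  have k2: "k * k = s * s + 1" using cosh_square_eq[of v] by (simp add: s_def k_def power2_eq_square)
  have k: "k = 2 * y - 1" by (simp add: y_def field_simps)
  have ss: "s * s = 4 * y * (y - 1)" using k2 unfolding k by (simp add: algebra_simps)
  let ?N = "(x - 1)^2 * s * p^2 / 4 - x * (x - 1) * (y - 1) * p + s / 4 * (m * (y - x)^2 + x * (x - 1))"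
  have N: "(x - 1)^2 * (y - x) * PVI_cosh \<mu> x v p = ?N"
    using PVI_cosh_cleared[OF assms(2,3)] by (simp add: s_def k_def y_def m_def)
  have "2 * (x - 1)^2 * y * (y - 1) * (y - x) * ((k * p^2 + s * q) / 2 - s * p / 2) -
       ((x - 1)^2 * ((y - 1) * (y - x) + y * (y - x) + y * (y - 1)) * (s * p / 2)^2
       - 2 * (x - 1) * y * (y - 1)
           * ((x - 1) * (y - x) + x * (y - x) + x * (x - 1)) * (s * p / 2)
       + y^2 * (y - 1)^2 * (m * (y - x)^2 + x * (x - 1))) =
    y * (y - 1) * s * ((x - 1)^2 * (y - x) * q - ?N)"
  proof -
    \<comment> \<open>This relation replaces the square of sinh in the P^2 term; after k = 2 y - 1
      the claim is a polynomial identity modulo it.\<close>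
    have "s^2 = 4 * (y * (y - 1))" using ss by (simp add: power2_eq_square mult.assoc)
    hence e: "(s * p / 2)^2 = y * (y - 1) * p^2"
      by (simp add: power_mult_distrib power2_eq_square)
    show ?thesis unfolding e k by (simp add: field_simps power2_eq_square) (use ss in algebra)
  qed
  also have "\<dots> = y * (y - 1) * s * ((x - 1)^2 * (y - x) * (q - PVI_cosh \<mu> x v p))"
    unfolding N[symmetric] by (simp only: right_diff_distrib mult.assoc)
  finally have "PVI_eq \<mu> x y (s * p / 2 / x) (((k * p^2 + s * q) / 2 - s * p / 2) / x^2) \<longleftrightarrow>
      y * (y - 1) * s * ((x - 1)^2 * (y - x) * (q - PVI_cosh \<mu> x v p)) = 0"
    unfolding PVI_eq_log[OF assms(1)] m_def by (metis (no_types, lifting) eq_iff_diff_eq_0)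
  also have "\<dots> \<longleftrightarrow> s = 0 \<or> q = PVI_cosh \<mu> x v p"
  proof -
    have "y - x \<noteq> 0" "x - 1 \<noteq> 0" using assms by (simp_all add: y_def k_def)
    moreover have "s = 0" if "y = 0 \<or> y = 1" using that ss by auto
    ultimately show ?thesis by auto
  qed
  finally show ?thesis by (simp add: s_def k_def y_def)
qed

section \<open>Decay and Lipschitz bounds for the coefficients\<close>

text \<open>Here y and y - 1 have norm at most \<open>B\<close>, half of |x| or less, so |y - x|
  lies between |x|/2 and 2|x| and |x - 1| is at least |x|/2. The three coefficients come out as 1/2,
  4 and 1 + 2 |2\<mu> - 1|^2 times B/|x|; \<open>K\<close> dominates all of them.\<close>

lemma PVI_cosh_coeff_bounds:
  assumes "norm (cosh v) \<le> B" "norm (sinh v) \<le> B" "1 \<le> B" "2 * B \<le> norm x"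
    and K: "K = (5 + 2 * norm (2 * \<mu> - 1)^2) * (B / norm x)"
  shows "(1 + cosh v) / 2 \<noteq> x" "norm (PVI_quad x v) \<le> K" "norm (PVI_lin x v) \<le> K" "norm (PVI_const \<mu> x v) \<le> K"
proof -
  define y X m where "y = (1 + cosh v) / 2" and "X = norm x" and "m = norm (2 * \<mu> - 1)^2"
  have X: "X \<ge> 2" "X > 0" "2 * B \<le> X" using assms by (auto simp: X_def)
  have y: "norm y \<le> B" unfolding y_def
    using norm_triangle_ineq[of 1 "cosh v"] assms(1,3) by (simp add: norm_divide)
  have "y - 1 = (cosh v - 1) / 2" by (simp add: y_def field_simps)
  hence y1: "norm (y - 1) \<le> B"
    using norm_triangle_ineq4[of "cosh v" 1] assms(1,3) by (simp add: norm_divide del: divide_const_simps)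
  have w: "norm (y - x) \<ge> X / 2" "norm (y - x) \<le> 2 * X"
    using norm_triangle_ineq2[of x y] norm_triangle_ineq4[of y x] y X
    by (auto simp: X_def norm_minus_commute)
  have u: "norm (x - 1) \<ge> X / 2" using norm_triangle_ineq2[of x 1] X by (simp add: X_def)
  show "(1 + cosh v) / 2 \<noteq> x" using w X by (auto simp: y_def)
  have KB: "c * (B / X) \<le> K" if "c \<le> 5 + 2 * m" for c
    unfolding K X_def[symmetric] m_def[symmetric] using that X assms(3) by (intro mult_right_mono) auto
  have "norm (PVI_quad x v) = norm (sinh v) / (4 * norm (y - x))"
    unfolding PVI_quad_def y_def[symmetric] norm_divide norm_mult by simp
  also have "\<dots> \<le> B / (4 * (X / 2))" using w X assms(2,3) by (intro frac_le) auto
  also have "\<dots> = 1/2 * (B / X)" by simp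
  also have "\<dots> \<le> K" by (rule KB) (simp add: m_def)
  finally show "norm (PVI_quad x v) \<le> K" .
  have "norm (PVI_lin x v) = X * norm (y - 1) / (norm (x - 1) * norm (y - x))"
    unfolding PVI_lin_def y_def[symmetric] X_def norm_divide norm_mult by simp
  also have "\<dots> \<le> X * B / (X / 2 * (X / 2))"
    using w u X y1 assms(3) by (intro frac_le mult_mono) auto
  also have "\<dots> = 4 * (B / X)" using X by (simp add: field_simps)
  also have "\<dots> \<le> K" by (rule KB) (simp add: m_def)
  finally show "norm (PVI_lin x v) \<le> K" .
  have "norm (PVI_const \<mu> x v) = norm (sinh v) / 4 *
    norm ((2 * \<mu> - 1)^2 * (y - x) / (x - 1)^2 + x / ((x - 1) * (y - x)))"
    unfolding PVI_const_def y_def[symmetric] norm_mult by (simp add: norm_divide)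
  also have "\<dots> \<le> B / 4 * (m * (2 * X) / (X / 2)^2 + X / (X / 2 * (X / 2)))"
  proof (intro mult_mono order_trans[OF norm_triangle_ineq] add_mono)
    show "norm ((2 * \<mu> - 1)^2 * (y - x) / (x - 1)^2) \<le> m * (2 * X) / (X / 2)^2"
      unfolding norm_divide norm_mult norm_power m_def
      using w u X by (intro frac_le mult_mono power_mono) auto
    show "norm (x / ((x - 1) * (y - x))) \<le> X / (X / 2 * (X / 2))"
      unfolding norm_divide norm_mult X_def[symmetric] using w u X by (intro frac_le mult_mono) auto
  qed (use assms in auto)
  also have "\<dots> = (2 * m + 1) * (B / X)" using X by (simp add: field_simps power2_eq_square)
  also have "\<dots> \<le> K" by (rule KB) simp
  finally show "norm (PVI_const \<mu> x v) \<le> K" .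
qed

text \<open>Cauchy's inequality on unit circles centred in the closed unit disc, which stay inside
  radius 3. With radius 1 the derivative inherits the bound \<open>M\<close> itself, so Lipschitz
  constants decay as fast as the functions.\<close>

lemma Lipschitz_of_bounded:
  assumes "f holomorphic_on ball 0 3" "\<And>w. w \<in> ball 0 3 \<Longrightarrow> norm (f w) \<le> M"
    and "norm w \<le> 1" "norm w' \<le> 1"
  shows "norm (f w - f w') \<le> M * norm (w - w' :: complex)"
proof (rule field_differentiable_bound[OF convex_cball])
  fix z :: complex assume "z \<in> cball 0 1"
  hence z: "norm z \<le> 1" by simp
  show "(f has_field_derivative deriv f z) (at z within cball 0 1)"
    using assms(1) z by (intro has_field_derivative_at_within[OF holomorphic_derivI[OF _ open_ball]]) auto
  have sub: "cball z 1 \<subseteq> ball 0 3" using z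
    by (auto simp: dist_norm) (smt (verit) norm_minus_commute norm_triangle_sub)
  have "norm ((deriv ^^ 1) f z) \<le> fact 1 * M / 1 ^ 1"
  proof (rule Cauchy_inequality)
    show "f holomorphic_on ball z 1" using assms(1) sub ball_subset_cball by (metis holomorphic_on_subset subset_trans)
    show "continuous_on (cball z 1) f" using assms(1) sub holomorphic_on_imp_continuous_on holomorphic_on_subset by metis
    show "norm (f x) \<le> M" if "norm (z - x) = 1" for x
    proof (rule assms(2))
      have "x \<in> cball z 1" using that by (simp add: dist_norm)
      thus "x \<in> ball 0 3" using sub by blast
    qed
  qed simp
  thus "norm (deriv f z) \<le> M" by simp
qed (use assms in auto)

text \<open>The equation for \<open>w\<close> in \<open>v = \<sigma> t + c + w\<close>.\<close>

definition PVI_pert :: "complex \<Rightarrow> real \<Rightarrow> complex \<Rightarrow> complex \<Rightarrow> complex \<Rightarrow> complex \<Rightarrow> complex" where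
  "PVI_pert \<mu> \<sigma> c t w p = PVI_cosh \<mu> (exp t) (of_real \<sigma> * t + c + w) (of_real \<sigma> + p)"

lemma norm_cosh_sinh_le:
  fixes v :: complex
  shows "norm (cosh v) \<le> exp \<bar>Re v\<bar>" "norm (sinh v) \<le> exp \<bar>Re v\<bar>"
proof -
  have "norm (exp v) \<le> exp \<bar>Re v\<bar>" "norm (exp (- v)) \<le> exp \<bar>Re v\<bar>" by auto
  thus "norm (cosh v) \<le> exp \<bar>Re v\<bar>" "norm (sinh v) \<le> exp \<bar>Re v\<bar>"
    using norm_triangle_ineq[of "exp v" "exp (- v)"] norm_triangle_ineq4[of "exp v" "exp (- v)"]
    unfolding cosh_field_def sinh_field_def norm_divide norm_numeral by linarith+
qed

lemma holomorphic_on_cosh_sinh: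
  fixes f :: "complex \<Rightarrow> complex"
  assumes "f holomorphic_on A"
  shows "(\<lambda>z. cosh (f z)) holomorphic_on A" "(\<lambda>z. sinh (f z)) holomorphic_on A"
  unfolding cosh_field_def sinh_field_def using assms by (auto intro!: holomorphic_intros)

lemma holomorphic_PVI_coeffs:
  assumes "x holomorphic_on A" "v holomorphic_on A"
    and "\<And>z. z \<in> A \<Longrightarrow> x z \<noteq> 1" "\<And>z. z \<in> A \<Longrightarrow> (1 + cosh (v z)) / 2 \<noteq> x z"
  shows "(\<lambda>z. PVI_quad (x z) (v z)) holomorphic_on A" "(\<lambda>z. PVI_lin (x z) (v z)) holomorphic_on A"
    "(\<lambda>z. PVI_const \<mu> (x z) (v z)) holomorphic_on A"
proof -
  define y where "y = (\<lambda>z. (1 + cosh (v z)) / 2)"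
  have y: "y holomorphic_on A" "z \<in> A \<Longrightarrow> y z \<noteq> x z" for z
    unfolding y_def using assms(4) by (auto intro!: holomorphic_intros holomorphic_on_cosh_sinh assms(2))
  show "(\<lambda>z. PVI_quad (x z) (v z)) holomorphic_on A" "(\<lambda>z. PVI_lin (x z) (v z)) holomorphic_on A"
    "(\<lambda>z. PVI_const \<mu> (x z) (v z)) holomorphic_on A"
    unfolding PVI_quad_def PVI_lin_def PVI_const_def y_def[THEN fun_cong, symmetric]
    by (intro holomorphic_intros holomorphic_on_cosh_sinh y(1) assms(1,2); use assms(3) y(2) in simp)+
qed

text \<open>On |w| < 3 both cosh v and sinh v are at most exp (\<sigma> Re t + |c| + 3); dividing by
  |x| = exp (Re t) produces the decay exponent 1 - \<sigma>. The radius 3 is the one asked for by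
  \<open>Lipschitz_of_bounded\<close>.\<close>

lemma PVI_pert_bounds:
  assumes "0 \<le> \<sigma>" "\<sigma> < 1"
  obtains \<rho>\<^sub>0 K where "\<rho>\<^sub>0 \<ge> 0"
    and "\<And>t w. Re t > \<rho>\<^sub>0 \<Longrightarrow> norm w < 3 \<Longrightarrow>
      exp t \<noteq> 1 \<and> (1 + cosh (of_real \<sigma> * t + c + w)) / 2 \<noteq> exp t"
    and "\<And>t w p. Re t > \<rho>\<^sub>0 \<Longrightarrow> norm w \<le> 1 \<Longrightarrow> norm p \<le> 1 \<Longrightarrow>
      norm (PVI_pert \<mu> \<sigma> c t w p) \<le> K * exp (- (1 - \<sigma>) * Re t)"
    and "\<And>t w p w' p'. Re t > \<rho>\<^sub>0 \<Longrightarrow> norm w \<le> 1 \<Longrightarrow> norm p \<le> 1 \<Longrightarrow>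
      norm w' \<le> 1 \<Longrightarrow> norm p' \<le> 1 \<Longrightarrow>
      norm (PVI_pert \<mu> \<sigma> c t w p - PVI_pert \<mu> \<sigma> c t w' p')
        \<le> K * exp (- (1 - \<sigma>) * Re t) * (norm (w - w') + norm (p - p'))"
proof -
  define \<kappa> B\<^sub>1 K\<^sub>0 where "\<kappa> = 1 - \<sigma>" and "B\<^sub>1 = exp (norm c + 3)" and "K\<^sub>0 = 5 + 2 * norm (2 * \<mu> - 1)^2"
  have "\<kappa> > 0" using assms by (simp add: \<kappa>_def)
  define M where "M = (\<lambda>t. K\<^sub>0 * (B\<^sub>1 * exp (- \<kappa> * Re t)))"
  \<comment> \<open>This is the condition 2 B \<le> |x| of \<open>PVI_cosh_coeff_bounds\<close>,
    written in t.\<close>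
  have "\<forall>\<^sub>F r in at_top. 2 * B\<^sub>1 * exp (- \<kappa> * r) < 1 \<and> r > 0"
    using order_tendstoD(2)[OF exp_decay_tendsto_0[OF \<open>\<kappa> > 0\<close>, of "2 * B\<^sub>1"] zero_less_one] eventually_gt_at_top[of "0 :: real"]
    by eventually_elim simp
  then obtain \<rho>\<^sub>0 where \<rho>\<^sub>0: "\<And>r. r \<ge> \<rho>\<^sub>0 \<Longrightarrow> 2 * B\<^sub>1 * exp (- \<kappa> * r) < 1 \<and> r > 0"
    unfolding eventually_at_top_linorder by blast
  have coeff: "(1 + cosh v) / 2 \<noteq> exp t" "norm (PVI_quad (exp t) v) \<le> M t"
    "norm (PVI_lin (exp t) v) \<le> M t" "norm (PVI_const \<mu> (exp t) v) \<le> M t" "exp t \<noteq> 1"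
    if t: "Re t > \<rho>\<^sub>0" and w: "norm w < 3" and v: "v = of_real \<sigma> * t + c + w" for t w v
  proof -
    define B where "B = B\<^sub>1 * exp (\<sigma> * Re t)"
    have r: "2 * B\<^sub>1 * exp (- \<kappa> * Re t) < 1" "Re t > 0" using \<rho>\<^sub>0[of "Re t"] t by auto
    have "\<bar>Re v\<bar> \<le> \<sigma> * Re t + norm c + 3"
    proof -
      have "\<bar>Re v\<bar> \<le> \<bar>\<sigma> * Re t\<bar> + \<bar>Re c\<bar> + \<bar>Re w\<bar>" by (simp add: v)
      thus ?thesis using abs_Re_le_cmod[of c] abs_Re_le_cmod[of w] w assms r by (simp add: abs_mult)
    qed
    hence "exp \<bar>Re v\<bar> \<le> exp (\<sigma> * Re t + norm c + 3)" by simp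
    also have "\<dots> = B" by (simp add: B_def B\<^sub>1_def flip: exp_add)
    finally have B: "norm (cosh v) \<le> B" "norm (sinh v) \<le> B" using norm_cosh_sinh_le[of v] by linarith+
    have "1 * 1 \<le> B" unfolding B_def using assms r by (intro mult_mono) (auto simp: B\<^sub>1_def)
    hence B1: "1 \<le> B" by simp
    have BX: "B / norm (exp t) = B\<^sub>1 * exp (- \<kappa> * Re t)"
      by (simp add: B_def \<kappa>_def field_simps flip: exp_add)
    have "B / norm (exp t) \<le> 1 / 2" using r unfolding BX by simp
    hence B2: "2 * B \<le> norm (exp t)" by (simp add: field_simps)
    have MK: "M t = (5 + 2 * norm (2 * \<mu> - 1)^2) * (B / norm (exp t))"
      by (simp only: M_def BX K\<^sub>0_def)
    show "(1 + cosh v) / 2 \<noteq> exp t" "norm (PVI_quad (exp t) v) \<le> M t"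
      "norm (PVI_lin (exp t) v) \<le> M t" "norm (PVI_const \<mu> (exp t) v) \<le> M t"
      by (rule PVI_cosh_coeff_bounds[OF B B1 B2 MK])+
    show "exp t \<noteq> 1"
    proof
      assume "exp t = 1"
      with B1 B2 show False by (simp only: norm_one)
    qed
  qed
  have M0: "M t \<ge> 0" for t by (simp add: M_def K\<^sub>0_def B\<^sub>1_def)
  \<comment> \<open>Since |\<sigma> + p| \<le> 2, the quadratic, linear and constant terms
    contribute 4 + 2 + 1 = 7. In the Lipschitz estimate the w-part again adds up to 7 and the p-part
    to 4 + 1.\<close>
  have M: "7 * M t = (7 * K\<^sub>0 * B\<^sub>1) * exp (- (1 - \<sigma>) * Re t)" for t by (simp add: M_def \<kappa>_def)
  have lip: "norm (PVI_quad (exp t) (of_real \<sigma> * t + c + w) - PVI_quad (exp t) (of_real \<sigma> * t + c + w')) \<le> M t * norm (w - w')"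
    "norm (PVI_lin (exp t) (of_real \<sigma> * t + c + w) - PVI_lin (exp t) (of_real \<sigma> * t + c + w')) \<le> M t * norm (w - w')"
    "norm (PVI_const \<mu> (exp t) (of_real \<sigma> * t + c + w) - PVI_const \<mu> (exp t) (of_real \<sigma> * t + c + w')) \<le> M t * norm (w - w')"
    if "Re t > \<rho>\<^sub>0" "norm w \<le> 1" "norm w' \<le> 1" for t w w'
  proof -
    have h: "(\<lambda>w. exp t) holomorphic_on ball 0 3" "(\<lambda>w. of_real \<sigma> * t + c + w) holomorphic_on ball 0 3"
      by (intro holomorphic_intros)+
    have nz: "exp t \<noteq> 1" "(1 + cosh (of_real \<sigma> * t + c + w)) / 2 \<noteq> exp t" if "w \<in> ball 0 3" for w
      using coeff(1,5)[OF \<open>Re t > \<rho>\<^sub>0\<close> _ refl, of w] that by auto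
    note hol = holomorphic_PVI_coeffs[OF h nz]
    note bd = coeff(2-4)[OF \<open>Re t > \<rho>\<^sub>0\<close> _ refl]
    show "norm (PVI_quad (exp t) (of_real \<sigma> * t + c + w) - PVI_quad (exp t) (of_real \<sigma> * t + c + w')) \<le> M t * norm (w - w')"
      by (rule Lipschitz_of_bounded[OF hol(1)]) (use that bd in auto)
    show "norm (PVI_lin (exp t) (of_real \<sigma> * t + c + w) - PVI_lin (exp t) (of_real \<sigma> * t + c + w')) \<le> M t * norm (w - w')"
      by (rule Lipschitz_of_bounded[OF hol(2)]) (use that bd in auto)
    show "norm (PVI_const \<mu> (exp t) (of_real \<sigma> * t + c + w) - PVI_const \<mu> (exp t) (of_real \<sigma> * t + c + w')) \<le> M t * norm (w - w')"
      by (rule Lipschitz_of_bounded[OF hol(3)]) (use that bd in auto)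
  qed
  show ?thesis
  proof (rule that[of \<rho>\<^sub>0 "7 * K\<^sub>0 * B\<^sub>1"])
    show "\<rho>\<^sub>0 \<ge> 0" using \<rho>\<^sub>0[of \<rho>\<^sub>0] by simp
  next
    fix t w :: complex assume "Re t > \<rho>\<^sub>0" "norm w < 3"
    thus "exp t \<noteq> 1 \<and> (1 + cosh (of_real \<sigma> * t + c + w)) / 2 \<noteq> exp t"
      using coeff(1,5)[OF _ _ refl] by simp
  next
    fix t w p :: complex assume t: "Re t > \<rho>\<^sub>0" and w: "norm w \<le> 1" and p: "norm p \<le> 1"
    define v P where "v = of_real \<sigma> * t + c + w" and "P = of_real \<sigma> + p"
    have P: "norm P \<le> 2" using norm_triangle_ineq[of "of_real \<sigma>" p] p assms by (simp add: P_def)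
    have b: "norm (PVI_quad (exp t) v) \<le> M t" "norm (PVI_lin (exp t) v) \<le> M t" "norm (PVI_const \<mu> (exp t) v) \<le> M t"
      using coeff[OF t _ v_def] w by auto
    have "norm (PVI_cosh \<mu> (exp t) v P) \<le> M t * 2^2 + M t * 2 + M t"
      unfolding PVI_cosh_def
    proof (intro order_trans[OF norm_triangle_ineq] add_mono)
      show "norm (PVI_quad (exp t) v * P^2) \<le> M t * 2^2" unfolding norm_mult norm_power
        using b P M0 by (intro mult_mono power_mono) auto
      show "norm (PVI_lin (exp t) v * P) \<le> M t * 2" unfolding norm_mult
        using b P M0 by (intro mult_mono) auto
    qed (rule b)
    thus "norm (PVI_pert \<mu> \<sigma> c t w p) \<le> 7 * K\<^sub>0 * B\<^sub>1 * exp (- (1 - \<sigma>) * Re t)"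
      unfolding M[symmetric] PVI_pert_def v_def P_def by simp
  next
    fix t w p w' p' :: complex
    assume t: "Re t > \<rho>\<^sub>0" and w: "norm w \<le> 1" "norm p \<le> 1" "norm w' \<le> 1" "norm p' \<le> 1"
    define v P v' P' where "v = of_real \<sigma> * t + c + w" and "P = of_real \<sigma> + p"
      and "v' = of_real \<sigma> * t + c + w'" and "P' = of_real \<sigma> + p'"
    have P: "norm P \<le> 2" "norm P' \<le> 2"
      using norm_triangle_ineq[of "of_real \<sigma>" p] norm_triangle_ineq[of "of_real \<sigma>" p'] w assms
      by (simp_all add: P_def P'_def)
    have PP: "norm (P - P') = norm (p - p')" "norm (P + P') \<le> 4"
      using P norm_triangle_ineq[of P P'] by (auto simp: P_def P'_def)
    have b: "norm (PVI_quad (exp t) v') \<le> M t" "norm (PVI_lin (exp t) v') \<le> M t"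
      using coeff[OF t _ v'_def] w by auto
    note l = lip[OF t w(1,3), folded v_def v'_def]
    have "PVI_cosh \<mu> (exp t) v P - PVI_cosh \<mu> (exp t) v' P' =
      (PVI_quad (exp t) v - PVI_quad (exp t) v') * P^2 + PVI_quad (exp t) v' * ((P + P') * (P - P'))
      + ((PVI_lin (exp t) v - PVI_lin (exp t) v') * P + PVI_lin (exp t) v' * (P - P'))
      + (PVI_const \<mu> (exp t) v - PVI_const \<mu> (exp t) v')"
      by (simp add: PVI_cosh_def algebra_simps power2_eq_square)
    also have "norm \<dots> \<le> ((M t * norm (w - w')) * 2^2 + M t * (4 * norm (p - p')))
      + ((M t * norm (w - w')) * 2 + M t * norm (p - p')) + M t * norm (w - w')"
    proof (intro order_trans[OF norm_triangle_ineq] add_mono)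
      show "norm ((PVI_quad (exp t) v - PVI_quad (exp t) v') * P^2) \<le> (M t * norm (w - w')) * 2^2"
        unfolding norm_mult norm_power using l P M0 by (intro mult_mono power_mono) auto
      show "norm (PVI_quad (exp t) v' * ((P + P') * (P - P'))) \<le> M t * (4 * norm (p - p'))"
        unfolding norm_mult PP(1) using b PP M0 by (intro mult_mono) auto
      show "norm ((PVI_lin (exp t) v - PVI_lin (exp t) v') * P) \<le> (M t * norm (w - w')) * 2"
        unfolding norm_mult using l P M0 by (intro mult_mono) auto
      show "norm (PVI_lin (exp t) v' * (P - P')) \<le> M t * norm (p - p')"
        unfolding norm_mult PP(1) using b M0 by (intro mult_mono) auto
    qed (rule l)
    also have "\<dots> \<le> 7 * M t * (norm (w - w') + norm (p - p'))"
      using mult_nonneg_nonneg[OF M0[of t] norm_ge_zero[of "p - p'"]] by (simp add: algebra_simps)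
    finally show "norm (PVI_pert \<mu> \<sigma> c t w p - PVI_pert \<mu> \<sigma> c t w' p')
        \<le> 7 * K\<^sub>0 * B\<^sub>1 * exp (- (1 - \<sigma>) * Re t) * (norm (w - w') + norm (p - p'))"
      unfolding M[symmetric] PVI_pert_def v_def P_def v'_def P'_def .
  qed
qed

section \<open>The logarithmic chart\<close>

text \<open>For \<rho> = ln R with R > 0, exp and \<open>cut_Ln \<phi>\<close> are mutually inverse
  bijections between this set and \<open>cut_nhd_infinity \<phi> R\<close>. Unlike the latter, it is
  convex.\<close>

definition log_strip :: "real \<Rightarrow> real \<Rightarrow> complex set" where
  "log_strip \<phi> \<rho> = {t. Re t > \<rho> \<and> \<phi> < Im t \<and> Im t < \<phi> + 2 * pi}"

lemma open_log_strip: "open (log_strip \<phi> \<rho>)"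
proof -
  have "log_strip \<phi> \<rho> = {t. Re t > \<rho>} \<inter> {t. Im t > \<phi>} \<inter> {t. Im t < \<phi> + 2 * pi}"
    by (auto simp: log_strip_def)
  thus ?thesis
    by (simp add: open_Int open_halfspace_Re_gt open_halfspace_Im_gt open_halfspace_Im_lt)
qed

lemma convex_log_strip: "convex (log_strip \<phi> \<rho>)"
proof -
  have "log_strip \<phi> \<rho> = {t. Re t > \<rho>} \<inter> {t. Im t > \<phi>} \<inter> {t. Im t < \<phi> + 2 * pi}"
    by (auto simp: log_strip_def)
  thus ?thesis
    by (simp add: convex_Int convex_halfspace_Re_gt convex_halfspace_Im_gt convex_halfspace_Im_lt)
qed

lemma cut_Ln_exp:
  assumes "\<phi> < Im t" "Im t < \<phi> + 2 * pi"
  shows "cut_Ln \<phi> (exp t) = t"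
proof -
  define s where "s = t - \<i> * of_real (\<phi> + pi)"
  have "exp s = exp t * cis (- (\<phi> + pi))"
    unfolding s_def cis_conv_exp exp_add[symmetric] by (simp add: algebra_simps)
  also have "cis (- (\<phi> + pi)) = - cis (- \<phi>)"
    by (simp add: complex_eq_iff)
  finally have "exp s = - (exp t * cis (- \<phi>))" by simp
  moreover have "Ln (exp s) = s" using assms by (intro Ln_exp) (simp_all add: s_def)
  ultimately show ?thesis by (simp add: cut_Ln_def s_def)
qed

lemma exp_in_cut_nhd:
  assumes "R > 0" "t \<in> log_strip \<phi> (ln R)"
  shows "exp t \<in> cut_nhd_infinity \<phi> R"
proof -
  have "exp (ln R) < exp (Re t)" using assms(2) by (simp add: log_strip_def)
  hence "norm (exp t) > R" using assms(1) by simp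
  moreover have False if "r \<ge> 0" "exp t = of_real r * cis \<phi>" for r
  proof -
    have "r \<noteq> 0" using that(2) by auto
    hence "r > 0" using that(1) by simp
    hence "exp t = exp (of_real (ln r) + \<i> * of_real \<phi>)"
      using that(2) by (simp add: exp_add cis_conv_exp exp_of_real)
    \<comment> \<open>A point over the cut has Im t in \<phi> + 2 pi Z, and the open interval of
      length 2 pi that starts at \<phi> contains no such value.\<close>
    then obtain n :: int where n: "t = of_real (ln r) + \<i> * of_real \<phi> + (of_int (2 * n) * pi) * \<i>"
      unfolding exp_eq by blast
    hence "Im t = \<phi> + 2 * pi * of_int n" by simp
    with assms(2) have "0 < 2 * pi * of_int n" "2 * pi * of_int n < 2 * pi * 1"
      by (simp_all add: log_strip_def)
    hence "0 < n" "n < 1" by (simp_all add: zero_less_mult_iff)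
    thus False by simp
  qed
  ultimately show ?thesis by (auto simp: cut_nhd_infinity_def)
qed

lemma cut_nhd_arg_not_nonpos:
  assumes "x \<in> cut_nhd_infinity \<phi> R"
  shows "- (x * cis (- \<phi>)) \<notin> \<real>\<^sub>\<le>\<^sub>0"
proof
  assume "- (x * cis (- \<phi>)) \<in> \<real>\<^sub>\<le>\<^sub>0"
  then obtain r where r: "r \<le> 0" "- (x * cis (- \<phi>)) = of_real r" by (elim nonpos_Reals_cases)
  have "x = - (- (x * cis (- \<phi>))) * cis \<phi>" by (simp add: mult.assoc cis_mult)
  hence "x = of_real (- r) * cis \<phi>" unfolding r(2) by simp
  with assms r(1) show False unfolding cut_nhd_infinity_def
    by (metis (mono_tags, lifting) mem_Collect_eq neg_0_le_iff_le)
qed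

lemma cut_Ln_has_field_derivative:
  assumes "x \<in> cut_nhd_infinity \<phi> R"
  shows "(cut_Ln \<phi> has_field_derivative 1 / x) (at x)"
  unfolding cut_Ln_def using cut_nhd_arg_not_nonpos[OF assms]
  by (auto intro!: derivative_eq_intros simp: field_simps)

lemma Re_cut_Ln: "x \<noteq> 0 \<Longrightarrow> Re (cut_Ln \<phi> x) = ln (norm x)"
  by (simp add: cut_Ln_def norm_mult)

lemma cut_Ln_in_log_strip:
  assumes "R > 0" "x \<in> cut_nhd_infinity \<phi> R"
  shows "cut_Ln \<phi> x \<in> log_strip \<phi> (ln R)"
proof -
  let ?z = "- (x * cis (- \<phi>))"
  have x: "norm x > R" "x \<noteq> 0" using assms by (auto simp: cut_nhd_infinity_def)
  have "?z \<notin> \<real>\<^sub>\<le>\<^sub>0" by (rule cut_nhd_arg_not_nonpos[OF assms(2)])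
  hence "- pi < Im (Ln ?z)" "Im (Ln ?z) < pi"
    using mpi_less_Im_Ln[of ?z] Im_Ln_less_pi[of ?z] x by auto
  moreover have "Re (cut_Ln \<phi> x) > ln R" using x assms(1) by (simp add: Re_cut_Ln)
  ultimately show ?thesis by (simp add: log_strip_def cut_Ln_def)
qed

lemma cut_powr_exp:
  assumes "\<phi> < Im t" "Im t < \<phi> + 2 * pi"
  shows "cut_powr \<phi> (exp t) s = exp (of_real s * t)"
  by (simp add: cut_powr_def cut_Ln_exp[OF assms])

text \<open>The set is the image of an open strip on which exp is injective, so the open mapping
  theorem applies.\<close>

lemma open_cut_nhd: "R > 0 \<Longrightarrow> open (cut_nhd_infinity \<phi> R)"
proof -
  assume R: "R > 0"
  have "exp ` log_strip \<phi> (ln R) = cut_nhd_infinity \<phi> R"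
  proof (intro equalityI subsetI)
    fix x assume "x \<in> cut_nhd_infinity \<phi> R"
    hence "x = exp (cut_Ln \<phi> x)" "cut_Ln \<phi> x \<in> log_strip \<phi> (ln R)"
      using exp_cut_Ln[of x \<phi>] cut_Ln_in_log_strip[OF R] R by (auto simp: cut_nhd_infinity_def)
    thus "x \<in> exp ` log_strip \<phi> (ln R)" by blast
  qed (use exp_in_cut_nhd[OF R] in blast)
  moreover have "open (exp ` log_strip \<phi> (ln R))"
  proof (rule open_mapping_thm3[OF _ open_log_strip])
    show "exp holomorphic_on log_strip \<phi> (ln R)" by (intro holomorphic_intros)
    show "inj_on exp (log_strip \<phi> (ln R))"
      by (rule inj_on_inverseI[where g = "cut_Ln \<phi>"]) (auto simp: log_strip_def cut_Ln_exp)
  qed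
  ultimately show ?thesis by simp
qed

text \<open>Lets a solution be built entirely in the variable t: the quotients P/x and (Q - P)/x^2
  are what two applications of the chain rule to \<open>cut_Ln\<close> give.
  \<open>PVI_branch_logD\<close> is the way back.\<close>

lemma PVI_branchI_log:
  assumes R: "R \<ge> 1"
    and Y: "\<And>t. t \<in> log_strip \<phi> (ln R) \<Longrightarrow> (Y has_field_derivative P t) (at t)"
    and P: "\<And>t. t \<in> log_strip \<phi> (ln R) \<Longrightarrow> (P has_field_derivative Q t) (at t)"
    and eq: "\<And>t. t \<in> log_strip \<phi> (ln R) \<Longrightarrow>
      PVI_eq \<mu> (exp t) (Y t) (P t / exp t) ((Q t - P t) / exp t ^ 2)"
  shows "PVI_branch \<mu> \<phi> R (\<lambda>x. Y (cut_Ln \<phi> x))"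
proof -
  let ?y = "\<lambda>x. Y (cut_Ln \<phi> x)" and ?D = "cut_nhd_infinity \<phi> R"
  have op: "open ?D" using R by (intro open_cut_nhd) simp
  have nz: "x \<noteq> 0" and ex: "exp (cut_Ln \<phi> x) = x" and str: "cut_Ln \<phi> x \<in> log_strip \<phi> (ln R)" if "x \<in> ?D" for x
    using that R exp_cut_Ln[of x \<phi>] cut_Ln_in_log_strip[of R x \<phi>] by (auto simp: cut_nhd_infinity_def)
  have d1: "(?y has_field_derivative P (cut_Ln \<phi> x) / x) (at x)" if "x \<in> ?D" for x
    using DERIV_chain2[OF Y[OF str[OF that]] cut_Ln_has_field_derivative[OF that]] by simp
  have dy: "deriv ?y x = P (cut_Ln \<phi> x) / x" if "x \<in> ?D" for x by (rule DERIV_imp_deriv[OF d1[OF that]])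
  have d2: "(deriv ?y has_field_derivative (Q (cut_Ln \<phi> x) - P (cut_Ln \<phi> x)) / x^2) (at x)" if x: "x \<in> ?D" for x
  proof (rule has_field_derivative_transform_within_open[OF _ op x])
    have "((\<lambda>x. P (cut_Ln \<phi> x)) has_field_derivative Q (cut_Ln \<phi> x) * (1 / x)) (at x)"
      by (rule DERIV_chain2[OF P[OF str[OF x]] cut_Ln_has_field_derivative[OF x]])
    from DERIV_divide[OF this DERIV_ident nz[OF x]]
    show "((\<lambda>x. P (cut_Ln \<phi> x) / x) has_field_derivative (Q (cut_Ln \<phi> x) - P (cut_Ln \<phi> x)) / x^2) (at x)"
      using nz[OF x] by (simp add: power2_eq_square)
  qed (simp add: dy)
  have "?y holomorphic_on ?D" using d1 by (auto simp: holomorphic_on_open[OF op])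
  moreover have "PVI_eq \<mu> x (?y x) (deriv ?y x) (deriv (deriv ?y) x)" if "x \<in> ?D" for x
    using eq[OF str[OF that]] unfolding ex[OF that] dy[OF that] DERIV_imp_deriv[OF d2[OF that]] .
  ultimately show ?thesis using R by (simp add: PVI_branch_def)
qed

lemma PVI_branch_logD:
  assumes "PVI_branch \<mu> \<phi> R y"
  defines "Y \<equiv> (\<lambda>t. y (exp t))"
  shows "Y holomorphic_on log_strip \<phi> (ln R)"
    and "\<And>t. t \<in> log_strip \<phi> (ln R) \<Longrightarrow>
      PVI_eq \<mu> (exp t) (Y t) (deriv Y t / exp t) ((deriv (deriv Y) t - deriv Y t) / exp t ^ 2)"
proof -
  let ?D = "cut_nhd_infinity \<phi> R" and ?S = "log_strip \<phi> (ln R)"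
  have R: "R \<ge> 1" and hol: "y holomorphic_on ?D"
    and eq: "\<And>x. x \<in> ?D \<Longrightarrow> PVI_eq \<mu> x (y x) (deriv y x) (deriv (deriv y) x)"
    using assms(1) unfolding PVI_branch_def by blast+
  have op: "open ?D" using R by (intro open_cut_nhd) simp
  have ex: "exp t \<in> ?D" if "t \<in> ?S" for t using exp_in_cut_nhd[OF _ that] R by simp
  have d1: "(Y has_field_derivative deriv y (exp t) * exp t) (at t)" if "t \<in> ?S" for t
    unfolding Y_def using DERIV_chain2[OF holomorphic_derivI[OF hol op ex[OF that]] DERIV_exp] .
  have dY: "deriv Y t = deriv y (exp t) * exp t" if "t \<in> ?S" for t by (rule DERIV_imp_deriv[OF d1[OF that]])
  have d2: "(deriv Y has_field_derivative deriv (deriv y) (exp t) * exp t * exp t + deriv y (exp t) * exp t) (at t)" if t: "t \<in> ?S" for t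
  proof (rule has_field_derivative_transform_within_open[OF _ open_log_strip t])
    have "((\<lambda>t. deriv y (exp t)) has_field_derivative deriv (deriv y) (exp t) * exp t) (at t)"
      by (rule DERIV_chain2[OF holomorphic_derivI[OF holomorphic_deriv[OF hol op] op ex[OF t]] DERIV_exp])
    from DERIV_mult[OF this DERIV_exp]
    show "((\<lambda>t. deriv y (exp t) * exp t) has_field_derivative deriv (deriv y) (exp t) * exp t * exp t + deriv y (exp t) * exp t) (at t)"
      by (simp add: add.commute mult_ac)
  qed (simp add: dY)
  show "Y holomorphic_on ?S" using d1 by (auto simp: holomorphic_on_open[OF open_log_strip])
  show "PVI_eq \<mu> (exp t) (Y t) (deriv Y t / exp t) ((deriv (deriv Y) t - deriv Y t) / exp t ^ 2)" if "t \<in> ?S" for t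
    unfolding dY[OF that] DERIV_imp_deriv[OF d2[OF that]]
    using eq[OF ex[OF that]] by (simp add: Y_def power2_eq_square)
qed

section \<open>Existence\<close>

text \<open>The numbers 2 y - 1 + 2 S and 2 y - 1 - 2 S have product (2 y - 1)^2 - 4 y (y - 1) = 1,
  so they are exp v and exp (-v), and their mean is cosh v.\<close>

lemma half_cosh_of_exp:
  fixes y S v :: complex
  assumes "S^2 = y * (y - 1)" "exp v = 2 * y - 1 + 2 * S"
  shows "(1 + cosh v) / 2 = y"
proof -
  have "exp v * (2 * y - 1 - 2 * S) = (2 * y - 1)^2 - 4 * S^2"
    unfolding assms(2) by (simp add: algebra_simps power2_eq_square)
  also have "\<dots> = 1" unfolding assms(1) by (simp add: algebra_simps power2_eq_square)
  finally have "exp (- v) = 2 * y - 1 - 2 * S"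
    by (simp add: exp_minus inverse_unique)
  thus ?thesis unfolding cosh_field_def assms(2) by (simp add: field_simps)
qed

lemma half_cosh_surj:
  obtains c :: complex where "(1 + cosh c) / 2 = a"
proof -
  define S where "S = csqrt (a * (a - 1))"
  have S: "S^2 = a * (a - 1)" by (simp add: S_def)
  have "(2 * a - 1 + 2 * S) * (2 * a - 1 - 2 * S) = (2 * a - 1)^2 - 4 * S^2"
    by (simp add: algebra_simps power2_eq_square)
  also have "\<dots> = 1" unfolding S by (simp add: algebra_simps power2_eq_square)
  finally have "2 * a - 1 + 2 * S \<noteq> 0" by auto
  hence "exp (Ln (2 * a - 1 + 2 * S)) = 2 * a - 1 + 2 * S" by simp
  from half_cosh_of_exp[OF S this] that show ?thesis by blast
qed

lemma PVI_asymptoticsI_log: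
  assumes "\<epsilon> > 0" "R > 0" "a \<noteq> 0"
    and "\<And>t. t \<in> log_strip \<phi> (ln R) \<Longrightarrow>
      norm (Y t - a * exp (of_real \<sigma> * t)) \<le> C * exp ((\<sigma> - \<epsilon>) * Re t)"
  shows "PVI_asymptotics \<phi> R a \<sigma> (\<lambda>x. Y (cut_Ln \<phi> x))"
  unfolding PVI_asymptotics_def
proof (intro exI[of _ \<epsilon>] conjI bigoI)
  show "\<forall>\<^sub>F x in inf at_infinity (principal (cut_nhd_infinity \<phi> R)).
    norm (Y (cut_Ln \<phi> x) / (a * cut_powr \<phi> x \<sigma>) - 1) \<le> (C / norm a) * norm (cut_powr \<phi> x (- \<epsilon>))"
    unfolding eventually_inf_principal
  proof (intro always_eventually allI impI)
    fix x assume x: "x \<in> cut_nhd_infinity \<phi> R"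
    define t where "t = cut_Ln \<phi> x"
    have t: "t \<in> log_strip \<phi> (ln R)" unfolding t_def by (rule cut_Ln_in_log_strip[OF assms(2) x])
    have "norm (Y t / (a * exp (of_real \<sigma> * t)) - 1) = norm ((Y t - a * exp (of_real \<sigma> * t)) / (a * exp (of_real \<sigma> * t)))"
      using assms(3) by (simp add: diff_divide_distrib)
    also have "\<dots> = norm (Y t - a * exp (of_real \<sigma> * t)) / (norm a * exp (\<sigma> * Re t))"
      by (simp add: norm_divide norm_mult)
    also have "\<dots> \<le> C * exp ((\<sigma> - \<epsilon>) * Re t) / (norm a * exp (\<sigma> * Re t))"
      by (intro divide_right_mono assms(4)[OF t]) simp
    also have "\<dots> = (C / norm a) * exp (- \<epsilon> * Re t)"
      using assms(3) by (simp add: field_simps flip: exp_add)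
    finally show "norm (Y (cut_Ln \<phi> x) / (a * cut_powr \<phi> x \<sigma>) - 1) \<le> (C / norm a) * norm (cut_powr \<phi> x (- \<epsilon>))"
      by (simp add: cut_powr_def t_def)
  qed
qed (use assms in auto)

lemma norm_exp_diff_le:
  fixes w :: complex
  assumes "norm w \<le> 1"
  shows "norm (exp w - 1) \<le> exp 1 * norm w"
proof -
  have "norm (exp w - exp 0) \<le> exp 1 * norm (w - 0)"
  proof (rule field_differentiable_bound[OF convex_cball])
    show "(exp has_field_derivative exp z) (at z within cball 0 1)" for z :: complex
      by (rule has_field_derivative_at_within[OF DERIV_exp])
    show "norm (exp z) \<le> exp 1" if "z \<in> cball 0 1" for z :: complex
      using that complex_Re_le_cmod[of z] by simp
  qed (use assms in auto)
  thus ?thesis by simp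
qed

lemma norm_cosh_diff_le:
  fixes w c :: complex
  assumes "norm w \<le> 1"
  shows "norm (cosh (c + w) - cosh c) \<le> exp (norm c + 1) * norm w"
proof -
  have "norm (cosh (c + w) - cosh (c + 0)) \<le> exp (norm c + 1) * norm (w - 0)"
  proof (rule field_differentiable_bound[OF convex_cball, where f = "\<lambda>w. cosh (c + w)" and f' = "\<lambda>w. sinh (c + w)"])
    show "((\<lambda>w. cosh (c + w)) has_field_derivative sinh (c + z)) (at z within cball 0 1)" for z
      by (auto intro!: derivative_eq_intros)
    show "norm (sinh (c + z)) \<le> exp (norm c + 1)" if "z \<in> cball 0 1" for z
    proof -
      have "\<bar>Re (c + z)\<bar> \<le> norm c + 1"
        using that abs_Re_le_cmod[of "c + z"] norm_triangle_ineq[of c z] by simp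
      thus ?thesis using norm_cosh_sinh_le(2)[of "c + z"] by (meson exp_le_cancel_iff order_trans)
    qed
  qed (use assms in auto)
  thus ?thesis by simp
qed

lemma PVI_branch_exists:
  fixes \<mu> a :: complex and \<sigma> \<phi> :: real
  assumes "a \<noteq> 0" "0 \<le> \<sigma>" "\<sigma> < 1"
  shows "\<exists>R y. PVI_branch \<mu> \<phi> R y \<and> PVI_asymptotics \<phi> R a \<sigma> y"
proof -
  \<comment> \<open>For \<sigma> > 0 the term exp v / 4 dominates y, so the leading coefficient is
    exp c / 4. For \<sigma> = 0 both exponentials survive and y tends to (1 + cosh c) / 2.\<close>
  obtain c where c: "\<sigma> > 0 \<Longrightarrow> exp c = 4 * a" "\<sigma> = 0 \<Longrightarrow> (1 + cosh c) / 2 = a"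
  proof (cases "\<sigma> > 0")
    case True
    thus ?thesis using that[of "Ln (4 * a)"] assms by auto
  next
    case False
    obtain c where "(1 + cosh c) / 2 = a" using half_cosh_surj .
    thus ?thesis using that[of c] False by simp
  qed
  obtain \<rho>\<^sub>0 K where "\<rho>\<^sub>0 \<ge> 0"
    and ns: "\<And>t w. Re t > \<rho>\<^sub>0 \<Longrightarrow> norm w < 3 \<Longrightarrow>
      exp t \<noteq> 1 \<and> (1 + cosh (of_real \<sigma> * t + c + w)) / 2 \<noteq> exp t"
    and bnd: "\<And>t w p. Re t > \<rho>\<^sub>0 \<Longrightarrow> norm w \<le> 1 \<Longrightarrow> norm p \<le> 1 \<Longrightarrow>
      norm (PVI_pert \<mu> \<sigma> c t w p) \<le> K * exp (- (1 - \<sigma>) * Re t)"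
    and lip: "\<And>t w p w' p'. Re t > \<rho>\<^sub>0 \<Longrightarrow> norm w \<le> 1 \<Longrightarrow> norm p \<le> 1 \<Longrightarrow>
      norm w' \<le> 1 \<Longrightarrow> norm p' \<le> 1 \<Longrightarrow>
      norm (PVI_pert \<mu> \<sigma> c t w p - PVI_pert \<mu> \<sigma> c t w' p')
        \<le> K * exp (- (1 - \<sigma>) * Re t) * (norm (w - w') + norm (p - p'))"
    by (rule PVI_pert_bounds[OF assms(2,3), where c = c and \<mu> = \<mu>]) (rule that)
  have hol: "(\<lambda>t. PVI_pert \<mu> \<sigma> c t (w t) (p t)) holomorphic_on {t. Re t > \<rho>}"
    if "\<rho> \<ge> \<rho>\<^sub>0" and h: "w holomorphic_on {t. Re t > \<rho>}" "p holomorphic_on {t. Re t > \<rho>}"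
      and w: "\<forall>t. Re t > \<rho> \<longrightarrow> norm (w t) \<le> 1" for \<rho> w p
  proof -
    have nz: "exp t \<noteq> 1" "(1 + cosh (of_real \<sigma> * t + c + w t)) / 2 \<noteq> exp t" if "t \<in> {t. Re t > \<rho>}" for t
    proof -
      have "norm (w t) < 3" "Re t > \<rho>\<^sub>0" using w that \<open>\<rho> \<ge> \<rho>\<^sub>0\<close> by force+
      thus "exp t \<noteq> 1" "(1 + cosh (of_real \<sigma> * t + c + w t)) / 2 \<noteq> exp t" using ns by blast+
    qed
    have v: "(\<lambda>t. of_real \<sigma> * t + c + w t) holomorphic_on {t. Re t > \<rho>}" by (intro holomorphic_intros h)
    have e: "exp holomorphic_on {t. Re t > \<rho>}" by (intro holomorphic_intros)
    show ?thesis unfolding PVI_pert_def PVI_cosh_def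
      by (intro holomorphic_intros h holomorphic_PVI_coeffs[OF e v nz])
  qed
  have "1 - \<sigma> > 0" using assms by simp
  then obtain w p C \<rho> where "\<rho>\<^sub>0 \<le> \<rho>"
    and w: "\<And>t. Re t > \<rho> \<Longrightarrow> (w has_field_derivative p t) (at t)"
    and p: "\<And>t. Re t > \<rho> \<Longrightarrow> (p has_field_derivative PVI_pert \<mu> \<sigma> c t (w t) (p t)) (at t)"
    and wb: "\<And>t. Re t > \<rho> \<Longrightarrow> norm (w t) \<le> 1 \<and> norm (w t) \<le> C * exp (- (1 - \<sigma>) * Re t)"
    by (rule decaying_second_order_solution[where F = "PVI_pert \<mu> \<sigma> c" and \<kappa> = "1 - \<sigma>" and K = K and \<rho>\<^sub>0 = \<rho>\<^sub>0])
      (rule bnd lip hol that; assumption)+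
  define R where "R = exp \<rho>"
  have R: "R \<ge> 1" "ln R = \<rho>" using \<open>\<rho>\<^sub>0 \<ge> 0\<close> \<open>\<rho>\<^sub>0 \<le> \<rho>\<close> by (simp_all add: R_def)
  define v q where "v = (\<lambda>t. of_real \<sigma> * t + c + w t)" and "q = (\<lambda>t. of_real \<sigma> + p t)"
  define Y where "Y = (\<lambda>t. (1 + cosh (v t)) / 2)"
  have v: "(v has_field_derivative q t) (at t)" if "Re t > \<rho>" for t
    unfolding v_def q_def using w[OF that] by (auto intro!: derivative_eq_intros)
  have q: "(q has_field_derivative PVI_cosh \<mu> (exp t) (v t) (q t)) (at t)" if "Re t > \<rho>" for t
    using p[OF that] unfolding q_def v_def PVI_pert_def by (auto intro!: derivative_eq_intros)
  have "PVI_branch \<mu> \<phi> R (\<lambda>x. Y (cut_Ln \<phi> x))"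
  proof (rule PVI_branchI_log[OF R(1)])
    fix t assume "t \<in> log_strip \<phi> (ln R)"
    hence t: "Re t > \<rho>" by (simp add: log_strip_def R)
    show "(Y has_field_derivative sinh (v t) * q t / 2) (at t)"
      unfolding Y_def using v[OF t] by (auto intro!: derivative_eq_intros)
    show "((\<lambda>t. sinh (v t) * q t / 2) has_field_derivative
      (cosh (v t) * q t ^ 2 + sinh (v t) * PVI_cosh \<mu> (exp t) (v t) (q t)) / 2) (at t)"
      using v[OF t] q[OF t] by (auto intro!: derivative_eq_intros simp: power2_eq_square algebra_simps)
    have "norm (w t) < 3" using wb[OF t] by linarith
    hence "exp t \<noteq> 1" "(1 + cosh (v t)) / 2 \<noteq> exp t" using ns[of t "w t"] t \<open>\<rho>\<^sub>0 \<le> \<rho>\<close> by (auto simp: v_def)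
    \<comment> \<open>In this direction the equation for v suffices even where sinh v vanishes, so
      \<sigma> = 0, a = 1 needs no separate construction.\<close>
    thus "PVI_eq \<mu> (exp t) (Y t) (sinh (v t) * q t / 2 / exp t)
      (((cosh (v t) * q t ^ 2 + sinh (v t) * PVI_cosh \<mu> (exp t) (v t) (q t)) / 2 - sinh (v t) * q t / 2) / exp t ^ 2)"
      unfolding Y_def by (subst PVI_eq_cosh_iff) auto
  qed
  moreover have "PVI_asymptotics \<phi> R a \<sigma> (\<lambda>x. Y (cut_Ln \<phi> x))"
  proof (cases "\<sigma> > 0")
    case True
    \<comment> \<open>In y = a exp (\<sigma> t) exp w + 1/2 + exp (-v)/4 the factor exp w has
      relative error of order exp (-(1-\<sigma>) Re t). The other two terms are bounded, which is
      relative size exp (-\<sigma> Re t).\<close>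
    define \<epsilon> where "\<epsilon> = min \<sigma> (1 - \<sigma>)"
    show ?thesis
    proof (rule PVI_asymptoticsI_log[where \<epsilon> = \<epsilon> and C = "norm a * exp 1 * C + 1/2 + exp (norm c + 1)"])
      fix t assume "t \<in> log_strip \<phi> (ln R)"
      hence t: "Re t > \<rho>" by (simp add: log_strip_def R)
      hence t0: "Re t > 0" using \<open>\<rho>\<^sub>0 \<ge> 0\<close> \<open>\<rho>\<^sub>0 \<le> \<rho>\<close> by simp
      let ?E = "exp (of_real \<sigma> * t)" and ?e = "exp ((\<sigma> - \<epsilon>) * Re t)"
      have nE: "norm ?E = exp (\<sigma> * Re t)" by simp
      have e1: "?e \<ge> 1" using t0 by (simp add: \<epsilon>_def)
      have wt: "norm (w t) \<le> 1" "norm (w t) \<le> C * exp (- (1 - \<sigma>) * Re t)" using wb[OF t] by auto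
      have "0 \<le> C * exp (- (1 - \<sigma>) * Re t)" using wt(2) norm_ge_zero order_trans by blast
      hence C: "C \<ge> 0" by (simp add: zero_le_mult_iff)
      have "exp (v t) = ?E * (4 * a) * exp (w t)" using True c(1) by (simp add: v_def exp_add)
      hence "Y t - a * ?E = a * ?E * (exp (w t) - 1) + 1/2 + exp (- v t) / 4"
        by (simp add: Y_def cosh_field_def field_simps)
      also have "norm \<dots> \<le> (norm a * exp 1 * C) * ?e + 1/2 * ?e + exp (norm c + 1) * ?e"
      proof (intro order_trans[OF norm_triangle_ineq] add_mono)
        have "norm (a * ?E * (exp (w t) - 1)) \<le> norm a * exp (\<sigma> * Re t) * (exp 1 * (C * exp (- (1 - \<sigma>) * Re t)))"
          unfolding norm_mult nE
          by (intro mult_left_mono order_trans[OF norm_exp_diff_le[OF wt(1)]] wt(2)) auto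
        also have "\<dots> = (norm a * exp 1 * C) * exp (\<sigma> * Re t - (1 - \<sigma>) * Re t)"
          unfolding diff_conv_add_uminus[of "\<sigma> * Re t"] exp_add by (simp add: mult_ac) (simp add: algebra_simps)
        also have "\<dots> \<le> (norm a * exp 1 * C) * ?e"
        proof (rule mult_left_mono)
          have "\<sigma> * Re t - (1 - \<sigma>) * Re t = (\<sigma> - (1 - \<sigma>)) * Re t" by (simp add: algebra_simps)
          also have "\<dots> \<le> (\<sigma> - \<epsilon>) * Re t" using t0 by (intro mult_right_mono) (auto simp: \<epsilon>_def)
          finally show "exp (\<sigma> * Re t - (1 - \<sigma>) * Re t) \<le> ?e" by simp
        qed (use C in simp)
        finally show "norm (a * ?E * (exp (w t) - 1)) \<le> (norm a * exp 1 * C) * ?e" .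
        show "norm (1/2 :: complex) \<le> 1/2 * ?e" using e1 by simp
        have "- Re (v t) \<le> norm c + 1"
        proof -
          have "Re (v t) = \<sigma> * Re t + Re c + Re (w t)" by (simp add: v_def)
          moreover have "\<sigma> * Re t > 0" using True t0 by simp
          ultimately show ?thesis using abs_Re_le_cmod[of c] abs_Re_le_cmod[of "w t"] wt(1) by linarith
        qed
        hence "norm (exp (- v t) / 4) \<le> exp (norm c + 1) * 1"
          by (simp add: norm_divide) (smt (verit) exp_le_cancel_iff exp_gt_zero)
        also have "\<dots> \<le> exp (norm c + 1) * ?e" using e1 by (intro mult_left_mono) auto
        finally show "norm (exp (- v t) / 4) \<le> exp (norm c + 1) * ?e" .
      qed
      finally show "norm (Y t - a * ?E) \<le> (norm a * exp 1 * C + 1/2 + exp (norm c + 1)) * ?e"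
        by (simp add: algebra_simps)
    qed (use True assms R in \<open>auto simp: \<epsilon>_def\<close>)
  next
    case False
    hence \<sigma>: "\<sigma> = 0" using assms by simp
    show ?thesis
    proof (rule PVI_asymptoticsI_log[where \<epsilon> = 1 and C = "exp (norm c + 1) * C"])
      fix t assume "t \<in> log_strip \<phi> (ln R)"
      hence t: "Re t > \<rho>" by (simp add: log_strip_def R)
      have wt: "norm (w t) \<le> 1" "norm (w t) \<le> C * exp (- Re t)" using wb[OF t] \<sigma> by auto
      have "Y t - a = (cosh (c + w t) - cosh c) / 2"
        unfolding c(2)[OF \<sigma>, symmetric] by (simp add: Y_def v_def \<sigma> field_simps)
      hence "norm (Y t - a) \<le> norm (cosh (c + w t) - cosh c)" by (simp only: norm_divide norm_numeral) simp
      also have "\<dots> \<le> exp (norm c + 1) * (C * exp (- Re t))"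
        by (intro order_trans[OF norm_cosh_diff_le[OF wt(1)]] mult_left_mono wt(2)) auto
      finally show "norm (Y t - a * exp (of_real \<sigma> * t)) \<le> exp (norm c + 1) * C * exp ((\<sigma> - 1) * Re t)"
        by (simp add: \<sigma> mult_ac)
    qed (use assms R in auto)
  qed
  ultimately show ?thesis by blast
qed

section \<open>The middle ray of the strip\<close>

text \<open>The end \<open>Re t \<rightarrow> \<infinity>\<close> of the strip that is the image of the cut neighbourhood under the logarithm.\<close>

definition log_end :: "real \<Rightarrow> complex filter" where
  "log_end \<phi> = inf (filtercomap Re at_top) (principal {t. \<phi> < Im t \<and> Im t < \<phi> + 2 * pi})"

lemma eventually_log_end: "eventually P (log_end \<phi>) \<longleftrightarrow> (\<exists>N. \<forall>t\<in>log_strip \<phi> N. P t)"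
  by (auto simp: log_end_def eventually_inf_principal eventually_filtercomap_at_top_dense log_strip_def)

lemma eventually_log_end_ge:
  assumes "eventually P (log_end \<phi>)"
  obtains N where "N \<ge> M" "\<And>t. t \<in> log_strip \<phi> N \<Longrightarrow> P t"
proof -
  obtain N where N: "\<forall>t\<in>log_strip \<phi> N. P t" using assms by (auto simp: eventually_log_end)
  show ?thesis by (rule that[of "max M N"]) (use N in \<open>auto simp: log_strip_def\<close>)
qed

lemma filterlim_Re_log_end: "filterlim Re at_top (log_end \<phi>)"
  unfolding log_end_def by (rule filterlim_mono[OF filterlim_filtercomap order_refl]) simp

lemma midline_in_log_strip: "r > N \<Longrightarrow> Complex r (\<phi> + pi) \<in> log_strip \<phi> N"
  using pi_gt_zero by (simp add: log_strip_def)

lemma filterlim_midline: "filterlim (\<lambda>r. Complex r (\<phi> + pi)) (log_end \<phi>) at_top"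
proof (rule filterlim_iff[THEN iffD2], intro allI impI)
  fix P assume "eventually P (log_end \<phi>)"
  then obtain N where "\<forall>t\<in>log_strip \<phi> N. P t" by (auto simp: eventually_log_end)
  thus "\<forall>\<^sub>F r in at_top. P (Complex r (\<phi> + pi))"
    unfolding eventually_at_top_dense using midline_in_log_strip by blast
qed

lemma log_strip_mono: "N \<le> N' \<Longrightarrow> log_strip \<phi> N' \<subseteq> log_strip \<phi> N"
  by (auto simp: log_strip_def)

text \<open>The strip has half-width pi > 1, so closed unit discs around points of the middle ray
  stay inside it. The factor exp \<epsilon> pays for moving one unit to the left, where the bound on
  \<open>f\<close> is weaker.\<close>

lemma midline_deriv_bound:
  assumes hol: "f holomorphic_on log_strip \<phi> N" and "\<epsilon> \<ge> 0" "C \<ge> 0"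
    and bnd: "\<And>t. t \<in> log_strip \<phi> N \<Longrightarrow> norm (f t) \<le> C * exp (- \<epsilon> * Re t)"
    and r: "r > N + 1"
  shows "norm ((deriv ^^ n) f (Complex r (\<phi> + pi))) \<le> (fact n * C * exp \<epsilon>) * exp (- \<epsilon> * r)"
proof -
  let ?z = "Complex r (\<phi> + pi)"
  have near: "x \<in> log_strip \<phi> N \<and> Re x \<ge> r - 1" if "norm (?z - x) \<le> 1" for x
  proof -
    have "\<bar>r - Re x\<bar> \<le> 1" "\<bar>\<phi> + pi - Im x\<bar> \<le> 1"
      using that abs_Re_le_cmod[of "?z - x"] abs_Im_le_cmod[of "?z - x"] by auto
    thus ?thesis using r pi_gt3 by (auto simp: log_strip_def abs_le_iff)
  qed
  have sub: "cball ?z 1 \<subseteq> log_strip \<phi> N" using near by (auto simp: dist_norm)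
  have "norm ((deriv ^^ n) f ?z) \<le> fact n * (C * exp (- \<epsilon> * (r - 1))) / 1 ^ n"
  proof (rule Cauchy_inequality)
    show "f holomorphic_on ball ?z 1" "continuous_on (cball ?z 1) f"
      using holomorphic_on_subset[OF hol] sub ball_subset_cball holomorphic_on_imp_continuous_on by blast+
    fix x assume "norm (?z - x) = 1"
    hence x: "x \<in> log_strip \<phi> N" "Re x \<ge> r - 1" using near by auto
    have "norm (f x) \<le> C * exp (- \<epsilon> * Re x)" by (rule bnd[OF x(1)])
    also have "\<dots> \<le> C * exp (- \<epsilon> * (r - 1))"
      using x(2) assms(2,3) by (intro mult_left_mono) (simp_all add: mult_left_mono)
    finally show "norm (f x) \<le> C * exp (- \<epsilon> * (r - 1))" .
  qed simp
  also have "exp (- \<epsilon> * (r - 1)) = exp \<epsilon> * exp (- \<epsilon> * r)" by (simp add: algebra_simps flip: exp_add)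
  finally show ?thesis by (simp add: mult_ac)
qed

lemma midline_deriv_tendsto_0:
  assumes hol: "f holomorphic_on log_strip \<phi> N" and lim: "(f \<longlongrightarrow> 0) (log_end \<phi>)"
  shows "((\<lambda>r. deriv f (Complex r (\<phi> + pi))) \<longlongrightarrow> 0) at_top"
proof (rule tendstoI)
  fix e :: real assume "e > 0"
  hence "\<forall>\<^sub>F t in log_end \<phi>. norm (f t) < e / 2" using tendstoD[OF lim, of "e / 2"] by simp
  then obtain N' where "N' \<ge> N" and N': "\<And>t. t \<in> log_strip \<phi> N' \<Longrightarrow> norm (f t) < e / 2"
    by (rule eventually_log_end_ge) blast
  have "norm (deriv f (Complex r (\<phi> + pi))) < e" if "r > N' + 1" for r
  proof -
    \<comment> \<open>Rate 0 turns the weighted estimate into a plain Cauchy bound, which suffices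
      for convergence without a rate.\<close>
    have "norm ((deriv ^^ 1) f (Complex r (\<phi> + pi))) \<le> (fact 1 * (e / 2) * exp 0) * exp (- 0 * r)"
      by (rule midline_deriv_bound[OF holomorphic_on_subset[OF hol log_strip_mono[OF \<open>N' \<ge> N\<close>]]])
        (use \<open>e > 0\<close> N' that in \<open>auto intro: less_imp_le\<close>)
    thus ?thesis using \<open>e > 0\<close> by simp
  qed
  thus "\<forall>\<^sub>F r in at_top. dist (deriv f (Complex r (\<phi> + pi))) 0 < e"
    unfolding eventually_at_top_dense by (auto simp: dist_norm)
qed

text \<open>Identity theorem: every tail of the middle ray has a limit point in the strip, which is
  convex and therefore connected.\<close>

lemma eq_on_log_strip:
  assumes "f holomorphic_on log_strip \<phi> N" "g holomorphic_on log_strip \<phi> N"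
    and ev: "\<forall>\<^sub>F r in at_top. f (Complex r (\<phi> + pi)) = g (Complex r (\<phi> + pi))"
    and "t \<in> log_strip \<phi> N"
  shows "f t = g t"
proof -
  obtain R where R: "\<And>r. r > R \<Longrightarrow> f (Complex r (\<phi> + pi)) = g (Complex r (\<phi> + pi))"
    using ev unfolding eventually_at_top_dense by blast
  define M where "M = max R N"
  let ?U = "(\<lambda>r. Complex r (\<phi> + pi)) ` {M<..}" and ?z = "Complex (M + 1) (\<phi> + pi)"
  have "f t - g t = 0"
  proof (rule analytic_continuation[where f = "\<lambda>t. f t - g t" and U = ?U and \<xi> = ?z])
    show "(\<lambda>t. f t - g t) holomorphic_on log_strip \<phi> N" using assms by (intro holomorphic_intros)
    show "open (log_strip \<phi> N)" by (rule open_log_strip)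
    show "connected (log_strip \<phi> N)" by (rule convex_connected[OF convex_log_strip])
    show "?U \<subseteq> log_strip \<phi> N" by (auto simp: M_def intro!: midline_in_log_strip)
    show "?z \<in> log_strip \<phi> N" by (rule midline_in_log_strip) (simp add: M_def)
    show "?z islimpt ?U"
      unfolding islimpt_approachable
    proof (intro allI impI)
      fix e :: real assume "e > 0"
      show "\<exists>x'\<in>?U. x' \<noteq> ?z \<and> dist x' ?z < e"
        by (rule bexI[of _ "Complex (M + 1 + e / 2) (\<phi> + pi)"])
          (use \<open>e > 0\<close> in \<open>auto simp: dist_norm cmod_def\<close>)
    qed
    show "f z - g z = 0" if "z \<in> ?U" for z using that R by (auto simp: M_def)
  qed (rule assms)
  thus ?thesis by simp
qed

section \<open>A triangular system with decaying perturbation\<close>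

lemma nilpotent_decay:
  fixes f\<^sub>1 f\<^sub>2 f\<^sub>3 d\<^sub>2 d\<^sub>3 :: "real \<Rightarrow> complex"
  assumes "\<epsilon> > 0" "K \<ge> 0"
    and der: "\<And>r. r > T \<Longrightarrow> (f\<^sub>1 has_vector_derivative f\<^sub>2 r) (at r)"
      "\<And>r. r > T \<Longrightarrow> (f\<^sub>2 has_vector_derivative d\<^sub>2 r) (at r)"
      "\<And>r. r > T \<Longrightarrow> (f\<^sub>3 has_vector_derivative d\<^sub>3 r) (at r)"
    and d2: "\<And>r. r > T \<Longrightarrow> norm (d\<^sub>2 r) \<le> norm (f\<^sub>3 r) / 2 + K * exp (- \<epsilon> * r) * (norm (f\<^sub>1 r) + norm (f\<^sub>2 r))"
    and d3: "\<And>r. r > T \<Longrightarrow> norm (d\<^sub>3 r) \<le> K * exp (- \<epsilon> * r) * (norm (f\<^sub>2 r) + norm (f\<^sub>3 r))"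
    and C: "\<And>r. r > T \<Longrightarrow> norm (f\<^sub>1 r) \<le> C * exp (- \<epsilon> * r)"
      "\<And>r. r > T \<Longrightarrow> norm (f\<^sub>2 r) \<le> C * exp (- \<epsilon> * r)"
      "\<And>r. r > T \<Longrightarrow> norm (f\<^sub>3 r) \<le> C * exp (- \<epsilon> * r)"
  shows "\<forall>\<^sub>F r in at_top. f\<^sub>1 r = 0"
proof -
  have lim: "(f \<longlongrightarrow> 0) at_top" if "\<And>r. r > T \<Longrightarrow> norm (f r) \<le> C * exp (- \<epsilon> * r)" for f :: "real \<Rightarrow> complex"
    by (rule Lim_null_comparison[OF _ exp_decay_tendsto_0[OF \<open>\<epsilon> > 0\<close>, of C]])
      (use that in \<open>unfold eventually_at_top_dense, blast\<close>)
  \<comment> \<open>The summands are the amplification factors in the bounds for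
    \<open>f\<^sub>3\<close>, \<open>f\<^sub>2\<close> and \<open>f\<^sub>1\<close>, in this order.
    The choice of 1 / (2 S) for the small coefficient thus makes each of the three at most
    1/2.\<close>
  define S where "S = 2 / \<epsilon> + (1 / \<epsilon> + 2) / \<epsilon> + (1 / \<epsilon> + 2) / \<epsilon> / \<epsilon>"
  have S: "S > 0" "2 / \<epsilon> \<le> S" "(1 / \<epsilon> + 2) / \<epsilon> \<le> S" "(1 / \<epsilon> + 2) / \<epsilon> / \<epsilon> \<le> S"
    using \<open>\<epsilon> > 0\<close> by (auto simp: S_def add_pos_pos add_nonneg_nonneg)
  have "\<forall>\<^sub>F r in at_top. K * exp (- \<epsilon> * r) < 1 / (2 * S) \<and> T < r"
    using order_tendstoD(2)[OF exp_decay_tendsto_0[OF \<open>\<epsilon> > 0\<close>, of K], of "1 / (2 * S)"] S(1)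
      eventually_gt_at_top[of T] by (auto intro: eventually_conj)
  then obtain R where R: "\<And>r. r > R \<Longrightarrow> K * exp (- \<epsilon> * r) < 1 / (2 * S) \<and> T < r"
    unfolding eventually_at_top_dense by blast
  define \<theta> where "\<theta> = 1 / (2 * S)"
  have \<theta>: "\<theta> > 0" "\<theta> * S = 1 / 2" using S by (auto simp: \<theta>_def)
  have half: "\<theta> * s * M \<le> M / 2" if "s \<le> S" "M \<ge> 0" for s M
  proof -
    have "\<theta> * s \<le> \<theta> * S" using \<theta> that by (intro mult_left_mono) auto
    hence "\<theta> * s * M \<le> 1 / 2 * M" unfolding \<theta>(2) using that by (intro mult_right_mono)
    thus ?thesis by simp
  qed
  define B where "B = (\<lambda>M. \<forall>r>R. norm (f\<^sub>1 r) \<le> M * exp (- \<epsilon> * r) \<and> norm (f\<^sub>2 r) \<le> M * exp (- \<epsilon> * r)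
    \<and> norm (f\<^sub>3 r) \<le> M * exp (- \<epsilon> * r))"
  have step: "B (M / 2)" if B: "B M" for M
  proof -
    have "0 \<le> M * exp (- \<epsilon> * (R + 1))" using B norm_ge_zero order_trans unfolding B_def
      by (metis less_add_one)
    hence M: "M \<ge> 0" by (simp add: zero_le_mult_iff)
    have sum: "K * exp (- \<epsilon> * r) * (norm (f r) + norm (g r)) \<le> (2 * \<theta> * M) * exp (- \<epsilon> * r)"
      if "r > R" "norm (f r) \<le> M * exp (- \<epsilon> * r)" "norm (g r) \<le> M * exp (- \<epsilon> * r)" for r and f g :: "real \<Rightarrow> complex"
    proof -
      have "K * exp (- \<epsilon> * r) * (norm (f r) + norm (g r)) \<le> \<theta> * (M * exp (- \<epsilon> * r) + M * exp (- \<epsilon> * r))"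
        using that R[of r] \<theta> by (intro mult_mono add_mono) (auto simp: \<theta>_def)
      thus ?thesis by (simp add: algebra_simps)
    qed
    have b3: "norm (f\<^sub>3 r - 0) \<le> (2 * \<theta> * M) / \<epsilon> * exp (- \<epsilon> * r)" if "r > R" for r
    proof (rule ray_decay[OF \<open>\<epsilon> > 0\<close> _ _ lim[OF C(3)] that])
      fix r assume r: "r > R"
      show "(f\<^sub>3 has_vector_derivative d\<^sub>3 r) (at r)" using der R[OF r] by blast
      have "norm (d\<^sub>3 r) \<le> K * exp (- \<epsilon> * r) * (norm (f\<^sub>2 r) + norm (f\<^sub>3 r))" using d3 R[OF r] by blast
      also have "\<dots> \<le> (2 * \<theta> * M) * exp (- \<epsilon> * r)" by (rule sum[OF r]) (use B r in \<open>auto simp: B_def\<close>)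
      finally show "norm (d\<^sub>3 r) \<le> (2 * \<theta> * M) * exp (- \<epsilon> * r)" .
    qed
    have b2: "norm (f\<^sub>2 r - 0) \<le> (\<theta> * (1 / \<epsilon> + 2) * M) / \<epsilon> * exp (- \<epsilon> * r)" if "r > R" for r
    proof (rule ray_decay[OF \<open>\<epsilon> > 0\<close> _ _ lim[OF C(2)] that])
      fix r assume r: "r > R"
      show "(f\<^sub>2 has_vector_derivative d\<^sub>2 r) (at r)" using der R[OF r] by blast
      have "norm (d\<^sub>2 r) \<le> norm (f\<^sub>3 r) / 2 + K * exp (- \<epsilon> * r) * (norm (f\<^sub>1 r) + norm (f\<^sub>2 r))"
        using d2 R[OF r] by blast
      also have "\<dots> \<le> ((2 * \<theta> * M) / \<epsilon> * exp (- \<epsilon> * r)) / 2 + (2 * \<theta> * M) * exp (- \<epsilon> * r)"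
        by (intro add_mono sum[OF r] divide_right_mono) (use b3[OF r] B r in \<open>auto simp: B_def\<close>)
      also have "\<dots> = (\<theta> * (1 / \<epsilon> + 2) * M) * exp (- \<epsilon> * r)" by (simp add: algebra_simps)
      finally show "norm (d\<^sub>2 r) \<le> (\<theta> * (1 / \<epsilon> + 2) * M) * exp (- \<epsilon> * r)" .
    qed
    have b1: "norm (f\<^sub>1 r - 0) \<le> (\<theta> * (1 / \<epsilon> + 2) * M) / \<epsilon> / \<epsilon> * exp (- \<epsilon> * r)" if "r > R" for r
    proof (rule ray_decay[OF \<open>\<epsilon> > 0\<close> _ _ lim[OF C(1)] that])
      fix r assume r: "r > R"
      show "(f\<^sub>1 has_vector_derivative f\<^sub>2 r) (at r)" using der R[OF r] by blast
      show "norm (f\<^sub>2 r) \<le> (\<theta> * (1 / \<epsilon> + 2) * M) / \<epsilon> * exp (- \<epsilon> * r)" using b2[OF r] by simp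
    qed
    have h: "(2 * \<theta> * M) / \<epsilon> \<le> M / 2" "(\<theta> * (1 / \<epsilon> + 2) * M) / \<epsilon> \<le> M / 2"
      "(\<theta> * (1 / \<epsilon> + 2) * M) / \<epsilon> / \<epsilon> \<le> M / 2"
      using half[OF S(2) M] half[OF S(3) M] half[OF S(4) M] by (simp_all add: mult_ac)
    have mono: "c * exp (- \<epsilon> * r) \<le> M / 2 * exp (- \<epsilon> * r)" if "c \<le> M / 2" for c r
      using that by (intro mult_right_mono) auto
    show ?thesis unfolding B_def
      using order_trans[OF b1 mono[OF h(3)]] order_trans[OF b2 mono[OF h(2)]] order_trans[OF b3 mono[OF h(1)]]
      by simp
  qed
  have "B (C / 2^n)" for n
  proof (induction n)
    case 0
    show ?case using C R by (simp add: B_def)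
  next
    case (Suc n)
    from step[OF this] show ?case by (simp add: mult.commute)
  qed
  hence bn: "norm (f\<^sub>1 r) \<le> C / 2^n * exp (- \<epsilon> * r)" if "r > R" for r n using that by (simp add: B_def)
  have "f\<^sub>1 r = 0" if "r > R" for r
  proof -
    have "(\<lambda>n. C * exp (- \<epsilon> * r) * (1/2)^n :: real) \<longlonglongrightarrow> C * exp (- \<epsilon> * r) * 0"
      by (intro tendsto_intros LIMSEQ_power_zero) simp
    hence "(\<lambda>n. C / 2^n * exp (- \<epsilon> * r)) \<longlonglongrightarrow> 0" by (simp add: power_one_over field_simps)
    from LIMSEQ_le_const[OF this] bn[OF that] have "norm (f\<^sub>1 r) \<le> 0" by blast
    thus ?thesis by simp
  qed
  thus ?thesis unfolding eventually_at_top_dense by blast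
qed

section \<open>Lifting a branch\<close>

lemma PVI_asymptotics_logD:
  assumes "PVI_asymptotics \<phi> R a \<sigma> y" "R > 0"
  obtains \<epsilon> C N where "\<epsilon> > 0" "N \<ge> ln R"
    "\<And>t. t \<in> log_strip \<phi> N \<Longrightarrow> norm (y (exp t) / (a * exp (of_real \<sigma> * t)) - 1) \<le> C * exp (- \<epsilon> * Re t)"
proof -
  obtain \<epsilon> where \<epsilon>: "\<epsilon> > 0" "(\<lambda>x. y x / (a * cut_powr \<phi> x \<sigma>) - 1)
      \<in> O[inf at_infinity (principal (cut_nhd_infinity \<phi> R))](\<lambda>x. cut_powr \<phi> x (- \<epsilon>))"
    using assms(1) unfolding PVI_asymptotics_def by blast
  from \<epsilon>(2) obtain C where "\<forall>\<^sub>F x in inf at_infinity (principal (cut_nhd_infinity \<phi> R)).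
      norm (y x / (a * cut_powr \<phi> x \<sigma>) - 1) \<le> C * norm (cut_powr \<phi> x (- \<epsilon>))"
    by (elim landau_o.bigE)
  then obtain b where b: "\<And>x. norm x \<ge> b \<Longrightarrow> x \<in> cut_nhd_infinity \<phi> R \<Longrightarrow>
      norm (y x / (a * cut_powr \<phi> x \<sigma>) - 1) \<le> C * norm (cut_powr \<phi> x (- \<epsilon>))"
    unfolding eventually_inf_principal eventually_at_infinity by blast
  \<comment> \<open>The threshold \<open>b\<close> may be nonpositive; \<open>max b 1\<close> keeps
    the logarithm meaningful.\<close>
  define N where "N = max (ln R) (ln (max b 1))"
  show ?thesis
  proof (rule that[OF \<epsilon>(1), of N])
    fix t assume t: "t \<in> log_strip \<phi> N"
    hence t': "t \<in> log_strip \<phi> (ln R)" "\<phi> < Im t" "Im t < \<phi> + 2 * pi" "Re t > ln (max b 1)"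
      by (auto simp: log_strip_def N_def)
    have "max b 1 = exp (ln (max b 1))" by simp
    also have "\<dots> \<le> exp (Re t)" using t'(4) by (subst exp_le_cancel_iff) simp
    finally have "norm (exp t) \<ge> b" by simp
    from b[OF this exp_in_cut_nhd[OF assms(2) t'(1)]]
    show "norm (y (exp t) / (a * exp (of_real \<sigma> * t)) - 1) \<le> C * exp (- \<epsilon> * Re t)"
      by (simp add: cut_powr_exp[OF t'(2,3)])
  qed (simp add: N_def)
qed

lemma near_1_not_nonpos:
  fixes z :: complex
  shows "norm (z - 1) < 1 \<Longrightarrow> z \<notin> \<real>\<^sub>\<le>\<^sub>0"
  using abs_Re_le_cmod[of "z - 1"] by (auto simp: complex_nonpos_Reals_iff)

lemma exp_decay_log_end:
  assumes "\<epsilon> > 0"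
  shows "((\<lambda>t. C * exp (- \<epsilon> * Re t)) \<longlongrightarrow> 0) (log_end \<phi>)"
  by (rule filterlim_compose[OF exp_decay_tendsto_0[OF assms] filterlim_Re_log_end])

lemma csqrt_branch_near_1:
  assumes hol: "f holomorphic_on log_strip \<phi> M" and lim: "(f \<longlongrightarrow> 1) (log_end \<phi>)"
  obtains N where "N \<ge> M" "(\<lambda>t. csqrt (f t)) holomorphic_on log_strip \<phi> N"
    "((\<lambda>t. csqrt (f t)) \<longlongrightarrow> 1) (log_end \<phi>)"
proof -
  have "\<forall>\<^sub>F t in log_end \<phi>. norm (f t - 1) < 1" using tendstoD[OF lim, of 1] by (simp add: dist_norm)
  then obtain N where N: "N \<ge> M" "\<And>t. t \<in> log_strip \<phi> N \<Longrightarrow> norm (f t - 1) < 1"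
    by (rule eventually_log_end_ge) blast
  show ?thesis
  proof (rule that[OF N(1)])
    show "(\<lambda>t. csqrt (f t)) holomorphic_on log_strip \<phi> N"
      by (rule holomorphic_on_csqrt'[OF holomorphic_on_subset[OF hol log_strip_mono[OF N(1)]]])
        (use N(2) near_1_not_nonpos in blast)
    have "isCont csqrt 1" by (intro continuous_at_csqrt near_1_not_nonpos) simp
    from isCont_tendsto_compose[OF this lim] show "((\<lambda>t. csqrt (f t)) \<longlongrightarrow> 1) (log_end \<phi>)" by simp
  qed
qed

text \<open>With \<open>S = sqrt (Y (Y - 1))\<close>, the exponential of the lift \<open>v\<close> of \<open>Y = (1 + cosh v) / 2\<close> is
  \<open>2 Y - 1 + 2 S\<close>.\<close>

lemma half_cosh_lift_of_sqrt:
  assumes Y: "Y holomorphic_on log_strip \<phi> M" and S: "S holomorphic_on log_strip \<phi> M"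
    and SS: "\<And>t. t \<in> log_strip \<phi> M \<Longrightarrow> S t ^ 2 = Y t * (Y t - 1)"
    and lim: "((\<lambda>t. (2 * Y t - 1 + 2 * S t) / exp (of_real \<sigma> * t + c)) \<longlongrightarrow> 1) (log_end \<phi>)"
  obtains w N where "N \<ge> M" "w holomorphic_on log_strip \<phi> N" "(w \<longlongrightarrow> 0) (log_end \<phi>)"
    "\<And>t. t \<in> log_strip \<phi> N \<Longrightarrow> Y t = (1 + cosh (of_real \<sigma> * t + c + w t)) / 2"
proof -
  define f where "f = (\<lambda>t. (2 * Y t - 1 + 2 * S t) / exp (of_real \<sigma> * t + c))"
  have f: "f holomorphic_on log_strip \<phi> M" unfolding f_def by (intro holomorphic_intros Y S) simp
  have "\<forall>\<^sub>F t in log_end \<phi>. norm (f t - 1) < 1" using tendstoD[OF lim, of 1] by (simp add: dist_norm f_def)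
  then obtain N where N: "N \<ge> M" "\<And>t. t \<in> log_strip \<phi> N \<Longrightarrow> norm (f t - 1) < 1"
    by (rule eventually_log_end_ge) blast
  hence np: "f t \<notin> \<real>\<^sub>\<le>\<^sub>0" if "t \<in> log_strip \<phi> N" for t using that near_1_not_nonpos by blast
  show ?thesis
  proof (rule that[OF N(1), of "\<lambda>t. Ln (f t)"])
    show "(\<lambda>t. Ln (f t)) holomorphic_on log_strip \<phi> N"
      by (rule holomorphic_on_Ln'[OF np holomorphic_on_subset[OF f log_strip_mono[OF N(1)]]])
    have "((\<lambda>t. Ln (f t)) \<longlongrightarrow> Ln 1) (log_end \<phi>)" by (rule tendsto_Ln) (use lim in \<open>auto simp: f_def\<close>)
    thus "((\<lambda>t. Ln (f t)) \<longlongrightarrow> 0) (log_end \<phi>)" by simp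
    fix t assume t: "t \<in> log_strip \<phi> N"
    have "f t \<noteq> 0" using np[OF t] by auto
    hence "exp (of_real \<sigma> * t + c + Ln (f t)) = exp (of_real \<sigma> * t + c) * f t" by (simp add: exp_add)
    also have "\<dots> = 2 * Y t - 1 + 2 * S t" by (simp add: f_def)
    finally show "Y t = (1 + cosh (of_real \<sigma> * t + c + Ln (f t))) / 2"
      using half_cosh_of_exp[OF SS] t log_strip_mono[OF N(1)] by fastforce
  qed
qed

text \<open>A holomorphic square root of Y (Y - 1) exists far out once a factor tending to 1 has
  been split off, as the principal root is holomorphic near 1. The constant \<open>c\<close> is
  matched to the sign of that root, so that exp v divided by exp (\<sigma> t + c) tends to 1 and its
  principal logarithm is the correction \<open>w\<close>.\<close>

lemma half_cosh_lift:
  fixes a c :: complex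
  assumes "a \<noteq> 0" "0 \<le> \<sigma>" "\<not> (\<sigma> = 0 \<and> a = 1)"
    and c: "\<sigma> > 0 \<longrightarrow> exp c = 4 * a" "\<sigma> = 0 \<longrightarrow> exp c = 2 * a - 1 + 2 * csqrt (a * (a - 1))"
    and Y: "Y holomorphic_on log_strip \<phi> M"
    and lim: "((\<lambda>t. Y t / (a * exp (of_real \<sigma> * t))) \<longlongrightarrow> 1) (log_end \<phi>)"
  obtains w N where "N \<ge> M" "w holomorphic_on log_strip \<phi> N" "(w \<longlongrightarrow> 0) (log_end \<phi>)"
    "\<And>t. t \<in> log_strip \<phi> N \<Longrightarrow> Y t = (1 + cosh (of_real \<sigma> * t + c + w t)) / 2"
    "\<And>t. t \<in> log_strip \<phi> N \<Longrightarrow> Y t \<noteq> 0 \<and> Y t \<noteq> 1"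
proof -
  have "\<exists>N S. N \<ge> M \<and> S holomorphic_on log_strip \<phi> N \<and>
      (\<forall>t\<in>log_strip \<phi> N. S t ^ 2 = Y t * (Y t - 1) \<and> Y t \<noteq> 0 \<and> Y t \<noteq> 1) \<and>
      ((\<lambda>t. (2 * Y t - 1 + 2 * S t) / exp (of_real \<sigma> * t + c)) \<longlongrightarrow> 1) (log_end \<phi>)"
  proof (cases "\<sigma> > 0")
    case True
    define q where "q = (\<lambda>t. Y t / (a * exp (of_real \<sigma> * t)))"
    have q: "(q \<longlongrightarrow> 1) (log_end \<phi>)" using lim by (simp add: q_def)
    have "((\<lambda>t. exp (- (of_real \<sigma> * t))) \<longlongrightarrow> (0 :: complex)) (log_end \<phi>)"
      by (rule tendsto_norm_zero_cancel) (use exp_decay_log_end[OF True, of 1] in simp)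
    hence "((\<lambda>t. 1 / q t * (exp (- (of_real \<sigma> * t)) / a)) \<longlongrightarrow> 1 / 1 * (0 / a)) (log_end \<phi>)"
      by (intro tendsto_intros q) (use assms in auto)
    moreover have "1 / q t * (exp (- (of_real \<sigma> * t)) / a) = 1 / Y t" for t
      using assms(1) by (simp add: q_def exp_minus field_simps)
    ultimately have Yinv: "((\<lambda>t. 1 / Y t) \<longlongrightarrow> 0) (log_end \<phi>)" by simp
    have "\<forall>\<^sub>F t in log_end \<phi>. norm (q t - 1) < 1 \<and> norm (1 / Y t) < 1"
      using tendstoD[OF q, of 1] tendstoD[OF Yinv, of 1] by (auto simp: dist_norm intro: eventually_conj)
    then obtain N\<^sub>0 where N\<^sub>0: "N\<^sub>0 \<ge> M" "\<And>t. t \<in> log_strip \<phi> N\<^sub>0 \<Longrightarrow> norm (q t - 1) < 1 \<and> norm (1 / Y t) < 1"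
      by (rule eventually_log_end_ge) blast
    have Y01: "Y t \<noteq> 0" "Y t \<noteq> 1" if "t \<in> log_strip \<phi> N\<^sub>0" for t
      using N\<^sub>0(2)[OF that] by (auto simp: q_def)
    have "(\<lambda>t. 1 - 1 / Y t) holomorphic_on log_strip \<phi> N\<^sub>0"
      by (intro holomorphic_intros holomorphic_on_subset[OF Y log_strip_mono[OF N\<^sub>0(1)]] Y01)
    moreover have "((\<lambda>t. 1 - 1 / Y t) \<longlongrightarrow> 1) (log_end \<phi>)" using tendsto_diff[OF tendsto_const Yinv, of 1] by simp
    ultimately obtain N where N: "N \<ge> N\<^sub>0" "(\<lambda>t. csqrt (1 - 1 / Y t)) holomorphic_on log_strip \<phi> N"
      "((\<lambda>t. csqrt (1 - 1 / Y t)) \<longlongrightarrow> 1) (log_end \<phi>)" by (rule csqrt_branch_near_1)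
    \<comment> \<open>Y tends to infinity here, so S is asymptotic to Y and 2 Y - 1 + 2 S to 4 Y, in
      agreement with exp c = 4 a.\<close>
    let ?S = "\<lambda>t. Y t * csqrt (1 - 1 / Y t)"
    have "?S holomorphic_on log_strip \<phi> N"
      by (intro holomorphic_intros N(2) holomorphic_on_subset[OF Y log_strip_mono]) (use N(1) N\<^sub>0(1) in simp)
    moreover have "?S t ^ 2 = Y t * (Y t - 1) \<and> Y t \<noteq> 0 \<and> Y t \<noteq> 1" if "t \<in> log_strip \<phi> N" for t
    proof -
      have nz: "Y t \<noteq> 0" "Y t \<noteq> 1" using Y01[of t] that log_strip_mono[OF N(1)] by auto
      have "?S t ^ 2 = Y t ^ 2 * (1 - 1 / Y t)" by (simp add: power_mult_distrib)
      thus ?thesis using nz by (simp add: power2_eq_square right_diff_distrib)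
    qed
    moreover have "((\<lambda>t. (2 * Y t - 1 + 2 * ?S t) / exp (of_real \<sigma> * t + c)) \<longlongrightarrow> 1) (log_end \<phi>)"
    proof -
      have "((\<lambda>t. q t * (2 - 1 / Y t + 2 * csqrt (1 - 1 / Y t)) / 4) \<longlongrightarrow> 1 * (2 - 0 + 2 * 1) / 4) (log_end \<phi>)"
        by (intro tendsto_intros q Yinv N(3)) simp
      moreover have "\<forall>\<^sub>F t in log_end \<phi>. q t * (2 - 1 / Y t + 2 * csqrt (1 - 1 / Y t)) / 4
          = (2 * Y t - 1 + 2 * ?S t) / exp (of_real \<sigma> * t + c)"
        unfolding eventually_log_end
      proof (intro exI[of _ N\<^sub>0] ballI)
        fix t assume "t \<in> log_strip \<phi> N\<^sub>0"
        hence "Y t \<noteq> 0" by (rule Y01)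
        thus "q t * (2 - 1 / Y t + 2 * csqrt (1 - 1 / Y t)) / 4 = (2 * Y t - 1 + 2 * ?S t) / exp (of_real \<sigma> * t + c)"
          using assms(1) by (simp add: q_def exp_add c(1)[rule_format, OF True] field_simps)
      qed
      ultimately have "((\<lambda>t. (2 * Y t - 1 + 2 * ?S t) / exp (of_real \<sigma> * t + c)) \<longlongrightarrow> 1 * (2 - 0 + 2 * 1) / 4) (log_end \<phi>)"
        by (rule Lim_transform_eventually)
      thus ?thesis by simp
    qed
    ultimately show ?thesis using N(1) N\<^sub>0(1) order_trans by blast
  next
    case False
    hence \<sigma>: "\<sigma> = 0" "a \<noteq> 1" using assms by auto
    \<comment> \<open>Y (Y - 1) tends to \<open>b\<close>, which is nonzero since a is neither 0 nor
      1; dividing by \<open>b\<close> produces the quantity that tends to 1.\<close>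
    define b r where "b = a * (a - 1)" and "r = csqrt b"
    have b: "b \<noteq> 0" using \<sigma> assms(1) by (simp add: b_def)
    have "((\<lambda>t. a * (Y t / (a * exp (of_real \<sigma> * t)))) \<longlongrightarrow> a * 1) (log_end \<phi>)" by (intro tendsto_intros lim)
    hence Ya: "(Y \<longlongrightarrow> a) (log_end \<phi>)" using assms(1) by (simp add: \<sigma>)
    have "\<forall>\<^sub>F t in log_end \<phi>. Y t \<noteq> 0 \<and> Y t \<noteq> 1"
      using tendsto_imp_eventually_ne[OF Ya assms(1)] tendsto_imp_eventually_ne[OF Ya \<sigma>(2)] by (rule eventually_conj)
    then obtain N\<^sub>0 where N\<^sub>0: "N\<^sub>0 \<ge> M" "\<And>t. t \<in> log_strip \<phi> N\<^sub>0 \<Longrightarrow> Y t \<noteq> 0 \<and> Y t \<noteq> 1"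
      by (rule eventually_log_end_ge) blast
    have "(\<lambda>t. Y t * (Y t - 1) / b) holomorphic_on log_strip \<phi> N\<^sub>0"
      by (intro holomorphic_intros holomorphic_on_subset[OF Y log_strip_mono[OF N\<^sub>0(1)]] b)
    moreover have "((\<lambda>t. Y t * (Y t - 1) / b) \<longlongrightarrow> 1) (log_end \<phi>)"
    proof -
      have "((\<lambda>t. Y t * (Y t - 1) / b) \<longlongrightarrow> a * (a - 1) / b) (log_end \<phi>)" by (intro tendsto_intros Ya b)
      thus ?thesis using b by (simp add: b_def)
    qed
    ultimately obtain N where N: "N \<ge> N\<^sub>0" "(\<lambda>t. csqrt (Y t * (Y t - 1) / b)) holomorphic_on log_strip \<phi> N"
      "((\<lambda>t. csqrt (Y t * (Y t - 1) / b)) \<longlongrightarrow> 1) (log_end \<phi>)" by (rule csqrt_branch_near_1)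
    let ?S = "\<lambda>t. r * csqrt (Y t * (Y t - 1) / b)"
    have "?S holomorphic_on log_strip \<phi> N" by (intro holomorphic_intros N(2))
    moreover have "?S t ^ 2 = Y t * (Y t - 1) \<and> Y t \<noteq> 0 \<and> Y t \<noteq> 1" if "t \<in> log_strip \<phi> N" for t
      using N\<^sub>0(2)[of t] that log_strip_mono[OF N(1)] b by (auto simp: power_mult_distrib r_def)
    moreover have "((\<lambda>t. (2 * Y t - 1 + 2 * ?S t) / exp (of_real \<sigma> * t + c)) \<longlongrightarrow> 1) (log_end \<phi>)"
    proof -
      have "((\<lambda>t. (2 * Y t - 1 + 2 * ?S t) / exp c) \<longlongrightarrow> (2 * a - 1 + 2 * (r * 1)) / exp c) (log_end \<phi>)"
        by (intro tendsto_intros Ya N(3)) simp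
      moreover have "(2 * a - 1 + 2 * (r * 1)) / exp c = 1"
        unfolding r_def b_def using c(2)[rule_format, OF \<sigma>(1)] exp_not_eq_zero[of c] by simp
      ultimately show ?thesis by (simp add: \<sigma>)
    qed
    ultimately show ?thesis using N(1) N\<^sub>0(1) order_trans by blast
  qed
  then obtain N S where N: "N \<ge> M" and S: "S holomorphic_on log_strip \<phi> N"
      "\<And>t. t \<in> log_strip \<phi> N \<Longrightarrow> S t ^ 2 = Y t * (Y t - 1)"
      "((\<lambda>t. (2 * Y t - 1 + 2 * S t) / exp (of_real \<sigma> * t + c)) \<longlongrightarrow> 1) (log_end \<phi>)"
    and Y01: "\<And>t. t \<in> log_strip \<phi> N \<Longrightarrow> Y t \<noteq> 0 \<and> Y t \<noteq> 1" by blast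
  obtain w N' where "N' \<ge> N" "w holomorphic_on log_strip \<phi> N'" "(w \<longlongrightarrow> 0) (log_end \<phi>)"
    "\<And>t. t \<in> log_strip \<phi> N' \<Longrightarrow> Y t = (1 + cosh (of_real \<sigma> * t + c + w t)) / 2"
    using half_cosh_lift_of_sqrt[OF holomorphic_on_subset[OF Y log_strip_mono[OF N]] S] by blast
  thus ?thesis using N Y01 log_strip_mono[OF \<open>N' \<ge> N\<close>] by (intro that[of N' w]) auto
qed

text \<open>Since sinh v ^ 2 = 4 Y (Y - 1), excluding the values 0 and 1 of Y rules out the
  degenerate alternative in \<open>PVI_eq_cosh_iff\<close>, and the equation for v follows.\<close>

lemma PVI_lift_ode:
  assumes w: "w holomorphic_on log_strip \<phi> N" and t: "t \<in> log_strip \<phi> N"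
    and Y: "\<And>t. t \<in> log_strip \<phi> N \<Longrightarrow> Y t = (1 + cosh (of_real \<sigma> * t + c + w t)) / 2"
    and nz: "Y t \<noteq> 0" "Y t \<noteq> 1" "exp t \<noteq> 1" "Y t \<noteq> exp t"
    and eq: "PVI_eq \<mu> (exp t) (Y t) (deriv Y t / exp t) ((deriv (deriv Y) t - deriv Y t) / exp t ^ 2)"
  shows "deriv (deriv w) t = PVI_pert \<mu> \<sigma> c t (w t) (deriv w t)"
proof -
  let ?D = "log_strip \<phi> N"
  note op = open_log_strip[of \<phi> N]
  define v where "v = (\<lambda>t. of_real \<sigma> * t + c + w t)"
  define q where "q = (\<lambda>t. of_real \<sigma> + deriv w t)"
  have dv: "(v has_field_derivative q s) (at s)" if "s \<in> ?D" for s
    unfolding v_def q_def using holomorphic_derivI[OF w op that] by (auto intro!: derivative_eq_intros)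
  have dq: "(q has_field_derivative deriv (deriv w) s) (at s)" if "s \<in> ?D" for s
    unfolding q_def using holomorphic_derivI[OF holomorphic_deriv[OF w op] op that]
    by (auto intro!: derivative_eq_intros)
  have dY: "deriv Y s = sinh (v s) * q s / 2" if "s \<in> ?D" for s
  proof (rule DERIV_imp_deriv, rule has_field_derivative_transform_within_open[OF _ op that])
    show "((\<lambda>t. (1 + cosh (v t)) / 2) has_field_derivative sinh (v s) * q s / 2) (at s)"
      using dv[OF that] by (auto intro!: derivative_eq_intros)
  qed (simp add: Y v_def)
  have ddY: "deriv (deriv Y) t = (cosh (v t) * q t ^ 2 + sinh (v t) * deriv (deriv w) t) / 2"
  proof (rule DERIV_imp_deriv, rule has_field_derivative_transform_within_open[OF _ op t])
    show "((\<lambda>t. sinh (v t) * q t / 2) has_field_derivative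
      (cosh (v t) * q t ^ 2 + sinh (v t) * deriv (deriv w) t) / 2) (at t)"
      using dv[OF t] dq[OF t] by (auto intro!: derivative_eq_intros simp: power2_eq_square algebra_simps)
  qed (simp add: dY)
  have Yv: "Y t = (1 + cosh (v t)) / 2" using Y[OF t] by (simp add: v_def)
  have "sinh (v t) ^ 2 = 4 * (Y t * (Y t - 1))"
    unfolding sinh_square_eq Yv by (simp add: field_simps power2_eq_square)
  hence sh: "sinh (v t) \<noteq> 0" using nz by auto
  have "PVI_eq \<mu> (exp t) ((1 + cosh (v t)) / 2) (sinh (v t) * q t / 2 / exp t)
    (((cosh (v t) * q t ^ 2 + sinh (v t) * deriv (deriv w) t) / 2 - sinh (v t) * q t / 2) / exp t ^ 2)"
    using eq unfolding dY[OF t] ddY Yv .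
  hence "deriv (deriv w) t = PVI_cosh \<mu> (exp t) (v t) (q t)"
    using sh nz(3,4) by (subst (asm) PVI_eq_cosh_iff) (auto simp: Yv)
  thus ?thesis by (simp add: PVI_pert_def v_def q_def)
qed

section \<open>Uniqueness\<close>

text \<open>Supplies the hypotheses of \<open>decaying_second_order_unique\<close>. The asymptotics
  yield w \<rightarrow> 0 on the whole end of the strip, whereas the decay of its derivative is
  obtained on the middle ray only.\<close>

lemma PVI_lift_pert_ray:
  assumes a: "a \<noteq> 0" "0 \<le> \<sigma>" "\<sigma> < 1" "\<not> (\<sigma> = 0 \<and> a = 1)"
    and c: "\<sigma> > 0 \<longrightarrow> exp c = 4 * a" "\<sigma> = 0 \<longrightarrow> exp c = 2 * a - 1 + 2 * csqrt (a * (a - 1))"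
    and br: "PVI_branch \<mu> \<phi> R y" and asy: "PVI_asymptotics \<phi> R a \<sigma> y"
  obtains w where
    "\<forall>\<^sub>F r in at_top. y (exp (Complex r (\<phi> + pi))) = (1 + cosh (of_real \<sigma> * Complex r (\<phi> + pi) + c + w (Complex r (\<phi> + pi)))) / 2"
    "((\<lambda>r. w (Complex r (\<phi> + pi))) \<longlongrightarrow> 0) at_top" "((\<lambda>r. deriv w (Complex r (\<phi> + pi))) \<longlongrightarrow> 0) at_top"
    "\<forall>\<^sub>F r in at_top. ((\<lambda>r. w (Complex r (\<phi> + pi))) has_vector_derivative deriv w (Complex r (\<phi> + pi))) (at r)"
    "\<forall>\<^sub>F r in at_top. ((\<lambda>r. deriv w (Complex r (\<phi> + pi))) has_vector_derivative
      PVI_pert \<mu> \<sigma> c (Complex r (\<phi> + pi)) (w (Complex r (\<phi> + pi))) (deriv w (Complex r (\<phi> + pi)))) (at r)"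
proof -
  define Y where "Y = (\<lambda>t. y (exp t))"
  have "R \<ge> 1" using br by (simp add: PVI_branch_def)
  hence R: "R > 0" by simp
  note Yhol = PVI_branch_logD(1)[OF br, folded Y_def]
  obtain \<epsilon> C N where "\<epsilon> > 0" and N: "N \<ge> ln R" and
    b: "\<And>t. t \<in> log_strip \<phi> N \<Longrightarrow> norm (y (exp t) / (a * exp (of_real \<sigma> * t)) - 1) \<le> C * exp (- \<epsilon> * Re t)"
    by (rule PVI_asymptotics_logD[OF asy R]) (rule that)
  have "\<forall>\<^sub>F t in log_end \<phi>. norm (Y t / (a * exp (of_real \<sigma> * t)) - 1) \<le> C * exp (- \<epsilon> * Re t)"
    unfolding eventually_log_end Y_def using b by blast
  hence "((\<lambda>t. Y t / (a * exp (of_real \<sigma> * t)) - 1) \<longlongrightarrow> 0) (log_end \<phi>)"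
    by (rule Lim_null_comparison[OF _ exp_decay_log_end[OF \<open>\<epsilon> > 0\<close>]])
  hence lim: "((\<lambda>t. Y t / (a * exp (of_real \<sigma> * t))) \<longlongrightarrow> 1) (log_end \<phi>)" by (rule LIM_zero_cancel)
  obtain w N\<^sub>1 where
    N1: "N\<^sub>1 \<ge> ln R" "w holomorphic_on log_strip \<phi> N\<^sub>1" "(w \<longlongrightarrow> 0) (log_end \<phi>)"
    and Yw: "\<And>t. t \<in> log_strip \<phi> N\<^sub>1 \<Longrightarrow> Y t = (1 + cosh (of_real \<sigma> * t + c + w t)) / 2"
    and Y01: "\<And>t. t \<in> log_strip \<phi> N\<^sub>1 \<Longrightarrow> Y t \<noteq> 0 \<and> Y t \<noteq> 1"
    by (rule half_cosh_lift[OF a(1,2,4) c Yhol lim]) (rule that)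
  obtain \<rho>\<^sub>0 where ns: "\<And>t w. Re t > \<rho>\<^sub>0 \<Longrightarrow> norm w < 3 \<Longrightarrow>
      exp t \<noteq> 1 \<and> (1 + cosh (of_real \<sigma> * t + c + w)) / 2 \<noteq> exp t"
    by (rule PVI_pert_bounds[OF a(2,3), where c = c and \<mu> = \<mu>]) (rule that)
  have "\<forall>\<^sub>F t in log_end \<phi>. norm (w t) < 3" using tendstoD[OF N1(3), of 3] by simp
  then obtain N where N: "N \<ge> max N\<^sub>1 \<rho>\<^sub>0" "\<And>t. t \<in> log_strip \<phi> N \<Longrightarrow> norm (w t) < 3"
    by (rule eventually_log_end_ge) blast
  have sub: "log_strip \<phi> N \<subseteq> log_strip \<phi> N\<^sub>1" "log_strip \<phi> N \<subseteq> log_strip \<phi> (ln R)"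
    using N(1) N1(1) by (auto intro!: log_strip_mono)
  have w: "w holomorphic_on log_strip \<phi> N" using N1(2) sub(1) by (rule holomorphic_on_subset)
  have ode: "deriv (deriv w) t = PVI_pert \<mu> \<sigma> c t (w t) (deriv w t)" if "t \<in> log_strip \<phi> N" for t
  proof (rule PVI_lift_ode[where Y = Y, OF w that])
    have "Re t > \<rho>\<^sub>0" using that N(1) by (simp add: log_strip_def)
    from ns[OF this N(2)[OF that]] have ns: "exp t \<noteq> 1" "(1 + cosh (of_real \<sigma> * t + c + w t)) / 2 \<noteq> exp t"
      by blast+
    have t: "t \<in> log_strip \<phi> N\<^sub>1" using that sub by blast
    show "exp t \<noteq> 1" by (rule ns(1))
    show "Y t \<noteq> exp t" unfolding Yw[OF t] by (rule ns(2))
    show "Y t \<noteq> 0" "Y t \<noteq> 1" using Y01[OF t] by blast+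
    show "Y t = (1 + cosh (of_real \<sigma> * t + c + w t)) / 2" if "t \<in> log_strip \<phi> N" for t
      by (rule Yw) (use that sub in blast)
    show "PVI_eq \<mu> (exp t) (Y t) (deriv Y t / exp t) ((deriv (deriv Y) t - deriv Y t) / (exp t)\<^sup>2)"
      unfolding Y_def by (rule PVI_branch_logD(2)[OF br]) (use that sub in blast)
  qed
  show ?thesis
  proof (rule that[of w])
    show "\<forall>\<^sub>F r in at_top. y (exp (Complex r (\<phi> + pi))) = (1 + cosh (of_real \<sigma> * Complex r (\<phi> + pi) + c + w (Complex r (\<phi> + pi)))) / 2"
      unfolding eventually_at_top_dense using Yw[OF midline_in_log_strip] by (auto simp: Y_def)
    show "((\<lambda>r. w (Complex r (\<phi> + pi))) \<longlongrightarrow> 0) at_top"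
      by (rule filterlim_compose[OF N1(3) filterlim_midline])
    show "((\<lambda>r. deriv w (Complex r (\<phi> + pi))) \<longlongrightarrow> 0) at_top"
      by (rule midline_deriv_tendsto_0[OF w N1(3)])
    show "\<forall>\<^sub>F r in at_top. ((\<lambda>r. w (Complex r (\<phi> + pi))) has_vector_derivative deriv w (Complex r (\<phi> + pi))) (at r)"
      unfolding eventually_at_top_dense
      by (intro exI[of _ N] allI impI has_vector_derivative_horizontal
          holomorphic_derivI[OF w open_log_strip] midline_in_log_strip)
    show "\<forall>\<^sub>F r in at_top. ((\<lambda>r. deriv w (Complex r (\<phi> + pi))) has_vector_derivative
      PVI_pert \<mu> \<sigma> c (Complex r (\<phi> + pi)) (w (Complex r (\<phi> + pi))) (deriv w (Complex r (\<phi> + pi)))) (at r)"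
      unfolding eventually_at_top_dense
    proof (intro exI[of _ N] allI impI has_vector_derivative_horizontal)
      fix r assume "r > N"
      hence t: "Complex r (\<phi> + pi) \<in> log_strip \<phi> N" by (rule midline_in_log_strip)
      show "(deriv w has_field_derivative PVI_pert \<mu> \<sigma> c (Complex r (\<phi> + pi)) (w (Complex r (\<phi> + pi)))
        (deriv w (Complex r (\<phi> + pi)))) (at (Complex r (\<phi> + pi)))"
        unfolding ode[OF t, symmetric]
        by (rule holomorphic_derivI[OF holomorphic_deriv[OF w open_log_strip] open_log_strip t])
    qed
  qed
qed

lemma PVI_branch_unique_generic:
  assumes a: "a \<noteq> 0" "0 \<le> \<sigma>" "\<sigma> < 1" "\<not> (\<sigma> = 0 \<and> a = 1)"
    and 1: "PVI_branch \<mu> \<phi> R\<^sub>1 y\<^sub>1" "PVI_asymptotics \<phi> R\<^sub>1 a \<sigma> y\<^sub>1"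
    and 2: "PVI_branch \<mu> \<phi> R\<^sub>2 y\<^sub>2" "PVI_asymptotics \<phi> R\<^sub>2 a \<sigma> y\<^sub>2"
  shows "\<forall>\<^sub>F r in at_top. y\<^sub>1 (exp (Complex r (\<phi> + pi))) = y\<^sub>2 (exp (Complex r (\<phi> + pi)))"
proof -
  \<comment> \<open>The constant depends on a and \<sigma> alone, so both branches are lifted with
    the same \<open>c\<close> and their corrections solve the same equation.\<close>
  define c where "c = (if \<sigma> > 0 then Ln (4 * a) else Ln (2 * a - 1 + 2 * csqrt (a * (a - 1))))"
  have nz: "2 * a - 1 + 2 * csqrt (a * (a - 1)) \<noteq> 0"
  proof
    define S where "S = csqrt (a * (a - 1))"
    assume "2 * a - 1 + 2 * csqrt (a * (a - 1)) = 0"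
    hence "2 * a - 1 = - (2 * S)" unfolding S_def by (simp add: eq_neg_iff_add_eq_0)
    hence "(2 * a - 1)^2 = (2 * S)^2" by simp
    also have "\<dots> = 4 * (a * (a - 1))" by (simp add: S_def power_mult_distrib)
    finally show False by (simp add: power2_eq_square algebra_simps)
  qed
  have c: "\<sigma> > 0 \<longrightarrow> exp c = 4 * a" "\<sigma> = 0 \<longrightarrow> exp c = 2 * a - 1 + 2 * csqrt (a * (a - 1))"
    using a(1) nz by (simp_all add: c_def)
  let ?t = "\<lambda>r. Complex r (\<phi> + pi)"
  obtain w\<^sub>1 where
    w1: "\<forall>\<^sub>F r in at_top. y\<^sub>1 (exp (?t r)) = (1 + cosh (of_real \<sigma> * ?t r + c + w\<^sub>1 (?t r))) / 2"
    "((\<lambda>r. w\<^sub>1 (?t r)) \<longlongrightarrow> 0) at_top" "((\<lambda>r. deriv w\<^sub>1 (?t r)) \<longlongrightarrow> 0) at_top"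
    "\<forall>\<^sub>F r in at_top. ((\<lambda>r. w\<^sub>1 (?t r)) has_vector_derivative deriv w\<^sub>1 (?t r)) (at r)"
    "\<forall>\<^sub>F r in at_top. ((\<lambda>r. deriv w\<^sub>1 (?t r)) has_vector_derivative PVI_pert \<mu> \<sigma> c (?t r) (w\<^sub>1 (?t r)) (deriv w\<^sub>1 (?t r))) (at r)"
    by (rule PVI_lift_pert_ray[OF a c 1]) (rule that)
  obtain w\<^sub>2 where
    w2: "\<forall>\<^sub>F r in at_top. y\<^sub>2 (exp (?t r)) = (1 + cosh (of_real \<sigma> * ?t r + c + w\<^sub>2 (?t r))) / 2"
    "((\<lambda>r. w\<^sub>2 (?t r)) \<longlongrightarrow> 0) at_top" "((\<lambda>r. deriv w\<^sub>2 (?t r)) \<longlongrightarrow> 0) at_top"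
    "\<forall>\<^sub>F r in at_top. ((\<lambda>r. w\<^sub>2 (?t r)) has_vector_derivative deriv w\<^sub>2 (?t r)) (at r)"
    "\<forall>\<^sub>F r in at_top. ((\<lambda>r. deriv w\<^sub>2 (?t r)) has_vector_derivative PVI_pert \<mu> \<sigma> c (?t r) (w\<^sub>2 (?t r)) (deriv w\<^sub>2 (?t r))) (at r)"
    by (rule PVI_lift_pert_ray[OF a c 2]) (rule that)
  obtain \<rho>\<^sub>0 K where
    lip: "\<And>t w p w' p'. Re t > \<rho>\<^sub>0 \<Longrightarrow> norm w \<le> 1 \<Longrightarrow> norm p \<le> 1 \<Longrightarrow>
      norm w' \<le> 1 \<Longrightarrow> norm p' \<le> 1 \<Longrightarrow>
      norm (PVI_pert \<mu> \<sigma> c t w p - PVI_pert \<mu> \<sigma> c t w' p')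
        \<le> K * exp (- (1 - \<sigma>) * Re t) * (norm (w - w') + norm (p - p'))"
    by (rule PVI_pert_bounds[OF a(2,3), where c = c and \<mu> = \<mu>]) (rule that)
  have "\<forall>\<^sub>F r in at_top.
    ((\<lambda>r. w\<^sub>1 (?t r)) has_vector_derivative deriv w\<^sub>1 (?t r)) (at r) \<and>
    ((\<lambda>r. deriv w\<^sub>1 (?t r)) has_vector_derivative PVI_pert \<mu> \<sigma> c (?t r) (w\<^sub>1 (?t r)) (deriv w\<^sub>1 (?t r))) (at r) \<and>
    ((\<lambda>r. w\<^sub>2 (?t r)) has_vector_derivative deriv w\<^sub>2 (?t r)) (at r) \<and>
    ((\<lambda>r. deriv w\<^sub>2 (?t r)) has_vector_derivative PVI_pert \<mu> \<sigma> c (?t r) (w\<^sub>2 (?t r)) (deriv w\<^sub>2 (?t r))) (at r)"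
    by (intro eventually_conj w1(4,5) w2(4,5))
  then obtain T where T: "\<And>r. r > T \<Longrightarrow> ((\<lambda>r. w\<^sub>1 (?t r)) has_vector_derivative deriv w\<^sub>1 (?t r)) (at r)"
    "\<And>r. r > T \<Longrightarrow> ((\<lambda>r. deriv w\<^sub>1 (?t r)) has_vector_derivative PVI_pert \<mu> \<sigma> c (?t r) (w\<^sub>1 (?t r)) (deriv w\<^sub>1 (?t r))) (at r)"
    "\<And>r. r > T \<Longrightarrow> ((\<lambda>r. w\<^sub>2 (?t r)) has_vector_derivative deriv w\<^sub>2 (?t r)) (at r)"
    "\<And>r. r > T \<Longrightarrow> ((\<lambda>r. deriv w\<^sub>2 (?t r)) has_vector_derivative PVI_pert \<mu> \<sigma> c (?t r) (w\<^sub>2 (?t r)) (deriv w\<^sub>2 (?t r))) (at r)"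
    unfolding eventually_at_top_dense by blast
  have "\<forall>\<^sub>F r in at_top. w\<^sub>1 (?t r) = w\<^sub>2 (?t r)"
    by (rule decaying_second_order_unique[where F = "PVI_pert \<mu> \<sigma> c" and \<kappa> = "1 - \<sigma>" and K = K and \<rho>\<^sub>0 = \<rho>\<^sub>0
          and T = T and \<eta> = "\<phi> + pi" and w\<^sub>1 = "\<lambda>r. w\<^sub>1 (?t r)" and w\<^sub>2 = "\<lambda>r. w\<^sub>2 (?t r)"
          and p\<^sub>1 = "\<lambda>r. deriv w\<^sub>1 (?t r)" and p\<^sub>2 = "\<lambda>r. deriv w\<^sub>2 (?t r)"])
      (fact w1(2,3) w2(2,3) | rule T lip; assumption | use a(3) in simp)+
  with w1(1) w2(1) show ?thesis by eventually_elim (simp only:)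
qed

section \<open>The exceptional case of exponent 0 and leading coefficient 1\<close>

text \<open>The only term of the equation singular at y = 1 is P^2 / (2 (y - 1)). Isolating it shows
  that P^2 is y - 1 times a regular expression, and working with the cleared form keeps this valid
  at points where y = 1.\<close>

lemma PVI_eq_square_form:
  fixes x y P Q \<mu> :: complex
  assumes "x \<noteq> 0" "x \<noteq> 1" "y \<noteq> 0" "y \<noteq> x"
  defines "k \<equiv> (1 / y + 1 / (y - x)) / 2" and "b \<equiv> - x * (y - 1) / ((x - 1) * (y - x))"
    and "h \<equiv> y / 2 * ((2 * \<mu> - 1)^2 * (y - x) / (x - 1)^2 + x / ((x - 1) * (y - x)))"
  assumes eq: "PVI_eq \<mu> x y (P / x) ((Q - P) / x^2)"
  shows "(y - 1) * (2 * (Q - k * P^2 - b * P - h * (y - 1))) = P^2"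
proof -
  define u w g m where "u = x - 1" and "w = y - x" and "g = y - 1" and "m = (2 * \<mu> - 1)^2"
  have nz: "u \<noteq> 0" "w \<noteq> 0" "y \<noteq> 0" and g: "g = w + u" using assms by (auto simp: u_def w_def g_def)
  define A where "A = u^2 * y * w"
  have A: "A \<noteq> 0" using nz by (simp add: A_def)
  have Ak: "A * k = u^2 * (w + y) / 2" using nz by (simp add: A_def k_def w_def[symmetric] field_simps)
  have Ab: "A * b = - x * g * u * y" using nz
    by (simp add: A_def b_def u_def[symmetric] w_def[symmetric] g_def[symmetric] field_simps power2_eq_square)
  have Ah: "A * h = y^2 / 2 * (m * w^2 + x * u)" 
    unfolding A_def h_def u_def[symmetric] w_def[symmetric] m_def[symmetric]
    using nz by (simp add: field_simps power2_eq_square)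
  have e: "2 * u^2 * y * g * w * (Q - P) =
       u^2 * (g * w + y * w + y * g) * P^2 - 2 * u * y * g * (u * w + x * w + x * u) * P
       + y^2 * g^2 * (m * w^2 + x * u)"
    using eq unfolding PVI_eq_log[OF assms(1)] u_def w_def g_def m_def .
  have "A * (g * (2 * (Q - k * P^2 - b * P - h * g)) - P^2) =
    2 * g * (A * Q - (A * k) * P^2 - (A * b) * P - (A * h) * g) - A * P^2"
    by (simp add: algebra_simps)
  also have "\<dots> = 2 * u^2 * y * g * w * (Q - P) -
       (u^2 * (g * w + y * w + y * g) * P^2 - 2 * u * y * g * (u * w + x * w + x * u) * P
       + y^2 * g^2 * (m * w^2 + x * u))"
    unfolding Ak Ab Ah unfolding A_def g by (simp add: field_simps power2_eq_square)
  also have "\<dots> = 0" using e by simp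
  finally show ?thesis using A by (simp add: g_def)
qed

text \<open>Two coefficients decay like 1/|x|. The coefficient of P^2 is merely bounded, which is
  enough because one of the factors P will supply decay.\<close>

lemma PVI_coeff_bounds_near_1:
  fixes x y \<mu> :: complex
  assumes "norm x \<ge> 4" "norm (y - 1) \<le> 1 / 2"
  shows "y \<noteq> 0" "y \<noteq> x" "x \<noteq> 1" "norm ((1 / y + 1 / (y - x)) / 2) \<le> 2"
    "norm (- x * (y - 1) / ((x - 1) * (y - x))) \<le> 2 / norm x"
    "norm (y / 2 * ((2 * \<mu> - 1)^2 * (y - x) / (x - 1)^2 + x / ((x - 1) * (y - x))))
      \<le> (6 * norm (2 * \<mu> - 1)^2 + 3) / norm x"
proof -
  define X where "X = norm x"
  have X: "X \<ge> 4" using assms by (simp add: X_def)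
  have y: "norm y \<ge> 1 / 2" "norm y \<le> 3 / 2"
    using norm_triangle_ineq2[of 1 "1 - y"] norm_triangle_ineq2[of y 1] assms(2) by (auto simp: norm_minus_commute)
  have w: "norm (y - x) \<ge> X / 2" "norm (y - x) \<le> 2 * X" "norm (y - x) \<ge> 1"
    using norm_triangle_ineq2[of x y] norm_triangle_ineq4[of y x] y X by (auto simp: X_def norm_minus_commute)
  have u: "norm (x - 1) \<ge> X / 2" using norm_triangle_ineq2[of x 1] X by (simp add: X_def)
  show "y \<noteq> 0" "y \<noteq> x" using y w by auto
  show "x \<noteq> 1" using assms(1) by auto
  have "norm (1 / y) \<le> 1 / (1 / 2)" "norm (1 / (y - x)) \<le> 1 / 1"
    unfolding norm_divide norm_one using y w by (intro frac_le; simp)+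
  hence "norm (1 / y + 1 / (y - x)) \<le> 4" using norm_triangle_ineq[of "1 / y" "1 / (y - x)"] by simp
  thus "norm ((1 / y + 1 / (y - x)) / 2) \<le> 2" by (simp add: norm_divide[of _ 2] del: divide_const_simps)
  have "norm (- x * (y - 1) / ((x - 1) * (y - x))) = X * norm (y - 1) / (norm (x - 1) * norm (y - x))"
    by (simp add: norm_divide norm_mult X_def)
  also have "\<dots> \<le> X * (1 / 2) / (X / 2 * (X / 2))"
    using X w u assms(2) by (intro frac_le mult_mono) auto
  also have "\<dots> = 2 / X" using X by (simp add: field_simps)
  finally show "norm (- x * (y - 1) / ((x - 1) * (y - x))) \<le> 2 / norm x" by (simp add: X_def)
  define m where "m = norm (2 * \<mu> - 1)^2"
  have "norm (y / 2 * ((2 * \<mu> - 1)^2 * (y - x) / (x - 1)^2 + x / ((x - 1) * (y - x)))) =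
    norm y / 2 * norm ((2 * \<mu> - 1)^2 * (y - x) / (x - 1)^2 + x / ((x - 1) * (y - x)))"
    unfolding norm_mult[of "y / 2"] norm_divide[of y] by simp
  also have "\<dots> \<le> (3 / 2) / 2 * (m * (2 * X) / (X / 2)^2 + X / (X / 2 * (X / 2)))"
  proof (intro mult_mono divide_right_mono order_trans[OF norm_triangle_ineq] add_mono)
    show "norm ((2 * \<mu> - 1)^2 * (y - x) / (x - 1)^2) \<le> m * (2 * X) / (X / 2)^2"
      unfolding norm_divide norm_mult norm_power m_def
      using w u X by (intro frac_le mult_mono power_mono) auto
    show "norm (x / ((x - 1) * (y - x))) \<le> X / (X / 2 * (X / 2))"
      unfolding norm_divide norm_mult X_def[symmetric] using w u X by (intro frac_le mult_mono) auto
  qed (use y in auto)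
  also have "\<dots> = (6 * m + 3) / X" using X by (simp add: field_simps power2_eq_square)
  finally show "norm (y / 2 * ((2 * \<mu> - 1)^2 * (y - x) / (x - 1)^2 + x / ((x - 1) * (y - x))))
      \<le> (6 * norm (2 * \<mu> - 1)^2 + 3) / norm x" by (simp add: X_def m_def)
qed

text \<open>The lift \<open>v\<close> would have to be a branch of \<open>2 arsinh (sqrt (y - 1))\<close>, which need not be
  single valued a priori.  Instead the first derivative of \<open>g = y - 1\<close> is tracked together with
  \<open>E = g'^2 / g\<close>, which the equation itself shows to be holomorphic and which satisfies a first-order
  equation.\<close>

lemma PVI_branch_unique_at_1:
  assumes br: "PVI_branch \<mu> \<phi> R y" and asy: "PVI_asymptotics \<phi> R 1 0 y"
  shows "\<forall>\<^sub>F r in at_top. y (exp (Complex r (\<phi> + pi))) = 1"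
proof -
  define Y where "Y = (\<lambda>t. y (exp t))"
  have "R \<ge> 1" using br by (simp add: PVI_branch_def)
  hence R: "R > 0" by simp
  obtain \<epsilon>\<^sub>0 C\<^sub>0 N\<^sub>0 where "\<epsilon>\<^sub>0 > 0" and N0: "N\<^sub>0 \<ge> ln R" and
    b0: "\<And>t. t \<in> log_strip \<phi> N\<^sub>0 \<Longrightarrow> norm (y (exp t) / (1 * exp (of_real 0 * t)) - 1) \<le> C\<^sub>0 * exp (- \<epsilon>\<^sub>0 * Re t)"
    by (rule PVI_asymptotics_logD[OF asy R]) (rule that)
  \<comment> \<open>The coefficients decay like exp (-Re t); capping the rate at 1 gives one rate
    valid for them and for Y - 1.\<close>
  define \<epsilon> C where "\<epsilon> = min \<epsilon>\<^sub>0 1" and "C = \<bar>C\<^sub>0\<bar>"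
  have \<epsilon>: "0 < \<epsilon>" "\<epsilon> \<le> 1" using \<open>\<epsilon>\<^sub>0 > 0\<close> by (auto simp: \<epsilon>_def)
  have "\<forall>\<^sub>F t in log_end \<phi>. C * exp (- \<epsilon> * Re t) < 1 / 2"
    using order_tendstoD(2)[OF exp_decay_log_end[OF \<epsilon>(1), of C], of "1 / 2"] by simp
  \<comment> \<open>Re t > 3 gives |exp t| \<ge> 4 by exp r \<ge> 1 + r, and 1/2 is the radius
    around y = 1 in \<open>PVI_coeff_bounds_near_1\<close>.\<close>
  then obtain N where N: "N \<ge> max N\<^sub>0 3" "\<And>t. t \<in> log_strip \<phi> N \<Longrightarrow> C * exp (- \<epsilon> * Re t) < 1 / 2"
    by (rule eventually_log_end_ge) blast
  define D where "D = log_strip \<phi> N"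
  have sub: "D \<subseteq> log_strip \<phi> N\<^sub>0" "D \<subseteq> log_strip \<phi> (ln R)"
    using N(1) N0 by (auto simp: D_def intro!: log_strip_mono)
  have opD: "open D" and conD: "connected D"
    unfolding D_def by (rule open_log_strip, rule convex_connected[OF convex_log_strip])
  have Re: "Re t > 3" if "t \<in> D" for t using that N(1) by (simp add: D_def log_strip_def)
  define g where "g = (\<lambda>t. Y t - 1)"
  have gb: "norm (g t) \<le> C * exp (- \<epsilon> * Re t)" if "t \<in> D" for t
  proof -
    have "norm (g t) \<le> C\<^sub>0 * exp (- \<epsilon>\<^sub>0 * Re t)" using b0[of t] that sub by (auto simp: g_def Y_def)
    also have "\<dots> \<le> C * exp (- \<epsilon> * Re t)"
      using Re[OF that] by (intro mult_mono) (auto simp: C_def \<epsilon>_def)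
    finally show ?thesis .
  qed
  have g2: "norm (Y t - 1) \<le> 1 / 2" if "t \<in> D" for t
    using gb[OF that] N(2)[of t] that by (simp add: D_def g_def)
  have x4: "norm (exp t) \<ge> 4" if "t \<in> D" for t
    unfolding norm_exp_eq_Re using exp_ge_add_one_self[of "Re t"] Re[OF that] by linarith
  define k b h where "k = (\<lambda>t. (1 / Y t + 1 / (Y t - exp t)) / 2)"
    and "b = (\<lambda>t. - exp t * (Y t - 1) / ((exp t - 1) * (Y t - exp t)))"
    and "h = (\<lambda>t. Y t / 2 * ((2 * \<mu> - 1)^2 * (Y t - exp t) / (exp t - 1)^2 + exp t / ((exp t - 1) * (Y t - exp t))))"
  define H where "H = 6 * norm (2 * \<mu> - 1)^2 + 3"
  have H: "H \<ge> 0" by (simp add: H_def)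
  have nz: "Y t \<noteq> 0" "Y t \<noteq> exp t" "exp t \<noteq> 1" and kb: "norm (k t) \<le> 2" "norm (b t) \<le> 2 / norm (exp t)"
      "norm (h t) \<le> H / norm (exp t)" if "t \<in> D" for t
    unfolding k_def b_def h_def H_def by (rule PVI_coeff_bounds_near_1[OF x4[OF that] g2[OF that]])+
  have Yh: "Y holomorphic_on D" using PVI_branch_logD(1)[OF br] sub(2) unfolding Y_def by (rule holomorphic_on_subset)
  have gh: "g holomorphic_on D" unfolding g_def by (intro holomorphic_intros Yh)
  have g1h: "deriv g holomorphic_on D" by (rule holomorphic_deriv[OF gh opD])
  have g2h: "deriv (deriv g) holomorphic_on D" by (rule holomorphic_deriv[OF g1h opD])
  have coeffh: "k holomorphic_on D" "b holomorphic_on D" "h holomorphic_on D"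
    unfolding k_def b_def h_def by (intro holomorphic_intros Yh; use nz in simp)+
  \<comment> \<open>Defined through the equation rather than as g'^2 / g, so that zeros of g cause
    no singularity.\<close>
  define E where "E = (\<lambda>t. 2 * (deriv (deriv g) t - k t * deriv g t ^ 2 - b t * deriv g t - h t * g t))"
  have Eh: "E holomorphic_on D" unfolding E_def by (intro holomorphic_intros coeffh gh g1h g2h)
  have dY: "deriv Y t = deriv g t" if "t \<in> D" for t
  proof (rule sym, rule DERIV_imp_deriv)
    show "(g has_field_derivative deriv Y t) (at t)"
      unfolding g_def using holomorphic_derivI[OF Yh opD that] by (auto intro!: derivative_eq_intros)
  qed
  have ddY: "deriv (deriv Y) t = deriv (deriv g) t" if "t \<in> D" for t
  proof (rule sym, rule DERIV_imp_deriv, rule has_field_derivative_transform_within_open[OF _ opD that])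
    show "(deriv Y has_field_derivative deriv (deriv Y) t) (at t)"
      by (rule holomorphic_derivI[OF holomorphic_deriv[OF Yh opD] opD that])
  qed (rule dY)
  have gE: "g t * E t = deriv g t ^ 2" if t: "t \<in> D" for t
  proof -
    have "PVI_eq \<mu> (exp t) (Y t) (deriv Y t / exp t) ((deriv (deriv Y) t - deriv Y t) / exp t ^ 2)"
      unfolding Y_def by (rule PVI_branch_logD(2)[OF br]) (use t sub in blast)
    from PVI_eq_square_form[OF exp_not_eq_zero nz(3,1,2) this, OF t t t] dY[OF t] ddY[OF t]
    show ?thesis by (simp add: g_def E_def k_def b_def h_def)
  qed
  have ddg: "deriv (deriv g) t = E t / 2 + k t * deriv g t ^ 2 + b t * deriv g t + h t * g t" for t
    by (simp add: E_def field_simps)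
  \<comment> \<open>Differentiate g E = g'^2 and insert g'' = E/2 + ...: the two terms g' E cancel,
    and replacing g'^2 by g E makes the rest divisible by g. The quotient is
    \<open>E'\<close>.\<close>
  define E' where "E' = (\<lambda>t. 2 * k t * deriv g t * E t + 2 * b t * E t + 2 * h t * deriv g t)"
  have gE': "g t * (deriv E t - E' t) = 0" if t: "t \<in> D" for t
  proof -
    have "((\<lambda>t. g t * E t) has_field_derivative deriv g t * E t + deriv E t * g t) (at t)"
      by (intro DERIV_mult holomorphic_derivI[OF gh opD t] holomorphic_derivI[OF Eh opD t])
    moreover have "((\<lambda>t. g t * E t) has_field_derivative 2 * deriv g t * deriv (deriv g) t) (at t)"
    proof (rule has_field_derivative_transform_within_open[OF _ opD t])
      show "((\<lambda>t. deriv g t ^ 2) has_field_derivative 2 * deriv g t * deriv (deriv g) t) (at t)"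
        using holomorphic_derivI[OF g1h opD t] by (auto intro!: derivative_eq_intros)
    qed (simp add: gE)
    ultimately have "deriv g t * E t + deriv E t * g t = deriv g t * (2 * deriv (deriv g) t)"
      using DERIV_unique by (fastforce simp: mult_ac)
    also have "2 * deriv (deriv g) t = E t + 2 * (k t * deriv g t ^ 2 + b t * deriv g t + h t * g t)"
      by (simp add: E_def algebra_simps)
    finally have "deriv g t * E t + deriv E t * g t =
      deriv g t * (E t + 2 * (k t * deriv g t ^ 2 + b t * deriv g t + h t * g t))" .
    hence "deriv E t * g t = 2 * k t * deriv g t * deriv g t ^ 2 + 2 * b t * deriv g t ^ 2 + 2 * h t * g t * deriv g t"
      by (simp add: algebra_simps power2_eq_square)
    thus ?thesis unfolding gE[OF t, symmetric] E'_def by (simp add: algebra_simps)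
  qed
  have "\<forall>\<^sub>F r in at_top. g (Complex r (\<phi> + pi)) = 0"
  proof (cases "\<forall>t\<in>D. g t = 0")
    case True
    thus ?thesis unfolding eventually_at_top_dense D_def using midline_in_log_strip by blast
  next
    case False
    \<comment> \<open>The factor g can be cancelled where it is nonzero, a nonempty open set in the
      present case; the identity theorem extends the result to \<open>D\<close>.\<close>
    have dE: "deriv E t = E' t" if "t \<in> D" for t
    proof (rule analytic_continuation_open[where f = "deriv E" and g = E' and s = "D \<inter> g -` (- {0})" and s' = D])
      show "open (D \<inter> g -` (- {0}))"
        by (rule continuous_open_preimage[OF holomorphic_on_imp_continuous_on[OF gh] opD]) (simp add: open_Compl)
      show "D \<inter> g -` (- {0}) \<noteq> {}" using False by auto
      show "deriv E holomorphic_on D" by (rule holomorphic_deriv[OF Eh opD])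
      show "E' holomorphic_on D" unfolding E'_def by (intro holomorphic_intros coeffh g1h Eh)
      show "deriv E t = E' t" if "t \<in> D \<inter> g -` (- {0})" for t using gE'[of t] that by auto
    qed (use opD conD that in auto)
    let ?t = "\<lambda>r. Complex r (\<phi> + pi)"
    \<comment> \<open>The summands bound k g', b and h relative to exp (-\<epsilon> r); the outer 2
      comes from the factors 2 in \<open>E'\<close>.\<close>
    define C\<^sub>1 K where "C\<^sub>1 = C * exp \<epsilon>" and "K = 2 * (2 * C\<^sub>1 + 2 + H)"
    have C1: "C\<^sub>1 \<ge> 0" by (simp add: C\<^sub>1_def C_def)
    have inD: "?t r \<in> D" if "r > N + 1" for r unfolding D_def by (rule midline_in_log_strip) (use that in simp)
    have gn: "norm ((deriv ^^ n) g (?t r)) \<le> (fact n * C * exp \<epsilon>) * exp (- \<epsilon> * r)" if "r > N + 1" for n r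
      by (rule midline_deriv_bound[OF gh[unfolded D_def]]) (use \<epsilon> gb that in \<open>auto simp: C_def D_def\<close>)
    have G: "norm (g (?t r)) \<le> C\<^sub>1 * exp (- \<epsilon> * r)" "norm (deriv g (?t r)) \<le> C\<^sub>1 * exp (- \<epsilon> * r)"
      "norm (deriv (deriv g) (?t r)) \<le> 2 * C\<^sub>1 * exp (- \<epsilon> * r)" if "r > N + 1" for r
      using gn[OF that, of 0] gn[OF that, of 1] gn[OF that, of 2] by (simp_all add: C\<^sub>1_def numeral_2_eq_2)
    have cf: "norm (b (?t r)) \<le> 2 * exp (- \<epsilon> * r)" "norm (h (?t r)) \<le> H * exp (- \<epsilon> * r)"
      "norm (k (?t r) * deriv g (?t r)) \<le> 2 * C\<^sub>1 * exp (- \<epsilon> * r)" if r: "r > N + 1" for r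
    proof -
      have "\<epsilon> * r \<le> 1 * r" using \<epsilon> r N(1) by (intro mult_right_mono) auto
      hence e: "1 / norm (exp (?t r)) \<le> exp (- \<epsilon> * r)" by (simp add: exp_minus inverse_eq_divide frac_le)
      show "norm (b (?t r)) \<le> 2 * exp (- \<epsilon> * r)" "norm (h (?t r)) \<le> H * exp (- \<epsilon> * r)"
        using kb(2,3)[OF inD[OF r]] mult_left_mono[OF e, of 2] mult_left_mono[OF e H] by simp_all
      show "norm (k (?t r) * deriv g (?t r)) \<le> 2 * C\<^sub>1 * exp (- \<epsilon> * r)"
        using mult_mono[OF kb(1)[OF inD[OF r]] G(2)[OF r]] by (simp add: norm_mult)
    qed
    have rest: "norm (k (?t r) * deriv g (?t r) ^ 2 + b (?t r) * deriv g (?t r) + h (?t r) * g (?t r))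
        \<le> K * exp (- \<epsilon> * r) * (norm (g (?t r)) + norm (deriv g (?t r)))" if r: "r > N + 1" for r
    proof -
      define \<delta> where "\<delta> = exp (- \<epsilon> * r)"
      have "norm (k (?t r) * deriv g (?t r) ^ 2 + b (?t r) * deriv g (?t r) + h (?t r) * g (?t r))
        \<le> (2 * C\<^sub>1 * \<delta>) * norm (deriv g (?t r)) + (2 * \<delta>) * norm (deriv g (?t r)) + (H * \<delta>) * norm (g (?t r))"
      proof (intro order_trans[OF norm_triangle_ineq] add_mono)
        have "norm (k (?t r) * deriv g (?t r) ^ 2) = norm (k (?t r) * deriv g (?t r)) * norm (deriv g (?t r))"
          by (simp add: norm_mult power2_eq_square)
        also have "\<dots> \<le> (2 * C\<^sub>1 * \<delta>) * norm (deriv g (?t r))"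
          unfolding \<delta>_def by (rule mult_right_mono[OF cf(3)[OF r]]) simp
        finally show "norm (k (?t r) * deriv g (?t r) ^ 2) \<le> (2 * C\<^sub>1 * \<delta>) * norm (deriv g (?t r))" .
        show "norm (b (?t r) * deriv g (?t r)) \<le> (2 * \<delta>) * norm (deriv g (?t r))"
          "norm (h (?t r) * g (?t r)) \<le> (H * \<delta>) * norm (g (?t r))"
          unfolding \<delta>_def norm_mult by (intro mult_right_mono cf[OF r] norm_ge_zero)+
      qed
      also have "\<dots> \<le> (K * \<delta>) * norm (deriv g (?t r)) + (K * \<delta>) * norm (g (?t r))"
        unfolding distrib_right[symmetric] using C1 H
        by (intro add_mono mult_right_mono) (auto simp: K_def \<delta>_def)
      finally show ?thesis by (simp add: \<delta>_def algebra_simps)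
    qed
    show ?thesis
    proof (rule nilpotent_decay[OF \<epsilon>(1), where f\<^sub>1 = "\<lambda>r. g (?t r)" and f\<^sub>2 = "\<lambda>r. deriv g (?t r)" and f\<^sub>3 = "\<lambda>r. E (?t r)"
          and d\<^sub>2 = "\<lambda>r. deriv (deriv g) (?t r)" and d\<^sub>3 = "\<lambda>r. deriv E (?t r)" and T = "N + 1" and K = K
          \<comment> \<open>\<open>C\<^sub>1\<close> serves g and g'. The bracket serves E, which is
            twice g'' minus the remainder: g'' contributes 2 \<open>C\<^sub>1\<close> by Cauchy's
            inequality, the remainder 2 K \<open>C\<^sub>1\<close>.\<close>
          and C = "C\<^sub>1 + (4 * C\<^sub>1 + 4 * K * C\<^sub>1)"])
      show K: "K \<ge> 0" using C1 H by (simp add: K_def)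
      fix r assume r: "r > N + 1"
      define \<delta> where "\<delta> = exp (- \<epsilon> * r)"
      have \<delta>: "\<delta> > 0" "\<delta> \<le> 1" using \<epsilon> r N(1) by (auto simp: \<delta>_def)
      note t = inD[OF r]
      show "((\<lambda>r. g (?t r)) has_vector_derivative deriv g (?t r)) (at r)"
        by (intro has_vector_derivative_horizontal holomorphic_derivI[OF gh opD t])
      show "((\<lambda>r. deriv g (?t r)) has_vector_derivative deriv (deriv g) (?t r)) (at r)"
        by (intro has_vector_derivative_horizontal holomorphic_derivI[OF g1h opD t])
      show "((\<lambda>r. E (?t r)) has_vector_derivative deriv E (?t r)) (at r)"
        by (intro has_vector_derivative_horizontal holomorphic_derivI[OF Eh opD t])
      have "norm (deriv (deriv g) (?t r)) \<le> norm (E (?t r) / 2)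
        + norm (k (?t r) * deriv g (?t r) ^ 2 + b (?t r) * deriv g (?t r) + h (?t r) * g (?t r))"
        unfolding ddg[of "?t r"] by (rule order_trans[OF _ norm_triangle_ineq]) (simp add: add.assoc)
      thus "norm (deriv (deriv g) (?t r)) \<le> norm (E (?t r)) / 2
        + K * exp (- \<epsilon> * r) * (norm (g (?t r)) + norm (deriv g (?t r)))"
        using rest[OF r] by (simp add: norm_divide)
      have "norm (deriv E (?t r)) \<le> (2 * (2 * C\<^sub>1 * \<delta>)) * norm (E (?t r)) + (2 * (2 * \<delta>)) * norm (E (?t r))
        + (2 * (H * \<delta>)) * norm (deriv g (?t r))"
        unfolding dE[OF t] E'_def
      proof (intro order_trans[OF norm_triangle_ineq] add_mono)
        have "norm (2 * k (?t r) * deriv g (?t r) * E (?t r)) = (2 * norm (k (?t r) * deriv g (?t r))) * norm (E (?t r))"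
          by (simp add: norm_mult)
        also have "\<dots> \<le> (2 * (2 * C\<^sub>1 * \<delta>)) * norm (E (?t r))"
          unfolding \<delta>_def by (intro mult_right_mono mult_left_mono cf(3)[OF r]) auto
        finally show "norm (2 * k (?t r) * deriv g (?t r) * E (?t r)) \<le> (2 * (2 * C\<^sub>1 * \<delta>)) * norm (E (?t r))" .
        show "norm (2 * b (?t r) * E (?t r)) \<le> (2 * (2 * \<delta>)) * norm (E (?t r))"
          "norm (2 * h (?t r) * deriv g (?t r)) \<le> (2 * (H * \<delta>)) * norm (deriv g (?t r))"
          unfolding \<delta>_def norm_mult norm_numeral by (intro mult_right_mono mult_left_mono cf[OF r] norm_ge_zero zero_le_numeral)+
      qed
      also have "\<dots> \<le> (K * \<delta>) * norm (E (?t r)) + (K * \<delta>) * norm (deriv g (?t r))"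
        unfolding distrib_right[symmetric] using C1 H \<delta>
        by (intro add_mono mult_right_mono) (auto simp: K_def algebra_simps)
      finally show "norm (deriv E (?t r)) \<le> K * exp (- \<epsilon> * r) * (norm (deriv g (?t r)) + norm (E (?t r)))"
        by (simp add: \<delta>_def algebra_simps)
      have CC: "c * \<delta> \<le> (C\<^sub>1 + (4 * C\<^sub>1 + 4 * K * C\<^sub>1)) * \<delta>" if "c \<le> C\<^sub>1 + (4 * C\<^sub>1 + 4 * K * C\<^sub>1)" for c
        using that \<delta> by (intro mult_right_mono) auto
      have c1: "C\<^sub>1 \<le> C\<^sub>1 + (4 * C\<^sub>1 + 4 * K * C\<^sub>1)" using C1 K by simp
      show "norm (g (?t r)) \<le> (C\<^sub>1 + (4 * C\<^sub>1 + 4 * K * C\<^sub>1)) * exp (- \<epsilon> * r)"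
        "norm (deriv g (?t r)) \<le> (C\<^sub>1 + (4 * C\<^sub>1 + 4 * K * C\<^sub>1)) * exp (- \<epsilon> * r)"
        using order_trans[OF G(1)[OF r] CC[OF c1, unfolded \<delta>_def]] order_trans[OF G(2)[OF r] CC[OF c1, unfolded \<delta>_def]] .
      have "E (?t r) = 2 * (deriv (deriv g) (?t r) -
        (k (?t r) * deriv g (?t r) ^ 2 + b (?t r) * deriv g (?t r) + h (?t r) * g (?t r)))"
        by (simp add: E_def algebra_simps)
      hence "norm (E (?t r)) \<le> 2 * (norm (deriv (deriv g) (?t r)) +
        norm (k (?t r) * deriv g (?t r) ^ 2 + b (?t r) * deriv g (?t r) + h (?t r) * g (?t r)))"
        by (simp only: norm_mult norm_numeral) (intro mult_left_mono norm_triangle_ineq4 zero_le_numeral)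
      also have "\<dots> \<le> 2 * (2 * C\<^sub>1 * \<delta> + K * 1 * (C\<^sub>1 * \<delta> + C\<^sub>1 * \<delta>))"
      proof (intro mult_left_mono add_mono order_trans[OF rest[OF r]])
        show "norm (deriv (deriv g) (?t r)) \<le> 2 * C\<^sub>1 * \<delta>" using G(3)[OF r] by (simp add: \<delta>_def)
        show "K * exp (- \<epsilon> * r) * (norm (g (?t r)) + norm (deriv g (?t r))) \<le> K * 1 * (C\<^sub>1 * \<delta> + C\<^sub>1 * \<delta>)"
          using K \<delta> G(1,2)[OF r] unfolding \<delta>_def by (intro mult_mono mult_left_mono add_mono) auto
      qed simp
      also have "\<dots> = (4 * C\<^sub>1 + 4 * K * C\<^sub>1) * \<delta>" by (simp add: algebra_simps)
      also have "\<dots> \<le> (C\<^sub>1 + (4 * C\<^sub>1 + 4 * K * C\<^sub>1)) * \<delta>" by (rule CC) (use C1 in simp)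
      finally show "norm (E (?t r)) \<le> (C\<^sub>1 + (4 * C\<^sub>1 + 4 * K * C\<^sub>1)) * exp (- \<epsilon> * r)" by (simp add: \<delta>_def)
    qed
  qed
  thus ?thesis by (simp add: g_def Y_def)
qed

theorem theorem2p2:
  fixes \<mu> a :: complex and \<sigma> \<phi> :: real
  assumes "2 * \<mu> \<notin> \<int>"
    and "a \<noteq> 0"
    and "0 \<le> \<sigma>" and "\<sigma> < 1"
  shows "(\<exists>R y. PVI_branch \<mu> \<phi> R y \<and> PVI_asymptotics \<phi> R a \<sigma> y) \<and>
         (\<forall>R\<^sub>1 y\<^sub>1 R\<^sub>2 y\<^sub>2.
            PVI_branch \<mu> \<phi> R\<^sub>1 y\<^sub>1 \<and> PVI_asymptotics \<phi> R\<^sub>1 a \<sigma> y\<^sub>1 \<and>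
            PVI_branch \<mu> \<phi> R\<^sub>2 y\<^sub>2 \<and> PVI_asymptotics \<phi> R\<^sub>2 a \<sigma> y\<^sub>2 \<longrightarrow>
            (\<forall>x\<in>cut_nhd_infinity \<phi> (max R\<^sub>1 R\<^sub>2). y\<^sub>1 x = y\<^sub>2 x))"
proof (intro conjI allI impI ballI)
  show "\<exists>R y. PVI_branch \<mu> \<phi> R y \<and> PVI_asymptotics \<phi> R a \<sigma> y"
    using assms(2-4) by (rule PVI_branch_exists)
next
  fix R\<^sub>1 y\<^sub>1 R\<^sub>2 y\<^sub>2 x
  assume asm: "PVI_branch \<mu> \<phi> R\<^sub>1 y\<^sub>1 \<and> PVI_asymptotics \<phi> R\<^sub>1 a \<sigma> y\<^sub>1 \<and>
    PVI_branch \<mu> \<phi> R\<^sub>2 y\<^sub>2 \<and> PVI_asymptotics \<phi> R\<^sub>2 a \<sigma> y\<^sub>2"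
    and x: "x \<in> cut_nhd_infinity \<phi> (max R\<^sub>1 R\<^sub>2)"
  have br: "PVI_branch \<mu> \<phi> R\<^sub>1 y\<^sub>1" "PVI_branch \<mu> \<phi> R\<^sub>2 y\<^sub>2"
    and asy: "PVI_asymptotics \<phi> R\<^sub>1 a \<sigma> y\<^sub>1" "PVI_asymptotics \<phi> R\<^sub>2 a \<sigma> y\<^sub>2" using asm by auto
  have R: "R\<^sub>1 \<ge> 1" "R\<^sub>2 \<ge> 1" using br by (auto simp: PVI_branch_def)
  have ev: "\<forall>\<^sub>F r in at_top. y\<^sub>1 (exp (Complex r (\<phi> + pi))) = y\<^sub>2 (exp (Complex r (\<phi> + pi)))"
  proof (cases "\<sigma> = 0 \<and> a = 1")
    case True
    have "\<forall>\<^sub>F r in at_top. y\<^sub>1 (exp (Complex r (\<phi> + pi))) = 1" "\<forall>\<^sub>F r in at_top. y\<^sub>2 (exp (Complex r (\<phi> + pi))) = 1"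
      using PVI_branch_unique_at_1 br asy True by auto
    thus ?thesis by eventually_elim simp
  next
    case False
    show ?thesis by (rule PVI_branch_unique_generic[OF assms(2-4) False br(1) asy(1) br(2) asy(2)])
  qed
  let ?N = "ln (max R\<^sub>1 R\<^sub>2)"
  have t: "cut_Ln \<phi> x \<in> log_strip \<phi> ?N" by (rule cut_Ln_in_log_strip[OF _ x]) (use R in auto)
  \<comment> \<open>In the logarithmic chart the common domain is a connected strip containing a
    tail of the middle ray, so agreement there spreads to all of it.\<close>
  have "y\<^sub>1 (exp (cut_Ln \<phi> x)) = y\<^sub>2 (exp (cut_Ln \<phi> x))"
  proof (rule eq_on_log_strip[OF _ _ ev t])
    show "(\<lambda>t. y\<^sub>1 (exp t)) holomorphic_on log_strip \<phi> ?N"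
      by (rule holomorphic_on_subset[OF PVI_branch_logD(1)[OF br(1)] log_strip_mono]) (use R in auto)
    show "(\<lambda>t. y\<^sub>2 (exp t)) holomorphic_on log_strip \<phi> ?N"
      by (rule holomorphic_on_subset[OF PVI_branch_logD(1)[OF br(2)] log_strip_mono]) (use R in auto)
  qed
  moreover have "x \<noteq> 0" using x R by (auto simp: cut_nhd_infinity_def)
  ultimately show "y\<^sub>1 x = y\<^sub>2 x" by (simp add: exp_cut_Ln)
qed

end
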